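(* Let (S) be an arbitrary linear system of two second order ordinary differential equations $$\mathbf y''+A_1(x)\,\mathbf y'+A_0(x)\,\mathbf y=\mathbf b(x),\qquad \mathbf y=(y_1,y_2)\in\mathbb R^2,$$ where $A_0,A_1$ are $2\times 2$ real matrix-valued smooth functions and $\mathbf b$ is an $\mathbb R^2$-valued smooth function on an open interval $I$. Then (S) is reducible by a point transformation to the trivial equation $\mathbf y''=0$, $\mathbf y\in\mathbb R^2$, if and only if it admits a non-Cartan symmetry.
   Context: A (Lie point) symmetry of (S), written as $\Delta=(\Delta_1,\Delta_2)=0$, is a smooth vector field $$\mathbf v=\xi(x,\mathbf y)\,\frac{\partial}{\partial x}+\sum_{j=1}^2\phi_j(x,\mathbf y)\,\frac{\partial}{\partial y_j}$$ on $I\times\mathbb R^2$ satisfying $\mathbf v^{(2)}(\Delta_\nu)\big|_{\Delta=0}=0$ for $\nu=1,2$, where $\mathbf v^{(2)}$ is the second prolongation of $\mathbf v$ to the jet space. The symmetry is called non-Cartan if $\xi$ depends explicitly on at least one of the dependent variables $y_1,y_2$ (i.e. some $\partial\xi/\partial y_j$ is not identically zero). A point transformation is an invertible smooth change of the independent and dependent variables $(x,\mathbf y)\mapsto(z,\mathbf w)$. As usual in Lie symmetry theory, reducibility by a point transformation is understood locally: in a neighbourhood of every point of $I\times\mathbb R^2$ there is such a change of variables transforming (S) into $d^2\mathbf w/dz^2=0$. *)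

theory Defs
  imports "HOL-Analysis.Analysis"
begin

primrec Ck_on :: "nat \<Rightarrow> ('a::euclidean_space \<Rightarrow> 'b::real_normed_vector) \<Rightarrow> 'a set \<Rightarrow> bool" where
  "Ck_on 0 f S \<longleftrightarrow> continuous_on S f"
| "Ck_on (Suc k) f S \<longleftrightarrow>
     (\<forall>x\<in>S. f differentiable (at x)) \<and>
     (\<forall>v. Ck_on k (\<lambda>x. frechet_derivative f (at x) v) S)"

(* Derivatives are taken in the full space, so this is meant for open S only. *)
definition smooth_on :: "('a::euclidean_space \<Rightarrow> 'b::real_normed_vector) \<Rightarrow> 'a set \<Rightarrow> bool" where
  "smooth_on f S \<longleftrightarrow> (\<forall>k. Ck_on k f S)"

(* Coordinates on the jet spaces of functions y(x): points (x, y), first-order jets (x, y, y')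
   and second-order jets (x, y, y', y''). *)
type_synonym point = "real \<times> (real^2)"
type_synonym jet1 = "real \<times> (real^2) \<times> (real^2)"
type_synonym jet2 = "real \<times> (real^2) \<times> (real^2) \<times> (real^2)"

(* The total derivative D_x = d/dx + y' d/dy, as a directional derivative. *)
definition Dx0 :: "(point \<Rightarrow> 'b::real_normed_vector) \<Rightarrow> jet1 \<Rightarrow> 'b" where
  "Dx0 f = (\<lambda>(x, y, y1). frechet_derivative f (at (x, y)) (1, y1))"

(* The total derivative D_x = d/dx + y' d/dy + y'' d/dy' of a function of the first-order jet. *)
definition Dx1 :: "(jet1 \<Rightarrow> 'b::real_normed_vector) \<Rightarrow> jet2 \<Rightarrow> 'b" where
  "Dx1 f = (\<lambda>(x, y, y1, y2). frechet_derivative f (at (x, y, y1)) (1, y1, y2))"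

(* The left-hand side minus the right-hand side of y'' + A1 y' + A0 y = b. *)
definition lin_sys ::
    "(real \<Rightarrow> real^2^2) \<Rightarrow> (real \<Rightarrow> real^2^2) \<Rightarrow> (real \<Rightarrow> real^2) \<Rightarrow> jet2 \<Rightarrow> real^2" where
  "lin_sys A1 A0 b = (\<lambda>(x, y, y1, y2). y2 + A1 x *v y1 + A0 x *v y - b x)"

(* A vector field on point space is a pair (xi, phi), standing for
   xi d/dx + phi_1 d/dy_1 + phi_2 d/dy_2. Coefficient of d/dy' in its prolongation:
   D_x phi - (D_x xi) y'. *)
definition prolong1 :: "(point \<Rightarrow> real) \<Rightarrow> (point \<Rightarrow> real^2) \<Rightarrow> jet1 \<Rightarrow> real^2" where
  "prolong1 \<xi> \<phi> = (\<lambda>(x, y, y1). Dx0 \<phi> (x, y, y1) - Dx0 \<xi> (x, y, y1) *\<^sub>R y1)"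

(* Coefficient of d/dy'' in the second prolongation: D_x (prolong1) - (D_x xi) y''. *)
definition prolong2 :: "(point \<Rightarrow> real) \<Rightarrow> (point \<Rightarrow> real^2) \<Rightarrow> jet2 \<Rightarrow> real^2" where
  "prolong2 \<xi> \<phi> = (\<lambda>(x, y, y1, y2).
     Dx1 (prolong1 \<xi> \<phi>) (x, y, y1, y2) - Dx0 \<xi> (x, y, y1) *\<^sub>R y2)"

definition apply_prolonged ::
    "(point \<Rightarrow> real) \<Rightarrow> (point \<Rightarrow> real^2) \<Rightarrow> (jet2 \<Rightarrow> real^2) \<Rightarrow> jet2 \<Rightarrow> real^2" where
  "apply_prolonged \<xi> \<phi> \<Delta> = (\<lambda>(x, y, y1, y2).
     frechet_derivative \<Delta> (at (x, y, y1, y2))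
       (\<xi> (x, y), \<phi> (x, y), prolong1 \<xi> \<phi> (x, y, y1), prolong2 \<xi> \<phi> (x, y, y1, y2)))"

definition lie_symmetry ::
    "real set \<Rightarrow> (jet2 \<Rightarrow> real^2) \<Rightarrow> (point \<Rightarrow> real) \<Rightarrow> (point \<Rightarrow> real^2) \<Rightarrow> bool" where
  "lie_symmetry I \<Delta> \<xi> \<phi> \<longleftrightarrow>
     smooth_on \<xi> (I \<times> UNIV) \<and> smooth_on \<phi> (I \<times> UNIV) \<and>
     (\<forall>x\<in>I. \<forall>y y1 y2. \<Delta> (x, y, y1, y2) = 0 \<longrightarrow>
        apply_prolonged \<xi> \<phi> \<Delta> (x, y, y1, y2) = 0)"

definition non_Cartan :: "real set \<Rightarrow> (point \<Rightarrow> real) \<Rightarrow> bool" where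
  "non_Cartan I \<xi> \<longleftrightarrow>
     (\<exists>j. \<exists>x\<in>I. \<exists>y. frechet_derivative \<xi> (at (x, y)) (0, axis j 1) \<noteq> 0)"

definition diffeo_on :: "point set \<Rightarrow> (point \<Rightarrow> point) \<Rightarrow> bool" where
  "diffeo_on U \<Psi> \<longleftrightarrow>
     (\<exists>V \<Theta>. open U \<and> open V \<and> homeomorphism U V \<Psi> \<Theta> \<and> smooth_on \<Psi> U \<and> smooth_on \<Theta> V)"

(* Chain rule for the change of variables z = Z(x, y), w = W(x, y):
   dw/dz = D_x W / D_x Z and d^2w/dz^2 = D_x (dw/dz) / D_x Z, meaningful where D_x Z is nonzero. *)
definition new_deriv1 :: "(point \<Rightarrow> point) \<Rightarrow> jet1 \<Rightarrow> real^2" where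
  "new_deriv1 \<Psi> = (\<lambda>J. Dx0 (snd \<circ> \<Psi>) J /\<^sub>R Dx0 (fst \<circ> \<Psi>) J)"

definition new_deriv2 :: "(point \<Rightarrow> point) \<Rightarrow> jet2 \<Rightarrow> real^2" where
  "new_deriv2 \<Psi> = (\<lambda>(x, y, y1, y2).
     Dx1 (new_deriv1 \<Psi>) (x, y, y1, y2) /\<^sub>R Dx0 (fst \<circ> \<Psi>) (x, y, y1))"

(* The system Delta = 0 over U becomes d^2w/dz^2 = 0 in the new variables. Jets at which
   D_x Z = 0, where the transformed curve is not a graph over the z-axis, are left out. As the
   differential of Z never vanishes, over each point these form a proper affine subspace
   (possibly empty) of the values of y'. *)
definition transforms_to_trivial :: "point set \<Rightarrow> (jet2 \<Rightarrow> real^2) \<Rightarrow> (point \<Rightarrow> point) \<Rightarrow> bool" where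
  "transforms_to_trivial U \<Delta> \<Psi> \<longleftrightarrow>
     (\<forall>x y y1 y2. (x, y) \<in> U \<and> Dx0 (fst \<circ> \<Psi>) (x, y, y1) \<noteq> 0 \<longrightarrow>
        (\<Delta> (x, y, y1, y2) = 0 \<longleftrightarrow> new_deriv2 \<Psi> (x, y, y1, y2) = 0))"

definition reducible_to_trivial :: "real set \<Rightarrow> (jet2 \<Rightarrow> real^2) \<Rightarrow> bool" where
  "reducible_to_trivial I \<Delta> \<longleftrightarrow>
     (\<forall>P \<in> I \<times> UNIV. \<exists>U \<Psi>. P \<in> U \<and> U \<subseteq> I \<times> UNIV \<and>
        diffeo_on U \<Psi> \<and> transforms_to_trivial U \<Delta> \<Psi>)"

end

theory Submission
  imports Defs
begin

text \<open>A gauge \<open>y = p + T u\<close>, with \<open>p\<close> a particular solution and \<open>T' = - A1 T / 2\<close>, turns the system into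
  \<open>u'' + Q u = 0\<close>; the inverse of \<open>T\<close> is \<open>S\<close>. Both conditions are equivalent to \<open>Q x\<close> being a multiple of the identity for every \<open>x\<close>.

  If \<open>(\<xi>, \<phi>)\<close> is a symmetry, then \<open>\<phi> - \<xi> u'\<close> solves the system along every solution \<open>u\<close>. Comparing powers
  of \<open>u'\<close> gives \<open>\<xi> = \<alpha> \<bullet> u + \<beta>\<close>, and the part of \<open>\<phi> - \<xi> u'\<close> that is quadratic in the solution is
  \<open>(\<alpha>' \<bullet> u) u - (\<alpha> \<bullet> u) u'\<close>. That this solves the system forces \<open>\<alpha>'' = - Q\<^sup>T \<alpha>\<close>, and \<open>Q\<close> to be scalar wherever
  \<open>\<alpha> \<noteq> 0\<close>; the zeros of \<open>\<alpha>\<close> are isolated. Conversely, for scalar \<open>Q\<close> any solution \<open>\<alpha>\<close> gives a symmetry.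

  If the system is reducible, the pencil of solution curves through a point with initial velocities in a
  plane is mapped into a plane. A solution curve that is tangent to this surface at another point stays in
  it, so solutions \<open>h\<close>, \<open>k\<close> with \<open>h(x0) = 0\<close>, \<open>k(x1) = 0\<close>, \<open>k'(x1) = h(x1)\<close> are parallel, which makes \<open>h\<close> and
  \<open>h'\<close>, hence \<open>h\<close> and \<open>Q h\<close>, parallel. Conversely, for \<open>Q = q\<close> scalar take \<open>z = s / c\<close>, \<open>w = u / c\<close> with
  solutions \<open>c\<close>, \<open>s\<close> of \<open>f'' + q f = 0\<close>.\<close>

section \<open>Smooth functions\<close>

text \<open>Reducibility is a local notion, whereas a symmetry must live on all of
  \<open>I \<times> UNIV\<close>: pulling a symmetry of the trivial equation back through a
  transformation would produce it near one point only. Scalarity of \<open>Q x\<close> mediates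
  between the two. It is a condition at each single x, so a transformation near one point over x
  suffices to prove it; and it turns every solution \<alpha>, which exists on the whole interval,
  into a global symmetry. In the opposite direction the quotients by c make sense only where c has
  no zero, which is all that the local notion asks for. Scalarity is tested by
  \<open>wedge (Q x *v v) v = 0\<close> for all v, because a matrix for which every nonzero vector
  is an eigenvector is a multiple of the identity.

  The plane in the reducible case comes from the trivial equation: its solution curves are straight
  lines, and the lines through one point with directions in a plane stay in that plane. The argument
  uses only that solution curves become straight lines.\<close>

lemma Ck_on_cong_aux:
  assumes "open S"
  shows "(\<And>x. x \<in> S \<Longrightarrow> f x = g x) \<Longrightarrow> Ck_on k f S \<Longrightarrow> Ck_on k g S"
proof (induction k arbitrary: f g)
  case 0
  then show ?case
    by (metis Ck_on.simps(1) continuous_on_cong)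
next
  case (Suc k)
  have diff: "f differentiable (at x)" if "x \<in> S" for x
    using Suc.prems that by simp
  have D: "(g has_derivative frechet_derivative f (at x)) (at x)" if "x \<in> S" for x
    using diff[OF that] Suc.prems(1) assms that
    by (metis frechet_derivative_works has_derivative_transform_within_open)
  have eq: "frechet_derivative g (at x) = frechet_derivative f (at x)" if "x \<in> S" for x
    using D[OF that] frechet_derivative_at by metis
  have "Ck_on k (\<lambda>x. frechet_derivative g (at x) v) S" for v
    by (rule Suc.IH[of "\<lambda>x. frechet_derivative f (at x) v"]) (use Suc.prems eq in auto)
  then show ?case
    using D by (auto simp: differentiable_def)
qed

lemma Ck_on_cong:
  assumes "open S" "\<And>x. x \<in> S \<Longrightarrow> f x = g x"
  shows "Ck_on k f S \<longleftrightarrow> Ck_on k g S"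
proof
  show "Ck_on k f S \<Longrightarrow> Ck_on k g S"
    by (rule Ck_on_cong_aux[OF assms])
  show "Ck_on k g S \<Longrightarrow> Ck_on k f S"
    by (rule Ck_on_cong_aux[OF assms(1) assms(2)[symmetric]])
qed

text \<open>Regularity is proved below from derivatives known by formula; uniqueness of the
  derivative identifies them with the \<open>frechet_derivative\<close> of the definition.\<close>

lemma Ck_on_SucI:
  assumes "open S" "\<And>x. x \<in> S \<Longrightarrow> (f has_derivative f' x) (at x)"
    and "\<And>v. Ck_on k (\<lambda>x. f' x v) S"
  shows "Ck_on (Suc k) f S"
proof -
  have eq: "frechet_derivative f (at x) = f' x" if "x \<in> S" for x
    using assms(2)[OF that] frechet_derivative_at by metis
  have "Ck_on k (\<lambda>x. frechet_derivative f (at x) v) S" for v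
    using assms(3)[of v] Ck_on_cong[OF assms(1), of "\<lambda>x. frechet_derivative f (at x) v" "\<lambda>x. f' x v"] eq
    by simp
  then show ?thesis
    using assms(2) by (auto simp: differentiable_def)
qed

lemma Ck_on_Suc_has_derivative:
  "Ck_on (Suc k) f S \<Longrightarrow> x \<in> S \<Longrightarrow> (f has_derivative frechet_derivative f (at x)) (at x)"
  by (simp add: frechet_derivative_works[symmetric])

lemma Ck_on_lower: "Ck_on (Suc k) f S \<Longrightarrow> Ck_on k f S"
proof (induction k arbitrary: f)
  case 0
  then show ?case
    by (auto intro!: continuous_at_imp_continuous_on differentiable_imp_continuous_within)
next
  case (Suc k)
  then show ?case by (simp only: Ck_on.simps(2)) blast
qed

lemma Ck_on_const: "open S \<Longrightarrow> Ck_on k (\<lambda>x. c) S"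
proof (induction k arbitrary: c)
  case (Suc k)
  show ?case
    by (rule Ck_on_SucI[where f' = "\<lambda>x v. 0"]) (use Suc in auto)
qed auto

lemma Ck_on_bounded_linear:
  assumes "open S" "bounded_linear L"
  shows "Ck_on k L S"
proof (cases k)
  case 0
  then show ?thesis
    using assms by (simp add: linear_continuous_on)
next
  case (Suc m)
  show ?thesis unfolding Suc
    by (rule Ck_on_SucI[where f' = "\<lambda>x. L"])
       (use assms bounded_linear_imp_has_derivative Ck_on_const in auto)
qed

lemma Ck_on_add:
  assumes "open S"
  shows "Ck_on k f S \<Longrightarrow> Ck_on k g S \<Longrightarrow> Ck_on k (\<lambda>x. f x + g x) S"
proof (induction k arbitrary: f g)
  case 0
  then show ?case by (simp add: continuous_on_add)
next
  case (Suc k)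
  show ?case
    by (rule Ck_on_SucI[OF assms has_derivative_add[OF Ck_on_Suc_has_derivative[OF Suc.prems(1)]
            Ck_on_Suc_has_derivative[OF Suc.prems(2)]]])
       (use Suc in auto)
qed

lemma Ck_on_sum:
  assumes "open S" "finite B" "\<And>b. b \<in> B \<Longrightarrow> Ck_on k (f b) S"
  shows "Ck_on k (\<lambda>x. \<Sum>b\<in>B. f b x) S"
  using assms(2,3)
proof (induction B rule: finite_induct)
  case empty
  then show ?case using Ck_on_const[OF assms(1), of k 0] by simp
next
  case (insert b B)
  then show ?case
    using Ck_on_add[OF assms(1), of k "f b" "\<lambda>x. \<Sum>b\<in>B. f b x"] by simp
qed

lemma Ck_on_bilinear:
  assumes "open S" "bounded_bilinear B"
  shows "Ck_on k f S \<Longrightarrow> Ck_on k g S \<Longrightarrow> Ck_on k (\<lambda>x. B (f x) (g x)) S"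
proof (induction k arbitrary: f g)
  case 0
  then show ?case using bounded_bilinear.continuous_on[OF assms(2)] by auto
next
  case (Suc k)
  show ?case
  proof (rule Ck_on_SucI[OF assms(1) bounded_bilinear.FDERIV[OF assms(2)
            Ck_on_Suc_has_derivative[OF Suc.prems(1)] Ck_on_Suc_has_derivative[OF Suc.prems(2)]]])
    fix v
    show "Ck_on k (\<lambda>x. B (f x) (frechet_derivative g (at x) v) + B (frechet_derivative f (at x) v) (g x)) S"
      using Suc.prems Ck_on_lower[OF Suc.prems(1)] Ck_on_lower[OF Suc.prems(2)]
      by (intro Ck_on_add[OF assms(1)] Suc.IH) auto
  qed auto
qed

lemma Ck_on_compose:
  assumes "open S" "open R"
  shows "Ck_on k f R \<Longrightarrow> Ck_on k g S \<Longrightarrow> g ` S \<subseteq> R \<Longrightarrow> Ck_on k (\<lambda>x. f (g x)) S"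
proof (induction k arbitrary: f g)
  case 0
  then show ?case using continuous_on_compose2 by auto
next
  case (Suc k)
  have Df: "(f has_derivative frechet_derivative f (at y)) (at y)" if "y \<in> R" for y
    using Ck_on_Suc_has_derivative[OF Suc.prems(1) that] .
  show ?case
  proof (rule Ck_on_SucI[OF assms(1),
        where f' = "\<lambda>x v. frechet_derivative f (at (g x)) (frechet_derivative g (at x) v)"])
    show "((\<lambda>x. f (g x)) has_derivative
       (\<lambda>v. frechet_derivative f (at (g x)) (frechet_derivative g (at x) v))) (at x)" if "x \<in> S" for x
      using has_derivative_compose[OF Ck_on_Suc_has_derivative[OF Suc.prems(2) that]
          Df[of "g x"]] that Suc.prems(3) by auto
  next
    fix v
    \<comment> \<open>The hypothesis on f controls derivatives in fixed directions, but here the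
      direction moves with x. Expanding it in the basis leaves fixed directions b with scalar
      coefficients, to which the induction hypothesis and the product rule apply.\<close>
    have eq: "frechet_derivative f (at (g x)) (frechet_derivative g (at x) v) =
       (\<Sum>b\<in>Basis. (frechet_derivative g (at x) v \<bullet> b) *\<^sub>R frechet_derivative f (at (g x)) b)"
      if "x \<in> S" for x
    proof -
      have lin: "linear (frechet_derivative f (at (g x)))"
        using Df[of "g x"] that Suc.prems(3) has_derivative_linear by blast
      show ?thesis
        by (subst euclidean_representation[of "frechet_derivative g (at x) v", symmetric])
           (simp add: linear_sum[OF lin] linear_scale[OF lin])
    qed
    have "Ck_on k (\<lambda>x. \<Sum>b\<in>Basis. (frechet_derivative g (at x) v \<bullet> b) *\<^sub>R
              frechet_derivative f (at (g x)) b) S"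
    proof (intro Ck_on_sum[OF assms(1)] Ck_on_bilinear[OF assms(1) bounded_bilinear_scaleR]
             Ck_on_bilinear[OF assms(1) bounded_bilinear_inner] Ck_on_const[OF assms(1)])
      show "Ck_on k (\<lambda>x. frechet_derivative f (at (g x)) b) S" for b
        by (rule Suc.IH) (use Suc.prems Ck_on_lower[OF Suc.prems(2)] in auto)
    qed (use Suc.prems in auto)
    then show "Ck_on k (\<lambda>x. frechet_derivative f (at (g x)) (frechet_derivative g (at x) v)) S"
      using Ck_on_cong[of S "\<lambda>x. frechet_derivative f (at (g x)) (frechet_derivative g (at x) v)", OF assms(1) eq]
      by blast
  qed
qed

lemma smooth_on_cong:
  assumes "open S" "\<And>x. x \<in> S \<Longrightarrow> f x = g x"
  shows "smooth_on f S \<longleftrightarrow> smooth_on g S"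
  unfolding smooth_on_def using Ck_on_cong[OF assms] by simp

lemma smooth_on_subset: 
  assumes "smooth_on f S" "R \<subseteq> S"
  shows "smooth_on f R"
proof -
  have "Ck_on k f S \<Longrightarrow> Ck_on k f R" for k
  proof (induction k arbitrary: f)
    case 0
    then show ?case using continuous_on_subset[OF _ assms(2)] by simp
  next
    case (Suc k)
    then show ?case using assms(2) by auto
  qed
  then show ?thesis using assms(1) by (auto simp: smooth_on_def)
qed

lemma smooth_on_has_derivative:
  "smooth_on f S \<Longrightarrow> x \<in> S \<Longrightarrow> (f has_derivative frechet_derivative f (at x)) (at x)"
  by (rule Ck_on_Suc_has_derivative[of 0]) (simp_all only: smooth_on_def)

lemma smooth_on_frechet:
  "smooth_on f S \<Longrightarrow> smooth_on (\<lambda>x. frechet_derivative f (at x) v) S"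
  unfolding smooth_on_def using Ck_on.simps(2) by blast

lemma smooth_on_continuous_on: "smooth_on f S \<Longrightarrow> continuous_on S f"
  unfolding smooth_on_def using Ck_on.simps(1) by blast

lemma smooth_on_const: "open S \<Longrightarrow> smooth_on (\<lambda>x. c) S"
  by (simp add: smooth_on_def Ck_on_const)

lemma smooth_on_bounded_linear: "open S \<Longrightarrow> bounded_linear L \<Longrightarrow> smooth_on L S"
  by (simp add: smooth_on_def Ck_on_bounded_linear)

lemma smooth_on_add:
  "open S \<Longrightarrow> smooth_on f S \<Longrightarrow> smooth_on g S \<Longrightarrow> smooth_on (\<lambda>x. f x + g x) S"
  by (simp add: smooth_on_def Ck_on_add)

lemma smooth_on_bilinear:
  "open S \<Longrightarrow> bounded_bilinear B \<Longrightarrow> smooth_on f S \<Longrightarrow> smooth_on g S \<Longrightarrow>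
    smooth_on (\<lambda>x. B (f x) (g x)) S"
  by (simp add: smooth_on_def Ck_on_bilinear)

lemma smooth_on_compose:
  "open S \<Longrightarrow> open R \<Longrightarrow> smooth_on f R \<Longrightarrow> smooth_on g S \<Longrightarrow> (\<And>x. x \<in> S \<Longrightarrow> g x \<in> R) \<Longrightarrow>
    smooth_on (\<lambda>x. f (g x)) S"
  unfolding smooth_on_def by (blast intro: Ck_on_compose)

lemma smooth_on_linear_compose:
  fixes f :: "'a::euclidean_space \<Rightarrow> 'b::euclidean_space"
  assumes "open S" "bounded_linear L" "smooth_on f S"
  shows "smooth_on (\<lambda>x. L (f x)) S"
  using smooth_on_compose[OF assms(1) open_UNIV smooth_on_bounded_linear[OF open_UNIV assms(2)] assms(3)]
  by simp

lemma smooth_on_diff: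
  fixes f g :: "'a::euclidean_space \<Rightarrow> 'b::euclidean_space"
  assumes "open S" "smooth_on f S" "smooth_on g S"
  shows "smooth_on (\<lambda>x. f x - g x) S"
  using smooth_on_add[OF assms(1,2) smooth_on_linear_compose[OF assms(1)
        bounded_linear_minus[OF bounded_linear_ident] assms(3)]] by simp

lemma smooth_on_Pair:
  fixes f :: "'a::euclidean_space \<Rightarrow> 'b::euclidean_space" and g :: "'a \<Rightarrow> 'c::euclidean_space"
  assumes "open S" "smooth_on f S" "smooth_on g S"
  shows "smooth_on (\<lambda>x. (f x, g x)) S"
proof -
  have "bounded_linear (\<lambda>b::'b. (b, 0::'c))" "bounded_linear (\<lambda>c::'c. (0::'b, c))"
    by (intro bounded_linear_Pair bounded_linear_ident bounded_linear_zero)+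
  from smooth_on_add[OF assms(1) smooth_on_linear_compose[OF assms(1) this(1) assms(2)]
      smooth_on_linear_compose[OF assms(1) this(2) assms(3)]]
  show ?thesis by simp
qed

text \<open>The derivative of \<open>inverse\<close> is a product of two copies of
  \<open>inverse\<close> and a constant, so each order of regularity yields the next one.\<close>

lemma smooth_on_inverse:
  assumes "open S" "smooth_on f S" "\<And>x. x \<in> S \<Longrightarrow> f x \<noteq> (0::real)"
  shows "smooth_on (\<lambda>x. inverse (f x)) S"
proof -
  have op: "open (- {0::real})" by auto
  have "Ck_on k inverse (- {0::real})" for k
  proof (induction k)
    case 0
    then show ?case by (auto intro!: continuous_intros)
  next
    case (Suc k)
    show ?case
    proof (rule Ck_on_SucI[OF op])
      show "(inverse has_derivative (\<lambda>h. - (inverse x * h * inverse x))) (at x)"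
        if "x \<in> - {0::real}" for x
        using that by (auto intro!: has_derivative_inverse')
      show "Ck_on k (\<lambda>x::real. - (inverse x * v * inverse x)) (- {0})" for v
        using Ck_on_bilinear[OF op bounded_bilinear_mult, of k inverse
            "\<lambda>x. (- v) * inverse x", OF Suc Ck_on_bilinear[OF op bounded_bilinear_mult
              Ck_on_const[OF op] Suc]]
        by (simp add: mult.assoc)
    qed
  qed
  then have "smooth_on inverse (- {0::real})" by (simp add: smooth_on_def)
  from smooth_on_compose[OF assms(1) op this assms(2)] assms(3) show ?thesis by auto
qed

text \<open>Total derivatives have this form: the direction (1, y') depends on the jet. As for
  compositions, the moving direction is expanded in the basis.\<close>

lemma smooth_on_frechet_apply:
  fixes f :: "'a::euclidean_space \<Rightarrow> 'b::real_normed_vector"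
  assumes "open S" "open R" "smooth_on f R" "smooth_on g S" "smooth_on h S"
    and "\<And>x. x \<in> S \<Longrightarrow> g x \<in> R"
  shows "smooth_on (\<lambda>x. frechet_derivative f (at (g x)) (h x)) S"
proof -
  have "smooth_on (\<lambda>x. (h x \<bullet> b) *\<^sub>R frechet_derivative f (at (g x)) b) S" for b
    by (intro smooth_on_bilinear[OF assms(1) bounded_bilinear_scaleR]
        smooth_on_bilinear[OF assms(1) bounded_bilinear_inner] smooth_on_const assms
        smooth_on_compose[OF assms(1,2) smooth_on_frechet[OF assms(3)] assms(4)])
  then have "smooth_on (\<lambda>x. \<Sum>b\<in>Basis. (h x \<bullet> b) *\<^sub>R frechet_derivative f (at (g x)) b) S"
    by (simp add: smooth_on_def Ck_on_sum[OF assms(1)])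
  moreover have eq: "frechet_derivative f (at (g x)) (h x) =
      (\<Sum>b\<in>Basis. (h x \<bullet> b) *\<^sub>R frechet_derivative f (at (g x)) b)" if "x \<in> S" for x
  proof -
    have lin: "linear (frechet_derivative f (at (g x)))"
      using smooth_on_has_derivative[OF assms(3) assms(6)[OF that]] has_derivative_linear by blast
    show ?thesis
      by (subst euclidean_representation[of "h x", symmetric])
         (simp add: linear_sum[OF lin] linear_scale[OF lin])
  qed
  ultimately show ?thesis
    using smooth_on_cong[of S "\<lambda>x. frechet_derivative f (at (g x)) (h x)", OF assms(1) eq]
    by blast
qed

section \<open>Smooth functions of one real variable\<close>

lemma smooth_on_real_deriv:
  fixes f :: "real \<Rightarrow> 'a::real_normed_vector"
  assumes "smooth_on f I"
  obtains f' where "smooth_on f' I" "\<And>x. x \<in> I \<Longrightarrow> (f has_vector_derivative f' x) (at x)"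
proof
  show "smooth_on (\<lambda>x. frechet_derivative f (at x) 1) I"
    by (rule smooth_on_frechet[OF assms])
  show "(f has_vector_derivative frechet_derivative f (at x) 1) (at x)" if "x \<in> I" for x
  proof -
    define F where "F = frechet_derivative f (at x)"
    have D: "(f has_derivative F) (at x)"
      unfolding F_def by (rule smooth_on_has_derivative[OF assms that])
    have "F h = h *\<^sub>R F 1" for h
      using linear_scale[OF has_derivative_linear[OF D], of h 1] by simp
    have "(f has_derivative (\<lambda>h. h *\<^sub>R F 1)) (at x)"
      using D by (rule has_derivative_eq_rhs) (rule ext, fact)
    then show ?thesis
      unfolding has_vector_derivative_def F_def .
  qed
qed

text \<open>Bootstrapping: if f' inherits every order of regularity that f has, then f gains one
  order at a time. This serves solutions of differential equations and inverse functions.\<close>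

lemma smooth_on_realI:
  fixes f :: "real \<Rightarrow> 'a::real_normed_vector"
  assumes "open I" "\<And>x. x \<in> I \<Longrightarrow> (f has_vector_derivative f' x) (at x)"
    and "\<And>k. Ck_on k f I \<Longrightarrow> Ck_on k f' I"
  shows "smooth_on f I"
proof -
  have "Ck_on k f I" for k
  proof (induction k)
    case 0
    then show ?case
      using assms(2) by (auto intro!: continuous_at_imp_continuous_on has_vector_derivative_continuous)
  next
    case (Suc k)
    show ?case
    proof (rule Ck_on_SucI[OF assms(1), where f' = "\<lambda>x v. v *\<^sub>R f' x"])
      show "(f has_derivative (\<lambda>v. v *\<^sub>R f' x)) (at x)" if "x \<in> I" for x
        using assms(2)[OF that] by (simp add: has_vector_derivative_def)
      show "Ck_on k (\<lambda>x. v *\<^sub>R f' x) I" for v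
        by (rule Ck_on_bilinear[OF assms(1) bounded_bilinear_scaleR Ck_on_const[OF assms(1)]
              assms(3)[OF Suc]])
    qed
  qed
  then show ?thesis by (simp add: smooth_on_def)
qed

section \<open>Linear differential equations\<close>

text \<open>The strict inequalities put both points into the interior of the compact interval, where
  a derivative within the interval is a full derivative.\<close>

lemma open_interval_enclose:
  fixes I :: "real set"
  assumes "open I" "is_interval I" "s \<in> I" "t \<in> I"
  obtains a b where "{a..b} \<subseteq> I" "a < s" "a < t" "s < b" "t < b"
proof -
  obtain e where e: "e > 0" "ball (min s t) e \<subseteq> I"
    using assms by (metis min_def open_contains_ball)
  obtain d where d: "d > 0" "ball (max s t) d \<subseteq> I"
    using assms by (metis max_def open_contains_ball)
  have a: "min s t - e/2 \<in> I"
    using e by (intro subsetD[OF e(2)]) (auto simp: dist_real_def)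
  have b: "max s t + d/2 \<in> I"
    using d by (intro subsetD[OF d(2)]) (auto simp: dist_real_def)
  have "{min s t - e/2..max s t + d/2} \<subseteq> I"
    using mem_is_interval_1_I[OF assms(2) a b] by auto
  then show ?thesis
    using e(1) d(1) by (intro that[of "min s t - e/2" "max s t + d/2"]) auto
qed

lemma has_vector_derivative_interval_integral:
  fixes f :: "real \<Rightarrow> 'a::euclidean_space"
  assumes "open I" "is_interval I" "t0 \<in> I" "continuous_on I f" "t \<in> I"
  shows "((\<lambda>u. LBINT s=t0..u. f s) has_vector_derivative f t) (at t)"
proof -
  obtain a b where ab: "{a..b} \<subseteq> I" "a < t0" "a < t" "t0 < b" "t < b"
    using open_interval_enclose[OF assms(1,2,3,5)] .
  have "((\<lambda>u. LBINT s=t0..u. f s) has_vector_derivative f t) (at t within {a..b})"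
    by (rule interval_integral_FTC2) (use ab continuous_on_subset[OF assms(4) ab(1)] in auto)
  moreover have "at t within {a..b} = at t"
    using ab by (intro at_within_interior) (auto simp: interior_atLeastAtMost_real)
  ultimately show ?thesis by simp
qed

lemma norm_le_power_of_deriv:
  fixes D :: "real \<Rightarrow> 'a::real_normed_vector"
  assumes "D t0 = 0" "t0 \<in> {a..b}" "t \<in> {a..b}"
    and der: "\<And>s. s \<in> {a..b} \<Longrightarrow> (D has_vector_derivative D' s) (at s)"
    and le: "\<And>s. s \<in> {a..b} \<Longrightarrow> norm (D' s) \<le> c * \<bar>s - t0\<bar> ^ m"
  shows "norm (D t) \<le> c * \<bar>t - t0\<bar> ^ Suc m / Suc m"
proof (cases "t = t0")
  case True
  then show ?thesis using assms(1) by simp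
next
  case False
  define r where "r = \<bar>t - t0\<bar>"
  \<comment> \<open>The path \<open>t0 + \<sigma> * u\<close> runs from t0 to t as u runs from 0 to
    r, which treats both sides of t0 at once.\<close>
  define \<sigma> where "\<sigma> = sgn (t - t0)"
  have r: "r > 0" "t0 + \<sigma> * r = t" using False by (auto simp: r_def \<sigma>_def sgn_mult_abs abs_mult_sgn mult.commute)
  have \<sigma>: "\<bar>\<sigma>\<bar> = 1" "\<sigma> = 1 \<or> \<sigma> = -1" using False by (auto simp: \<sigma>_def sgn_if)
  have mem: "t0 + \<sigma> * u \<in> {a..b}" if "0 \<le> u" "u \<le> r" for u
    using that \<sigma>(2) r assms(2,3) by (auto simp: r_def)
  have dE: "((\<lambda>u. D (t0 + \<sigma> * u)) has_vector_derivative \<sigma> *\<^sub>R D' (t0 + \<sigma> * u)) (at u)"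
    if "0 \<le> u" "u \<le> r" for u
  proof -
    have "((\<lambda>u. t0 + \<sigma> * u) has_vector_derivative \<sigma>) (at u)"
      unfolding has_real_derivative_iff_has_vector_derivative[symmetric]
      by (auto intro!: derivative_eq_intros)
    from vector_diff_chain_at[OF this der[OF mem[OF that]]] show ?thesis
      by (simp add: o_def)
  qed
  have "norm (D (t0 + \<sigma> * r) - D (t0 + \<sigma> * 0)) \<le> c * r ^ Suc m / Suc m - c * 0 ^ Suc m / Suc m"
  proof (rule differentiable_bound_general[OF r(1),
        where f' = "\<lambda>u. \<sigma> *\<^sub>R D' (t0 + \<sigma> * u)" and \<phi>' = "\<lambda>u. c * u ^ m"])
    show "continuous_on {0..r} (\<lambda>u. D (t0 + \<sigma> * u))"
      using dE by (auto intro!: continuous_at_imp_continuous_on has_vector_derivative_continuous)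
    show "((\<lambda>u. c * u ^ Suc m / Suc m) has_vector_derivative c * u ^ m) (at u)" for u :: real
      unfolding has_real_derivative_iff_has_vector_derivative[symmetric]
      by (rule derivative_eq_intros refl | simp add: field_simps del: of_nat_Suc power_Suc)+
    show "norm (\<sigma> *\<^sub>R D' (t0 + \<sigma> * u)) \<le> c * u ^ m" if "0 < u" "u < r" for u
      using le[OF mem[of u]] that \<sigma> by (auto simp: abs_mult)
    show "continuous_on {0..r} (\<lambda>u. c * u ^ Suc m / Suc m)"
      by (intro continuous_intros) auto
  qed (use dE in auto)
  then show ?thesis using r assms(1) by (simp add: r_def)
qed

text \<open>The Picard iterates converge on all of the interval because the Lipschitz constant may
  depend on time; hence no local solutions have to be glued.\<close>

lemma global_picard:
  fixes G :: "real \<Rightarrow> 'a::euclidean_space \<Rightarrow> 'a"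
  assumes I: "open I" "is_interval I" "t0 \<in> I"
    and K: "continuous_on I K"
    and lip: "\<And>t x y. t \<in> I \<Longrightarrow> norm (G t x - G t y) \<le> K t * norm (x - y)"
    and cont: "\<And>x. continuous_on I x \<Longrightarrow> continuous_on I (\<lambda>t. G t (x t))"
  obtains x where "x t0 = x0" "\<And>t. t \<in> I \<Longrightarrow> (x has_vector_derivative G t (x t)) (at t)"
proof -
  define X where "X = rec_nat (\<lambda>t. x0) (\<lambda>_ x t. x0 + (LBINT s=t0..t. G s (x s)))"
  have X0: "X 0 = (\<lambda>t. x0)" and XS: "X (Suc n) = (\<lambda>t. x0 + (LBINT s=t0..t. G s (X n s)))" for n
    by (simp_all add: X_def)
  have Xt0: "X n t0 = x0" for n
    by (cases n) (simp_all add: X0 XS)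
  have contX: "continuous_on I (X n)" for n
  proof (induction n)
    case (Suc n)
    show ?case
      using has_vector_derivative_interval_integral[OF I cont[OF Suc]]
      unfolding XS
      by (auto intro!: continuous_at_imp_continuous_on continuous_intros
          intro: has_vector_derivative_continuous)
  qed (simp add: X0)
  have derX: "(X (Suc n) has_vector_derivative G t (X n t)) (at t)" if "t \<in> I" for n t
    unfolding XS
    using has_vector_derivative_interval_integral[OF I cont[OF contX] that]
    by (auto intro!: derivative_eq_intros)
  \<comment> \<open>The limit is written as a series of increments so that the Weierstrass M-test
    applies.\<close>
  define D where "D n t = X (Suc n) t - X n t" for n t
  have X_sum: "X n t = x0 + (\<Sum>i<n. D i t)" for n t
    by (induction n) (auto simp: X0 D_def algebra_simps)
  define x where "x t = x0 + (\<Sum>i. D i t)" for t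
  have unif: "uniform_limit {a..b} X x sequentially" and
    lipL: "\<exists>L\<ge>0. \<forall>t\<in>{a..b}. \<forall>y z. norm (G t y - G t z) \<le> L * norm (y - z)"
    if ab: "{a..b} \<subseteq> I" "t0 \<in> {a..b}" for a b
  proof -
    have "compact (K ` {a..b})"
      using ab by (intro compact_continuous_image continuous_on_subset[OF K]) auto
    then obtain L where L: "L > 0" "\<And>t. t \<in> {a..b} \<Longrightarrow> \<bar>K t\<bar> \<le> L"
      using bounded_pos[THEN iffD1, OF compact_imp_bounded] by (metis imageI real_norm_def)
    have Lip: "norm (G t y - G t z) \<le> L * norm (y - z)" if "t \<in> {a..b}" for t y z
      using lip[of t y z] L(2)[OF that] ab that
      by (meson abs_le_D1 mult_right_mono norm_ge_zero order_trans subsetD)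
    then show "\<exists>L\<ge>0. \<forall>t\<in>{a..b}. \<forall>y z. norm (G t y - G t z) \<le> L * norm (y - z)"
      using L(1) by (intro exI[of _ L]) auto
    have "compact ((\<lambda>t. G t x0) ` {a..b})"
      using ab by (intro compact_continuous_image continuous_on_subset[OF cont[of "\<lambda>_. x0"]]) auto
    then obtain C where C: "C > 0" "\<And>t. t \<in> {a..b} \<Longrightarrow> norm (G t x0) \<le> C"
      using bounded_pos[THEN iffD1, OF compact_imp_bounded] by (metis imageI)
    have bnd: "norm (D n t) \<le> C * L ^ n * \<bar>t - t0\<bar> ^ Suc n / fact (Suc n)" if "t \<in> {a..b}" for n t
      using that
    proof (induction n arbitrary: t)
      case 0
      have "norm (D 0 t) \<le> C * \<bar>t - t0\<bar> ^ Suc 0 / Suc 0"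
      proof (rule norm_le_power_of_deriv[OF _ ab(2) 0])
        show "(D 0 has_vector_derivative G s x0) (at s)" if "s \<in> {a..b}" for s
          using derX[of s 0] that ab unfolding D_def[abs_def] X0
          by (auto intro!: derivative_eq_intros)
      qed (use C Xt0 in \<open>auto simp: D_def\<close>)
      then show ?case by simp
    next
      case (Suc n)
      have "norm (D (Suc n) t) \<le> (C * L ^ Suc n / fact (Suc n)) * \<bar>t - t0\<bar> ^ Suc (Suc n) / Suc (Suc n)"
      proof (rule norm_le_power_of_deriv[OF _ ab(2) Suc.prems])
        show "(D (Suc n) has_vector_derivative (G s (X (Suc n) s) - G s (X n s))) (at s)"
          if "s \<in> {a..b}" for s
          using derX[of s] that ab unfolding D_def[abs_def]
          by (intro derivative_intros) auto
        show "norm (G s (X (Suc n) s) - G s (X n s)) \<le> C * L ^ Suc n / fact (Suc n) * \<bar>s - t0\<bar> ^ Suc n"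
          if s: "s \<in> {a..b}" for s
        proof -
          have "norm (G s (X (Suc n) s) - G s (X n s)) \<le> L * norm (D n s)"
            using Lip[OF s] by (simp add: D_def)
          also have "\<dots> \<le> L * (C * L ^ n * \<bar>s - t0\<bar> ^ Suc n / fact (Suc n))"
            by (intro mult_left_mono Suc.IH[OF s]) (use L in auto)
          finally show ?thesis by (simp add: field_simps)
        qed
      qed (use Xt0 in \<open>auto simp: D_def\<close>)
      also have "\<dots> = C * L ^ Suc n * \<bar>t - t0\<bar> ^ Suc (Suc n) / fact (Suc (Suc n))"
        by (simp add: field_simps)
      finally show ?case .
    qed
    define r where "r = b - a"
    \<comment> \<open>The factor n + 1 of the factorial is given away; what remains is a constant
      times the general term of the exponential series at \<open>L * r\<close>.\<close>
    have "norm (D n t) \<le> C * r * ((L * r) ^ n /\<^sub>R fact n)" if t: "t \<in> {a..b}" for n t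
    proof -
      have tr: "\<bar>t - t0\<bar> \<le> r" "0 \<le> r" using t ab(2) by (auto simp: r_def)
      have "norm (D n t) \<le> C * L ^ n * \<bar>t - t0\<bar> ^ Suc n / fact (Suc n)" by (rule bnd[OF t])
      also have "\<dots> \<le> C * L ^ n * r ^ Suc n / fact n"
        using C L tr by (intro frac_le mult_left_mono power_mono fact_mono mult_nonneg_nonneg zero_le_power) auto
      also have "\<dots> = C * r * ((L * r) ^ n /\<^sub>R fact n)"
        by (simp add: field_simps power_mult_distrib)
      finally show ?thesis .
    qed
    moreover have "summable (\<lambda>n. C * r * ((L * r) ^ n /\<^sub>R fact n))"
      by (intro summable_mult summable_exp_generic)
    ultimately have "uniform_limit {a..b} (\<lambda>n t. \<Sum>i<n. D i t) (\<lambda>t. \<Sum>i. D i t) sequentially"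
      by (rule Weierstrass_m_test)
    then have "uniform_limit {a..b} (\<lambda>n t. x0 + (\<Sum>i<n. D i t)) (\<lambda>t. x0 + (\<Sum>i. D i t)) sequentially"
      by (intro uniform_limit_intros)
    then show "uniform_limit {a..b} X x sequentially"
      unfolding X_sum[abs_def] x_def[abs_def] .
  qed
  show ?thesis
  proof (rule that[of x])
    show "x t0 = x0" by (simp add: x_def D_def Xt0)
    fix t assume t: "t \<in> I"
    obtain a b where ab: "{a..b} \<subseteq> I" "a < t0" "a < t" "t0 < b" "t < b"
      using open_interval_enclose[OF I(1,2,3) t] .
    have t0ab: "t0 \<in> {a..b}" using ab by auto
    obtain L where L: "L \<ge> 0" "\<And>s y z. s \<in> {a..b} \<Longrightarrow> norm (G s y - G s z) \<le> L * norm (y - z)"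
      using lipL[OF ab(1) t0ab] by blast
    note un = unif[OF ab(1) t0ab]
    have lim: "(\<lambda>n. X (Suc n) s) \<longlonglongrightarrow> x s" if "s \<in> {a..b}" for s
      using tendsto_uniform_limitI[OF un that] by (rule LIMSEQ_Suc)
    \<comment> \<open>The derivative of \<open>X (Suc n)\<close> is G along \<open>X n\<close>.
      These derivatives converge uniformly because G is Lipschitz on the compact interval, so limit
      and derivative may be exchanged.\<close>
    have "\<exists>g. \<forall>s\<in>{a..b}. (\<lambda>n. X (Suc n) s) \<longlonglongrightarrow> g s \<and>
        (g has_derivative (\<lambda>h. h *\<^sub>R G s (x s))) (at s within {a..b})"
    proof (rule has_derivative_sequence[where f' = "\<lambda>n s h. h *\<^sub>R G s (X n s)"])
      show "(X (Suc n) has_derivative (\<lambda>h. h *\<^sub>R G s (X n s))) (at s within {a..b})"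
        if "s \<in> {a..b}" for n s
        using has_derivative_at_withinI[OF derX[of s n, unfolded has_vector_derivative_def]] that ab(1)
        by blast
      fix e :: real assume e: "e > 0"
      have "\<forall>\<^sub>F n in sequentially. \<forall>s\<in>{a..b}. dist (X n s) (x s) < e / (L + 1)"
        using uniform_limitD[OF un, of "e / (L + 1)"] e L(1) by auto
      then show "\<forall>\<^sub>F n in sequentially. \<forall>s\<in>{a..b}. \<forall>h.
          norm (h *\<^sub>R G s (X n s) - h *\<^sub>R G s (x s)) \<le> e * norm h"
      proof (rule eventually_mono, intro ballI allI)
        fix n s h assume *: "\<forall>s\<in>{a..b}. dist (X n s) (x s) < e / (L + 1)" and s: "s \<in> {a..b}"
        have "norm (G s (X n s) - G s (x s)) \<le> L * norm (X n s - x s)" by (rule L(2)[OF s])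
        also have "\<dots> \<le> (L + 1) * (e / (L + 1))"
          using * s L(1) e by (intro mult_mono) (auto simp: dist_norm less_imp_le)
        also have "\<dots> = e" using L(1) by simp
        finally have "\<bar>h\<bar> * norm (G s (X n s) - G s (x s)) \<le> \<bar>h\<bar> * e"
          by (rule mult_left_mono) simp
        then show "norm (h *\<^sub>R G s (X n s) - h *\<^sub>R G s (x s)) \<le> e * norm h"
          by (simp add: scaleR_diff_right[symmetric] mult.commute)
      qed
    qed (use lim[OF t0ab] t0ab in auto)
    then obtain g where g: "\<And>s. s \<in> {a..b} \<Longrightarrow> (\<lambda>n. X (Suc n) s) \<longlonglongrightarrow> g s"
      "\<And>s. s \<in> {a..b} \<Longrightarrow> (g has_derivative (\<lambda>h. h *\<^sub>R G s (x s))) (at s within {a..b})"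
      by blast
    have gx: "g s = x s" if "s \<in> {a..b}" for s
      using LIMSEQ_unique[OF g(1)[OF that] lim[OF that]] .
    have "(x has_derivative (\<lambda>h. h *\<^sub>R G t (x t))) (at t within {a..b})"
      by (rule has_derivative_transform[OF _ _ g(2)]) (use gx ab in auto)
    moreover have "at t within {a..b} = at t"
      using ab by (intro at_within_interior) (auto simp: interior_atLeastAtMost_real)
    ultimately show "(x has_vector_derivative G t (x t)) (at t)"
      by (simp add: has_vector_derivative_def)
  qed
qed

text \<open>The assumption on \<open>Ck_on\<close> acts twice: for k = 0 it supplies the continuity
  required by the Picard iteration, and for all k it lets the equation raise the regularity of its
  solution.\<close>

lemma smooth_ode:
  fixes G :: "real \<Rightarrow> 'a::euclidean_space \<Rightarrow> 'a"
  assumes I: "open I" "is_interval I" "t0 \<in> I"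
    and K: "continuous_on I K"
    and lip: "\<And>t x y. t \<in> I \<Longrightarrow> norm (G t x - G t y) \<le> K t * norm (x - y)"
    and Ck: "\<And>k x. Ck_on k x I \<Longrightarrow> Ck_on k (\<lambda>t. G t (x t)) I"
  obtains x where "smooth_on x I" "x t0 = x0"
    "\<And>t. t \<in> I \<Longrightarrow> (x has_vector_derivative G t (x t)) (at t)"
proof -
  obtain x where x: "x t0 = x0" "\<And>t. t \<in> I \<Longrightarrow> (x has_vector_derivative G t (x t)) (at t)"
    using global_picard[OF I K lip] Ck[of 0] by auto
  show ?thesis
    by (rule that[OF smooth_on_realI[OF I(1) x(2) Ck] x])
qed

text \<open>An abstract product B covers multiplication of matrices from the left and from the
  right, for the gauge and for its inverse.\<close>

lemma linear_ode1:
  fixes B :: "'c::real_normed_vector \<Rightarrow> 'a::euclidean_space \<Rightarrow> 'a"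
  assumes I: "open I" "is_interval I" "t0 \<in> I"
    and B: "bounded_bilinear B" and A: "smooth_on A I"
  obtains x where "smooth_on x I" "x t0 = x0"
    "\<And>t. t \<in> I \<Longrightarrow> (x has_vector_derivative B (A t) (x t)) (at t)"
proof -
  interpret B: bounded_bilinear B by (rule B)
  obtain M where M: "M > 0" "\<And>a x. norm (B a x) \<le> norm a * norm x * M"
    using B.pos_bounded by auto
  show ?thesis
  proof (rule smooth_ode[OF I, of "\<lambda>t. M * norm (A t)" "\<lambda>t x. B (A t) x" x0])
    show "continuous_on I (\<lambda>t. M * norm (A t))"
      by (intro continuous_intros smooth_on_continuous_on[OF A])
    show "norm (B (A t) x - B (A t) y) \<le> M * norm (A t) * norm (x - y)" for t x y
      using M(2)[of "A t" "x - y"] by (simp add: B.diff_right mult_ac)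
    show "Ck_on k (\<lambda>t. B (A t) (x t)) I" if "Ck_on k x I" for k x
      using A that by (intro Ck_on_bilinear[OF I(1) B]) (auto simp: smooth_on_def)
  qed (use that in auto)
qed

text \<open>Here B will be matrix times vector for the system, and multiplication of reals for the
  scalar equation f'' + q f = 0.\<close>

lemma linear_ode2:
  fixes B :: "'c::real_normed_vector \<Rightarrow> 'a::euclidean_space \<Rightarrow> 'a"
  assumes I: "open I" "is_interval I" "t0 \<in> I"
    and B: "bounded_bilinear B" and A: "smooth_on A1 I" "smooth_on A0 I" "smooth_on b I"
  obtains x x1 where "smooth_on x I" "smooth_on x1 I" "x t0 = x0" "x1 t0 = v0"
    "\<And>t. t \<in> I \<Longrightarrow> (x has_vector_derivative x1 t) (at t)"
    "\<And>t. t \<in> I \<Longrightarrow> (x1 has_vector_derivative b t + B (A1 t) (x1 t) + B (A0 t) (x t)) (at t)"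
proof -
  interpret B: bounded_bilinear B by (rule B)
  obtain M where M: "M > 0" "\<And>a x. norm (B a x) \<le> norm a * norm x * M"
    using B.pos_bounded by auto
  define G where "G t z = (snd z, b t + B (A1 t) (snd z) + B (A0 t) (fst z))" for t z
  obtain z where z: "smooth_on z I" "z t0 = (x0, v0)"
    "\<And>t. t \<in> I \<Longrightarrow> (z has_vector_derivative G t (z t)) (at t)"
  proof (rule smooth_ode[OF I, of "\<lambda>t. 1 + (M * norm (A1 t) + M * norm (A0 t))" G "(x0, v0)"])
    show "continuous_on I (\<lambda>t. 1 + (M * norm (A1 t) + M * norm (A0 t)))"
      by (intro continuous_intros smooth_on_continuous_on A)
    show "norm (G t y - G t z) \<le> (1 + (M * norm (A1 t) + M * norm (A0 t))) * norm (y - z)" for t y z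
    proof -
      have n: "norm (fst (y - z)) \<le> norm (y - z)" "norm (snd (y - z)) \<le> norm (y - z)"
        using norm_fst_le[of "fst (y - z)" "snd (y - z)"] norm_snd_le[of "snd (y - z)" "fst (y - z)"]
        by (simp_all only: prod.collapse)
      have "G t y - G t z = (snd (y - z), B (A1 t) (snd (y - z)) + B (A0 t) (fst (y - z)))"
        by (simp add: G_def B.diff_right algebra_simps)
      also have "norm \<dots> \<le> norm (snd (y - z)) + norm (B (A1 t) (snd (y - z)) + B (A0 t) (fst (y - z)))"
        by (rule norm_Pair_le)
      also have "\<dots> \<le> norm (snd (y - z)) + (norm (B (A1 t) (snd (y - z))) + norm (B (A0 t) (fst (y - z))))"
        by (intro add_left_mono norm_triangle_ineq)
      also have "\<dots> \<le> norm (y - z) + (norm (A1 t) * norm (y - z) * M + norm (A0 t) * norm (y - z) * M)"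
        using n M(1) by (intro add_mono order_trans[OF M(2)] mult_right_mono mult_left_mono) auto
      finally show ?thesis by (simp add: algebra_simps)
    qed
    show "Ck_on k (\<lambda>t. G t (z t)) I" if z: "Ck_on k z I" for k z
    proof -
      have f: "Ck_on k (\<lambda>t. L (z t)) I" if "bounded_linear L" for L :: "'a \<times> 'a \<Rightarrow> 'a"
        using Ck_on_compose[OF I(1) open_UNIV Ck_on_bounded_linear[OF open_UNIV that] z] by simp
      have s: "Ck_on k (\<lambda>t. b t + B (A1 t) (snd (z t)) + B (A0 t) (fst (z t))) I"
        using A by (intro Ck_on_add[OF I(1)] Ck_on_bilinear[OF I(1) B] f bounded_linear_fst bounded_linear_snd)
          (auto simp: smooth_on_def)
      have L: "bounded_linear (\<lambda>x::'a. (x, 0::'a))" "bounded_linear (\<lambda>x::'a. (0::'a, x))"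
        by (intro bounded_linear_Pair bounded_linear_ident bounded_linear_zero)+
      have "Ck_on k (\<lambda>t. (snd (z t), 0) + (0, b t + B (A1 t) (snd (z t)) + B (A0 t) (fst (z t)))) I"
        using Ck_on_compose[OF I(1) open_UNIV Ck_on_bounded_linear[OF open_UNIV L(1)] f[OF bounded_linear_snd]]
          Ck_on_compose[OF I(1) open_UNIV Ck_on_bounded_linear[OF open_UNIV L(2)] s]
        by (intro Ck_on_add[OF I(1)]) auto
      then show ?thesis by (simp add: G_def)
    qed
  qed auto
  show ?thesis
  proof (rule that[of "\<lambda>t. fst (z t)" "\<lambda>t. snd (z t)"])
    show "((\<lambda>t. fst (z t)) has_vector_derivative snd (z t)) (at t)"
      "((\<lambda>t. snd (z t)) has_vector_derivative b t + B (A1 t) (snd (z t)) + B (A0 t) (fst (z t))) (at t)"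
      if "t \<in> I" for t
      using bounded_linear.has_vector_derivative[OF bounded_linear_fst z(3)[OF that]]
        bounded_linear.has_vector_derivative[OF bounded_linear_snd z(3)[OF that]]
      by (simp_all add: G_def)
  qed (use z smooth_on_linear_compose[OF I(1) bounded_linear_fst z(1)]
        smooth_on_linear_compose[OF I(1) bounded_linear_snd z(1)] in auto)
qed

section \<open>Symmetries along solutions\<close>

lemma bounded_bilinear_matrix_vector_mult:
  "bounded_bilinear ((*v) :: real^2^2 \<Rightarrow> real^2 \<Rightarrow> real^2)"
  unfolding bilinear_conv_bounded_bilinear[symmetric] bilinear_def
  by (auto intro!: linearI simp: vec_eq_iff matrix_vector_mult_def sum_2 forall_2 algebra_simps)

lemma bounded_bilinear_matrix_matrix_mult:
  "bounded_bilinear ((**) :: real^2^2 \<Rightarrow> real^2^2 \<Rightarrow> real^2^2)"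
  unfolding bilinear_conv_bounded_bilinear[symmetric] bilinear_def
  by (auto intro!: linearI simp: vec_eq_iff matrix_matrix_mult_def sum_2 forall_2 algebra_simps)

text \<open>The determinant with columns u and v, zero exactly for parallel vectors. Hence
  \<open>wedge (M *v v) v = 0\<close> says that v is 0 or an eigenvector of M.\<close>

definition wedge :: "real^2 \<Rightarrow> real^2 \<Rightarrow> real" where
  "wedge u v = u $ 1 * v $ 2 - u $ 2 * v $ 1"

lemma bounded_bilinear_wedge: "bounded_bilinear wedge"
  unfolding bilinear_conv_bounded_bilinear[symmetric] bilinear_def
  by (auto intro!: linearI simp: wedge_def algebra_simps)

text \<open>The two axis vectors force M to be diagonal, and their sum forces the diagonal entries
  to agree.\<close>

lemma scalar_matrix_of_wedge:
  fixes M :: "real^2^2"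
  assumes "\<And>v. wedge (M *v v) v = 0"
  shows "M *v v = M $ 1 $ 1 *\<^sub>R v"
proof -
  have "wedge (M *v axis 1 1) (axis 1 1) = 0" "wedge (M *v axis 2 1) (axis 2 1) = 0"
    "wedge (M *v (axis 1 1 + axis 2 1)) (axis 1 1 + axis 2 1) = 0"
    by (rule assms)+
  then have "M $ 2 $ 1 = 0" "M $ 1 $ 2 = 0" "M $ 2 $ 2 = M $ 1 $ 1"
    by (auto simp: wedge_def matrix_vector_mult_def sum_2 axis_def)
  then show ?thesis
    by (simp add: vec_eq_iff matrix_vector_mult_def sum_2 forall_2)
qed

lemma wedge_matrix_mult:
  fixes M :: "real^2^2"
  shows "wedge (M *v u) (M *v v) = det M * wedge u v"
  by (simp add: wedge_def matrix_vector_mult_def sum_2 det_2 algebra_simps)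

section \<open>Chain rule along curves and total derivatives\<close>

lemma has_vector_derivative_compose_curve:
  assumes "(f has_derivative f') (at (g t))" "(g has_vector_derivative v) (at t)"
  shows "((\<lambda>s. f (g s)) has_vector_derivative f' v) (at t)"
  using has_derivative_compose[OF assms(2)[unfolded has_vector_derivative_def] assms(1)]
    linear_scale[OF has_derivative_linear[OF assms(1)]]
  by (simp add: has_vector_derivative_def)

lemma has_vector_derivative_Pair:
  assumes "(f has_vector_derivative f') (at t)" "(g has_vector_derivative g') (at t)"
  shows "((\<lambda>s. (f s, g s)) has_vector_derivative (f', g')) (at t)"
  using has_derivative_Pair[OF assms[unfolded has_vector_derivative_def]]
  by (simp add: has_vector_derivative_def)

text \<open>On the lift of a curve to the jet space the total derivative is ordinary differentiation
  in t. This turns the jet formulas into calculus along solutions.\<close>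

lemma has_vector_derivative_Dx0:
  assumes "f differentiable (at (t, y t))" "(y has_vector_derivative y1) (at t)"
  shows "((\<lambda>s. f (s, y s)) has_vector_derivative Dx0 f (t, y t, y1)) (at t)"
  unfolding Dx0_def
  using has_vector_derivative_compose_curve[OF assms(1)[unfolded frechet_derivative_works]
      has_vector_derivative_Pair[OF has_vector_derivative_id assms(2)]] by simp

lemma has_vector_derivative_Dx1:
  assumes "F differentiable (at (t, y t, y1 t))" "(y has_vector_derivative y1 t) (at t)"
    "(y1 has_vector_derivative y2) (at t)"
  shows "((\<lambda>s. F (s, y s, y1 s)) has_vector_derivative Dx1 F (t, y t, y1 t, y2)) (at t)"
  unfolding Dx1_def
  using has_vector_derivative_compose_curve[OF assms(1)[unfolded frechet_derivative_works]
      has_vector_derivative_Pair[OF has_vector_derivative_id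
        has_vector_derivative_Pair[OF assms(2,3)]]] by simp

lemma smooth_on_Dx0:
  assumes "open U" "smooth_on f U"
  shows "smooth_on (Dx0 f) ((\<lambda>J. (fst J, fst (snd J))) -` U)"
proof -
  let ?p = "\<lambda>J :: jet1. (fst J, fst (snd J))"
  have bl: "bounded_linear ?p"
    by (intro bounded_linear_Pair bounded_linear_fst
        bounded_linear_compose[OF bounded_linear_fst bounded_linear_snd])
  have op: "open (?p -` U)"
    by (intro open_vimage assms linear_continuous_on bl)
  have "smooth_on (\<lambda>J. frechet_derivative f (at (?p J)) (1, snd (snd J))) (?p -` U)"
    by (intro smooth_on_frechet_apply[OF op assms] smooth_on_bounded_linear[OF op] bl
        smooth_on_Pair[OF op] smooth_on_const[OF op]
        bounded_linear_compose[OF bounded_linear_snd bounded_linear_snd]) simp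
  moreover have "Dx0 f = (\<lambda>J. frechet_derivative f (at (?p J)) (1, snd (snd J)))"
    by (auto simp: Dx0_def)
  ultimately show ?thesis by metis
qed

lemma smooth_on_of_fst:
  fixes f :: "real \<Rightarrow> 'a::real_normed_vector"
  assumes "open J" "smooth_on f J"
  shows "smooth_on (\<lambda>P :: point. f (fst P)) (J \<times> UNIV)"
  by (rule smooth_on_compose[OF open_Times[OF assms(1) open_UNIV] assms
        smooth_on_bounded_linear[OF open_Times[OF assms(1) open_UNIV] bounded_linear_fst]]) auto

lemma smooth_on_differentiable: "smooth_on f S \<Longrightarrow> x \<in> S \<Longrightarrow> f differentiable (at x)"
  using smooth_on_has_derivative unfolding differentiable_def by blast

lemma smooth_on_real_has_derivative:
  fixes f :: "real \<Rightarrow> 'a::real_normed_vector"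
  assumes "smooth_on f I" "t \<in> I"
  shows "(f has_vector_derivative vector_derivative f (at t)) (at t)"
  using smooth_on_differentiable[OF assms] vector_derivative_works by blast

lemma smooth_on_vector_derivative:
  fixes f :: "real \<Rightarrow> 'a::real_normed_vector"
  assumes "open I" "smooth_on f I"
  shows "smooth_on (\<lambda>t. vector_derivative f (at t)) I"
proof -
  obtain f' where f': "smooth_on f' I" "\<And>x. x \<in> I \<Longrightarrow> (f has_vector_derivative f' x) (at x)"
    using smooth_on_real_deriv[OF assms(2)] by blast
  have "smooth_on (\<lambda>t. vector_derivative f (at t)) I = smooth_on f' I"
    by (rule smooth_on_cong[OF assms(1)]) (use vector_derivative_at f'(2) in blast)
  then show ?thesis using f'(1) by blast
qed

lemma has_vector_derivative_cong_open:
  assumes "open I" "t \<in> I" "\<And>s. s \<in> I \<Longrightarrow> f s = g s"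
    "(f has_vector_derivative v) (at t)"
  shows "(g has_vector_derivative v) (at t)"
  using assms has_vector_derivative_transform_within_open by metis

lemma const_of_vector_derivative_zero:
  fixes f :: "real \<Rightarrow> 'a::real_normed_vector"
  assumes "is_interval I" "\<And>t. t \<in> I \<Longrightarrow> (f has_vector_derivative 0) (at t)" "s \<in> I" "t \<in> I"
  shows "f s = f t"
proof -
  have "\<exists>c. \<forall>x\<in>I. f x = c"
  proof (rule has_derivative_zero_constant)
    show "convex I" by (rule is_interval_convex[OF assms(1)])
    show "(f has_derivative (\<lambda>h. 0)) (at x within I)" if "x \<in> I" for x
      using assms(2)[OF that] by (simp add: has_vector_derivative_def has_derivative_at_withinI)
  qed
  then show ?thesis using assms by auto
qed

lemmas mv_deriv = bounded_bilinear.has_vector_derivative[OF bounded_bilinear_matrix_vector_mult]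
lemmas mm_deriv = bounded_bilinear.has_vector_derivative[OF bounded_bilinear_matrix_matrix_mult]
lemmas scaleR_deriv = bounded_bilinear.has_vector_derivative[OF bounded_bilinear_scaleR]
lemmas inner_deriv = bounded_bilinear.has_vector_derivative[OF bounded_bilinear_inner]
lemmas wedge_deriv = bounded_bilinear.has_vector_derivative[OF bounded_bilinear_wedge]

section \<open>The system and its symmetry condition along solutions\<close>

locale linear_system =
  fixes I :: "real set" and A1 A0 :: "real \<Rightarrow> real^2^2" and b :: "real \<Rightarrow> real^2"
  assumes I: "open I" "is_interval I"
    and A1: "smooth_on A1 I" and A0: "smooth_on A0 I" and b: "smooth_on b I"
begin

definition rhs :: "real \<Rightarrow> real^2 \<Rightarrow> real^2 \<Rightarrow> real^2" where
  "rhs t y y1 = b t - A1 t *v y1 - A0 t *v y"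

definition solves :: "(real \<Rightarrow> real^2) \<Rightarrow> (real \<Rightarrow> real^2) \<Rightarrow> bool" where
  "solves y y1 \<longleftrightarrow> (\<forall>t\<in>I. (y has_vector_derivative y1 t) (at t) \<and>
     (y1 has_vector_derivative rhs t (y t) (y1 t)) (at t))"

abbreviation \<Delta> :: "jet2 \<Rightarrow> real^2" where "\<Delta> \<equiv> lin_sys A1 A0 b"

lemma lin_sys_eq_0_iff: "\<Delta> (x, y, y1, y2) = 0 \<longleftrightarrow> y2 = rhs x y y1"
  by (auto simp: lin_sys_def rhs_def algebra_simps)

lemma smooth_solution_exists:
  assumes "t0 \<in> I"
  obtains y y1 where "smooth_on y I" "smooth_on y1 I" "solves y y1" "y t0 = v" "y1 t0 = w"
proof -
  have m: "smooth_on (\<lambda>t. - A t) I" if "smooth_on A I" for A :: "real \<Rightarrow> real^2^2"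
    using smooth_on_linear_compose[OF I(1) bounded_linear_minus[OF bounded_linear_ident] that] by simp
  obtain y y1 where "smooth_on y I" "smooth_on y1 I" "y t0 = v" "y1 t0 = w"
    "\<And>t. t \<in> I \<Longrightarrow> (y has_vector_derivative y1 t) (at t)"
    "\<And>t. t \<in> I \<Longrightarrow> (y1 has_vector_derivative b t + - A1 t *v y1 t + - A0 t *v y t) (at t)"
    using linear_ode2[OF I assms bounded_bilinear_matrix_vector_mult m[OF A1] m[OF A0] b] by blast
  moreover have "b t + - A1 t *v y1 t + - A0 t *v y t = rhs t (y t) (y1 t)" for t
    by (simp add: rhs_def vec_eq_iff forall_2 matrix_vector_mult_def sum_2)
  ultimately show ?thesis
    using that[of y y1] by (auto simp: solves_def)
qed

abbreviation A1' where "A1' t \<equiv> vector_derivative A1 (at t)"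
abbreviation A0' where "A0' t \<equiv> vector_derivative A0 (at t)"
abbreviation b' where "b' t \<equiv> vector_derivative b (at t)"

lemmas A1' = smooth_on_real_has_derivative[OF A1]
lemmas A0' = smooth_on_real_has_derivative[OF A0]
lemmas b' = smooth_on_real_has_derivative[OF b]

lemma frechet_lin_sys:
  assumes "x \<in> I"
  shows "frechet_derivative \<Delta> (at (x, y, y1, y2)) (dx, dy, d1, d2) =
    d2 + A1 x *v d1 + A0 x *v dy + dx *\<^sub>R (A1' x *v y1 + A0' x *v y - b' x)"
proof -
  have fst_d: "((\<lambda>J. M (fst J)) has_derivative (\<lambda>h. fst h *\<^sub>R vector_derivative M (at x))) (at (x, y, y1, y2))"
    if "(M has_vector_derivative vector_derivative M (at x)) (at x)"
    for M :: "real \<Rightarrow> 'a::real_normed_vector"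
    by (rule has_derivative_compose[of fst fst "(x, y, y1, y2)" UNIV M])
      (use that in \<open>auto simp: has_vector_derivative_def intro!: derivative_eq_intros\<close>)
  note mv = bounded_bilinear.FDERIV[OF bounded_bilinear_matrix_vector_mult]
  have "((\<lambda>J. snd (snd (snd J)) + A1 (fst J) *v fst (snd (snd J)) + A0 (fst J) *v fst (snd J) - b (fst J))
     has_derivative (\<lambda>h. snd (snd (snd h))
        + (A1 x *v fst (snd (snd h)) + (fst h *\<^sub>R A1' x) *v y1)
        + (A0 x *v fst (snd h) + (fst h *\<^sub>R A0' x) *v y) - fst h *\<^sub>R b' x)) (at (x, y, y1, y2))"
    by (rule has_derivative_eq_rhs)
      (rule has_derivative_diff has_derivative_add mv fst_d[OF A1'[OF assms]] fst_d[OF A0'[OF assms]]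
        fst_d[OF b'[OF assms]] has_derivative_fst has_derivative_snd has_derivative_ident | simp)+
  moreover have "\<Delta> = (\<lambda>J. snd (snd (snd J)) + A1 (fst J) *v fst (snd (snd J)) + A0 (fst J) *v fst (snd J) - b (fst J))"
    by (simp add: lin_sys_def case_prod_unfold)
  ultimately have "(\<Delta> has_derivative (\<lambda>h. snd (snd (snd h))
        + (A1 x *v fst (snd (snd h)) + (fst h *\<^sub>R A1' x) *v y1)
        + (A0 x *v fst (snd h) + (fst h *\<^sub>R A0' x) *v y) - fst h *\<^sub>R b' x)) (at (x, y, y1, y2))"
    by simp
  from frechet_derivative_at[OF this, symmetric] show ?thesis
    by (simp add: vec_eq_iff forall_2 matrix_vector_mult_def sum_2 algebra_simps)
qed

lemma open_IU: "open (I \<times> (UNIV :: (real^2) set))"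
  by (intro open_Times I open_UNIV)

text \<open>The evolutionary form of the symmetry condition: on a solution, the prolonged vector field
  applied to the system is the homogeneous system applied to the characteristic \<open>\<phi> - \<xi> y'\<close>.\<close>

lemma apply_prolonged_characteristic:
  assumes \<xi>: "smooth_on \<xi> (I \<times> UNIV)" and \<phi>: "smooth_on \<phi> (I \<times> UNIV)" and sol: "solves y y1"
  obtains \<chi>1 \<chi>2 where
    "\<And>t. t \<in> I \<Longrightarrow> ((\<lambda>s. \<phi> (s, y s) - \<xi> (s, y s) *\<^sub>R y1 s) has_vector_derivative \<chi>1 t) (at t)"
    "\<And>t. t \<in> I \<Longrightarrow> (\<chi>1 has_vector_derivative \<chi>2 t) (at t)"
    "\<And>t. t \<in> I \<Longrightarrow> apply_prolonged \<xi> \<phi> \<Delta> (t, y t, y1 t, rhs t (y t) (y1 t)) =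
       \<chi>2 t + A1 t *v \<chi>1 t + A0 t *v (\<phi> (t, y t) - \<xi> (t, y t) *\<^sub>R y1 t)"
proof -
  define y2 where "y2 t = rhs t (y t) (y1 t)" for t
  have dy: "(y has_vector_derivative y1 t) (at t)" "(y1 has_vector_derivative y2 t) (at t)" if "t \<in> I" for t
    using sol that by (auto simp: solves_def y2_def)
  \<comment> \<open>The third derivative of the solution, from the equation differentiated once; it
    enters through the second derivative of the product of \<xi> and y'.\<close>
  define y3 where "y3 t = b' t - (A1 t *v y2 t + A1' t *v y1 t) - (A0 t *v y1 t + A0' t *v y t)" for t
  have dy2: "(y2 has_vector_derivative y3 t) (at t)" if "t \<in> I" for t
    unfolding y2_def[abs_def] rhs_def y3_def
    using dy[OF that] A1'[OF that] A0'[OF that] b'[OF that]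
    by (intro has_vector_derivative_diff mv_deriv) (auto simp: y2_def rhs_def)
  let ?W = "(\<lambda>J :: jet1. (fst J, fst (snd J))) -` (I \<times> UNIV)"
  have d0: "((\<lambda>s. f (s, y s)) has_vector_derivative Dx0 f (t, y t, y1 t)) (at t)"
    if "smooth_on f (I \<times> UNIV)" "t \<in> I" for f :: "point \<Rightarrow> 'a::real_normed_vector" and t
    using that dy by (intro has_vector_derivative_Dx0 smooth_on_differentiable) auto
  have diff0: "Dx0 f differentiable (at (t, v, w))"
    if "smooth_on f (I \<times> UNIV)" "t \<in> I" for f :: "point \<Rightarrow> 'a::real_normed_vector" and t v w
    using smooth_on_differentiable[OF smooth_on_Dx0[OF open_IU that(1)]] that(2) by auto
  have d1: "((\<lambda>s. F (s, y s, y1 s)) has_vector_derivative Dx1 F (t, y t, y1 t, y2 t)) (at t)"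
    if "F differentiable (at (t, y t, y1 t))" "t \<in> I" for F :: "jet1 \<Rightarrow> 'a::real_normed_vector" and t
    using that dy by (intro has_vector_derivative_Dx1) auto
  define F where "F t = \<phi> (t, y t)" for t
  define F1 where "F1 t = Dx0 \<phi> (t, y t, y1 t)" for t
  define F2 where "F2 t = Dx1 (Dx0 \<phi>) (t, y t, y1 t, y2 t)" for t
  define X where "X t = \<xi> (t, y t)" for t
  define X1 where "X1 t = Dx0 \<xi> (t, y t, y1 t)" for t
  define X2 where "X2 t = Dx1 (Dx0 \<xi>) (t, y t, y1 t, y2 t)" for t
  have dF: "(F has_vector_derivative F1 t) (at t)" "(F1 has_vector_derivative F2 t) (at t)"
    "(X has_vector_derivative X1 t) (at t)" "(X1 has_vector_derivative X2 t) (at t)" if "t \<in> I" for t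
    unfolding F_def[abs_def] F1_def[abs_def] F2_def X_def[abs_def] X1_def[abs_def] X2_def
    using d0[OF \<phi> that] d0[OF \<xi> that] d1[OF diff0[OF \<phi> that] that] d1[OF diff0[OF \<xi> that] that]
    by auto
  define \<chi>1 where "\<chi>1 t = F1 t - (X t *\<^sub>R y2 t + X1 t *\<^sub>R y1 t)" for t
  define \<chi>2 where "\<chi>2 t = F2 t - ((X t *\<^sub>R y3 t + X1 t *\<^sub>R y2 t) + (X1 t *\<^sub>R y2 t + X2 t *\<^sub>R y1 t))" for t
  show ?thesis
  proof (rule that[of \<chi>1 \<chi>2])
    fix t assume t: "t \<in> I"
    show "((\<lambda>s. \<phi> (s, y s) - \<xi> (s, y s) *\<^sub>R y1 s) has_vector_derivative \<chi>1 t) (at t)"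
      unfolding \<chi>1_def F_def[symmetric] X_def[symmetric]
      by (intro has_vector_derivative_diff scaleR_deriv dF dy t)
    show "(\<chi>1 has_vector_derivative \<chi>2 t) (at t)"
      unfolding \<chi>1_def[abs_def] \<chi>2_def
      by (intro has_vector_derivative_diff has_vector_derivative_add scaleR_deriv dF dy dy2 t)
    \<comment> \<open>The first prolongation along the solution is differentiated by the chain rule
      and by the product rule; equating the results evaluates its total derivative.\<close>
    have "((\<lambda>s. prolong1 \<xi> \<phi> (s, y s, y1 s)) has_vector_derivative
        Dx1 (prolong1 \<xi> \<phi>) (t, y t, y1 t, y2 t)) (at t)"
    proof (rule d1[OF _ t])
      have "prolong1 \<xi> \<phi> = (\<lambda>J. Dx0 \<phi> J - Dx0 \<xi> J *\<^sub>R snd (snd J))"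
        by (auto simp: prolong1_def)
      moreover have "(\<lambda>J. Dx0 \<phi> J - Dx0 \<xi> J *\<^sub>R snd (snd J)) differentiable (at (t, y t, y1 t))"
        using diff0[OF \<phi> t] diff0[OF \<xi> t] bounded_linear_imp_differentiable[OF
            bounded_linear_compose[OF bounded_linear_snd bounded_linear_snd]]
        by (intro differentiable_diff differentiable_scaleR) blast+
      ultimately show "prolong1 \<xi> \<phi> differentiable (at (t, y t, y1 t))" by simp
    qed
    moreover have "((\<lambda>s. prolong1 \<xi> \<phi> (s, y s, y1 s)) has_vector_derivative
        F2 t - (X1 t *\<^sub>R y2 t + X2 t *\<^sub>R y1 t)) (at t)"
      unfolding prolong1_def prod.case F1_def[symmetric] X1_def[symmetric]
      by (intro has_vector_derivative_diff scaleR_deriv dF dy t)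
    ultimately have D: "Dx1 (prolong1 \<xi> \<phi>) (t, y t, y1 t, y2 t) = F2 t - (X1 t *\<^sub>R y2 t + X2 t *\<^sub>R y1 t)"
      by (rule vector_derivative_unique_at)
    have P1: "prolong1 \<xi> \<phi> (t, y t, y1 t) = F1 t - X1 t *\<^sub>R y1 t"
      by (simp add: prolong1_def F1_def X1_def)
    have P2: "prolong2 \<xi> \<phi> (t, y t, y1 t, y2 t) = F2 t - (X1 t *\<^sub>R y2 t + X2 t *\<^sub>R y1 t) - X1 t *\<^sub>R y2 t"
      unfolding prolong2_def prod.case D X1_def ..
    show "apply_prolonged \<xi> \<phi> \<Delta> (t, y t, y1 t, rhs t (y t) (y1 t)) =
       \<chi>2 t + A1 t *v \<chi>1 t + A0 t *v (\<phi> (t, y t) - \<xi> (t, y t) *\<^sub>R y1 t)"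
      \<comment> \<open>The terms with undifferentiated \<xi> match because \<open>y3\<close>
        contains the x-derivatives of the coefficients, which are also what the vector field picks
        up from the explicit dependence of the system on x.\<close>
      unfolding apply_prolonged_def prod.case y2_def[symmetric] P1 P2 frechet_lin_sys[OF t]
        F_def[symmetric] X_def[symmetric] \<chi>1_def \<chi>2_def y3_def
      by (simp add: vec_eq_iff forall_2 matrix_vector_mult_def sum_2 algebra_simps)
  qed
qed

text \<open>Every second-order jet satisfying the system is the jet of a solution: position and
  velocity are free and determine y''. So the condition may be tested along solutions.\<close>

lemma lie_symmetryI:
  assumes \<xi>: "smooth_on \<xi> (I \<times> UNIV)" and \<phi>: "smooth_on \<phi> (I \<times> UNIV)"
    and "\<And>y y1. solves y y1 \<Longrightarrow> \<exists>\<chi>1. \<forall>t\<in>I.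
      ((\<lambda>s. \<phi> (s, y s) - \<xi> (s, y s) *\<^sub>R y1 s) has_vector_derivative \<chi>1 t) (at t) \<and>
      (\<chi>1 has_vector_derivative - (A1 t *v \<chi>1 t) - A0 t *v (\<phi> (t, y t) - \<xi> (t, y t) *\<^sub>R y1 t)) (at t)"
  shows "lie_symmetry I \<Delta> \<xi> \<phi>"
  unfolding lie_symmetry_def
proof (intro conjI ballI allI impI \<xi> \<phi>)
  fix x y y1 y2 assume x: "x \<in> I" and 0: "\<Delta> (x, y, y1, y2) = 0"
  obtain u u1 where u: "solves u u1" "u x = y" "u1 x = y1"
    using smooth_solution_exists[OF x] .
  obtain \<chi>1 \<chi>2 where \<chi>:
    "\<And>t. t \<in> I \<Longrightarrow> ((\<lambda>s. \<phi> (s, u s) - \<xi> (s, u s) *\<^sub>R u1 s) has_vector_derivative \<chi>1 t) (at t)"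
    "\<And>t. t \<in> I \<Longrightarrow> (\<chi>1 has_vector_derivative \<chi>2 t) (at t)"
    "\<And>t. t \<in> I \<Longrightarrow> apply_prolonged \<xi> \<phi> \<Delta> (t, u t, u1 t, rhs t (u t) (u1 t)) =
       \<chi>2 t + A1 t *v \<chi>1 t + A0 t *v (\<phi> (t, u t) - \<xi> (t, u t) *\<^sub>R u1 t)"
    using apply_prolonged_characteristic[OF \<xi> \<phi> u(1)] by blast
  obtain c1 where c1: "\<And>t. t \<in> I \<Longrightarrow> ((\<lambda>s. \<phi> (s, u s) - \<xi> (s, u s) *\<^sub>R u1 s) has_vector_derivative c1 t) (at t)"
    "\<And>t. t \<in> I \<Longrightarrow> (c1 has_vector_derivative - (A1 t *v c1 t) - A0 t *v (\<phi> (t, u t) - \<xi> (t, u t) *\<^sub>R u1 t)) (at t)"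
    using assms(3)[OF u(1)] by blast
  have eq: "\<chi>1 t = c1 t" if "t \<in> I" for t
    using vector_derivative_unique_at[OF \<chi>(1)[OF that] c1(1)[OF that]] .
  have "(c1 has_vector_derivative \<chi>2 x) (at x)"
    by (rule has_vector_derivative_cong_open[OF I(1) x eq \<chi>(2)[OF x]])
  then have "\<chi>2 x = - (A1 x *v c1 x) - A0 x *v (\<phi> (x, u x) - \<xi> (x, u x) *\<^sub>R u1 x)"
    by (rule vector_derivative_unique_at[OF _ c1(2)[OF x]])
  then show "apply_prolonged \<xi> \<phi> \<Delta> (x, y, y1, y2) = 0"
    using \<chi>(3)[OF x] 0 u by (simp add: lin_sys_eq_0_iff eq[OF x])
qed

lemma lie_symmetryD:
  assumes "lie_symmetry I \<Delta> \<xi> \<phi>" "solves y y1"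
  obtains \<chi>1 where
    "\<And>t. t \<in> I \<Longrightarrow> ((\<lambda>s. \<phi> (s, y s) - \<xi> (s, y s) *\<^sub>R y1 s) has_vector_derivative \<chi>1 t) (at t)"
    "\<And>t. t \<in> I \<Longrightarrow> (\<chi>1 has_vector_derivative
        - (A1 t *v \<chi>1 t) - A0 t *v (\<phi> (t, y t) - \<xi> (t, y t) *\<^sub>R y1 t)) (at t)"
proof -
  have sm: "smooth_on \<xi> (I \<times> UNIV)" "smooth_on \<phi> (I \<times> UNIV)"
    using assms(1) by (auto simp: lie_symmetry_def)
  obtain \<chi>1 \<chi>2 where \<chi>:
    "\<And>t. t \<in> I \<Longrightarrow> ((\<lambda>s. \<phi> (s, y s) - \<xi> (s, y s) *\<^sub>R y1 s) has_vector_derivative \<chi>1 t) (at t)"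
    "\<And>t. t \<in> I \<Longrightarrow> (\<chi>1 has_vector_derivative \<chi>2 t) (at t)"
    "\<And>t. t \<in> I \<Longrightarrow> apply_prolonged \<xi> \<phi> \<Delta> (t, y t, y1 t, rhs t (y t) (y1 t)) =
       \<chi>2 t + A1 t *v \<chi>1 t + A0 t *v (\<phi> (t, y t) - \<xi> (t, y t) *\<^sub>R y1 t)"
    using apply_prolonged_characteristic[OF sm assms(2)] by blast
  have "\<chi>2 t = - (A1 t *v \<chi>1 t) - A0 t *v (\<phi> (t, y t) - \<xi> (t, y t) *\<^sub>R y1 t)" if "t \<in> I" for t
  proof -
    have "apply_prolonged \<xi> \<phi> \<Delta> (t, y t, y1 t, rhs t (y t) (y1 t)) = 0"
      using assms(1) that lin_sys_eq_0_iff unfolding lie_symmetry_def by blast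
    then show ?thesis
      unfolding \<chi>(3)[OF that] by (simp add: algebra_simps eq_neg_iff_add_eq_0)
  qed
  then show ?thesis
    using that[OF \<chi>(1)] \<chi>(2) by simp
qed

end

section \<open>The gauge\<close>

interpretation mv: bounded_bilinear "(*v) :: real^2^2 \<Rightarrow> real^2 \<Rightarrow> real^2"
  by (rule bounded_bilinear_matrix_vector_mult)

interpretation mm: bounded_bilinear "(**) :: real^2^2 \<Rightarrow> real^2^2 \<Rightarrow> real^2^2"
  by (rule bounded_bilinear_matrix_matrix_mult)

lemmas mv_simps = mv.add_left mv.add_right mv.diff_left mv.diff_right mv.minus_left mv.minus_right
  mv.scaleR_left mv.scaleR_right matrix_vector_mul_assoc[symmetric]

text \<open>The factor 1/2 makes 2 T' + A1 T vanish, which is the coefficient of u' once y = T u is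
  inserted. The inverse S comes with its own differential equation, so its smoothness and its
  derivative are at hand.\<close>

locale gauged_system = linear_system +
  fixes T S :: "real \<Rightarrow> real^2^2"
  assumes T: "smooth_on T I" and S: "smooth_on S I"
    and dT: "t \<in> I \<Longrightarrow> (T has_vector_derivative (- 1 / 2) *\<^sub>R (A1 t ** T t)) (at t)"
    and dS: "t \<in> I \<Longrightarrow> (S has_vector_derivative (1 / 2) *\<^sub>R (S t ** A1 t)) (at t)"
    and ST: "t \<in> I \<Longrightarrow> S t ** T t = mat 1"

lemma (in linear_system) gauge_exists:
  assumes "t0 \<in> I"
  obtains T S where "gauged_system I A1 A0 b T S"
proof -
  have sc: "smooth_on (\<lambda>t. c *\<^sub>R A1 t) I" for c
    using smooth_on_linear_compose[OF I(1) bounded_linear_scaleR_right A1] .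
  obtain T where T: "smooth_on T I" "T t0 = mat 1"
    "\<And>t. t \<in> I \<Longrightarrow> (T has_vector_derivative (- 1 / 2) *\<^sub>R A1 t ** T t) (at t)"
    using linear_ode1[OF I assms bounded_bilinear_matrix_matrix_mult sc] by blast
  obtain S where S: "smooth_on S I" "S t0 = mat 1"
    "\<And>t. t \<in> I \<Longrightarrow> (S has_vector_derivative S t ** ((1 / 2) *\<^sub>R A1 t)) (at t)"
    using linear_ode1[OF I assms bounded_bilinear.flip[OF bounded_bilinear_matrix_matrix_mult] sc] by blast
  have "S t ** T t = mat 1" if "t \<in> I" for t
  proof -
    \<comment> \<open>S' T and S T' are plus and minus half of S A1 T, so the product keeps its
      initial value.\<close>
    have "((\<lambda>t. S t ** T t) has_vector_derivative 0) (at s)" if "s \<in> I" for s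
      using mm_deriv[OF S(3)[OF that] T(3)[OF that]]
      by (simp add: mm.scaleR_left mm.scaleR_right mm.minus_left mm.minus_right matrix_mul_assoc)
    from const_of_vector_derivative_zero[OF I(2) this \<open>t \<in> I\<close> assms] show ?thesis
      by (simp add: T S)
  qed
  then show ?thesis
    using that[of T S] T S linear_system_axioms
    by (simp add: gauged_system_def gauged_system_axioms_def mm.scaleR_left mm.scaleR_right mm.minus_left)
qed

context gauged_system
begin

lemma TS: "t \<in> I \<Longrightarrow> T t ** S t = mat 1"
  using ST matrix_left_right_inverse by blast

lemma S_T_vec: "t \<in> I \<Longrightarrow> S t *v (T t *v v) = v"
  by (simp add: matrix_vector_mul_assoc ST)

lemma T_S_vec: "t \<in> I \<Longrightarrow> T t *v (S t *v v) = v"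
  by (simp add: matrix_vector_mul_assoc TS)

text \<open>From T' = - A1 T / 2 follows T'' + A1 T' + A0 T = Q0 T, the zeroth-order coefficient
  after inserting y = T u. Multiplying the equation by S turns it into the potential Q.\<close>

definition Q0 where "Q0 t = A0 t - (1 / 2) *\<^sub>R A1' t - (1 / 4) *\<^sub>R (A1 t ** A1 t)"

definition Q where "Q t = S t ** Q0 t ** T t"

lemma smooth_Q: "smooth_on Q I"
  unfolding Q_def[abs_def] Q0_def
  by (intro smooth_on_bilinear[OF I(1) bounded_bilinear_matrix_matrix_mult] smooth_on_diff I(1) T S A0 A1
      smooth_on_linear_compose[OF I(1) bounded_linear_scaleR_right] smooth_on_vector_derivative)

lemma T_Q: "t \<in> I \<Longrightarrow> T t *v (Q t *v v) = Q0 t *v (T t *v v)"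
  by (simp add: Q_def matrix_vector_mul_assoc[symmetric] T_S_vec)

lemma Q_S: "t \<in> I \<Longrightarrow> Q t *v (S t *v v) = S t *v (Q0 t *v v)"
  by (simp add: Q_def matrix_vector_mul_assoc[symmetric] T_S_vec)

text \<open>The derivative of T u when u' = \<open>u1\<close>, with T' eliminated by its
  differential equation.\<close>

definition T_lift :: "(real \<Rightarrow> real^2) \<Rightarrow> (real \<Rightarrow> real^2) \<Rightarrow> real \<Rightarrow> real^2" where
  "T_lift u u1 t = T t *v u1 t - (1 / 2) *\<^sub>R (A1 t *v (T t *v u t))"

lemma deriv_T_vec:
  assumes "t \<in> I" "(u has_vector_derivative u1 t) (at t)"
  shows "((\<lambda>t. T t *v u t) has_vector_derivative T_lift u u1 t) (at t)"
  using mv_deriv[OF dT[OF assms(1)] assms(2)]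
  by (simp add: T_lift_def mv_simps)

text \<open>\<open>u2\<close> is not tied to any equation: T carries the residual u'' + Q u to the
  residual of the homogeneous system at T u.\<close>

lemma deriv_T_lift:
  assumes "t \<in> I" "(u has_vector_derivative u1 t) (at t)" "(u1 has_vector_derivative u2) (at t)"
  shows "(T_lift u u1 has_vector_derivative
    T t *v (u2 + Q t *v u t) - A1 t *v T_lift u u1 t - A0 t *v (T t *v u t)) (at t)"
proof -
  have 1: "((\<lambda>t. A1 t *v (T t *v u t)) has_vector_derivative
     A1 t *v T_lift u u1 t + A1' t *v (T t *v u t)) (at t)"
    by (rule mv_deriv[OF A1'[OF assms(1)] deriv_T_vec[of t u u1, OF assms(1,2)]])
  have "(T_lift u u1 has_vector_derivative
     (T t *v u2 + ((- 1 / 2) *\<^sub>R (A1 t ** T t)) *v u1 t)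
      - (1 / 2) *\<^sub>R (A1 t *v T_lift u u1 t + A1' t *v (T t *v u t))) (at t)"
  proof -
    have "T_lift u u1 = (\<lambda>t. T t *v u1 t - (1 / 2) *\<^sub>R (A1 t *v (T t *v u t)))"
      by (simp add: T_lift_def fun_eq_iff)
    moreover have "((\<lambda>t. T t *v u1 t - (1 / 2) *\<^sub>R (A1 t *v (T t *v u t))) has_vector_derivative
     (T t *v u2 + ((- 1 / 2) *\<^sub>R (A1 t ** T t)) *v u1 t)
      - (1 / 2) *\<^sub>R (A1 t *v T_lift u u1 t + A1' t *v (T t *v u t))) (at t)"
      by (intro has_vector_derivative_diff mv_deriv dT assms
        bounded_linear.has_vector_derivative[OF bounded_linear_scaleR_right] 1)
    ultimately show ?thesis by simp
  qed
  then show ?thesis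
    by (rule has_vector_derivative_eq_rhs)
       (simp add: T_lift_def T_Q[OF assms(1)] Q0_def mv_simps, simp add: vec_eq_iff forall_2 field_simps)
qed

definition S_lift :: "(real \<Rightarrow> real^2) \<Rightarrow> (real \<Rightarrow> real^2) \<Rightarrow> real \<Rightarrow> real^2" where
  "S_lift y y1 t = S t *v y1 t + (1 / 2) *\<^sub>R (S t *v (A1 t *v y t))"

lemma deriv_S_vec:
  assumes "t \<in> I" "(y has_vector_derivative y1 t) (at t)"
  shows "((\<lambda>t. S t *v y t) has_vector_derivative S_lift y y1 t) (at t)"
  using mv_deriv[OF dS[OF assms(1)] assms(2)]
  by (simp add: S_lift_def mv_simps)

text \<open>The transport of residuals in the other direction. Arbitrary \<open>y2\<close> is
  essential for reducibility, where jets off the equation have to be tested as well.\<close>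

lemma deriv_S_lift:
  assumes "t \<in> I" "(y has_vector_derivative y1 t) (at t)" "(y1 has_vector_derivative y2) (at t)"
  shows "(S_lift y y1 has_vector_derivative
    S t *v (y2 + A1 t *v y1 t + A0 t *v y t) - Q t *v (S t *v y t)) (at t)"
proof -
  have "(S_lift y y1 has_vector_derivative
     (S t *v y2 + ((1 / 2) *\<^sub>R (S t ** A1 t)) *v y1 t)
      + (1 / 2) *\<^sub>R (S t *v (A1 t *v y1 t + A1' t *v y t) + ((1 / 2) *\<^sub>R (S t ** A1 t)) *v (A1 t *v y t))) (at t)"
    unfolding S_lift_def[abs_def]
    by (intro has_vector_derivative_add mv_deriv dS A1' assms
        bounded_linear.has_vector_derivative[OF bounded_linear_scaleR_right])
  then show ?thesis
    by (rule has_vector_derivative_eq_rhs)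
       (simp add: Q_S[OF assms(1)] Q0_def mv_simps, simp add: vec_eq_iff forall_2 field_simps)
qed

definition reduced_sol :: "(real \<Rightarrow> real^2) \<Rightarrow> (real \<Rightarrow> real^2) \<Rightarrow> bool" where
  "reduced_sol u u1 \<longleftrightarrow> (\<forall>t\<in>I. (u has_vector_derivative u1 t) (at t) \<and>
     (u1 has_vector_derivative - (Q t *v u t)) (at t))"

lemma reduced_sol_exists:
  assumes "t0 \<in> I"
  obtains u u1 where "reduced_sol u u1" "u t0 = v" "u1 t0 = w" "smooth_on u I" "smooth_on u1 I"
proof -
  interpret red: linear_system I "\<lambda>_. 0" Q "\<lambda>_. 0"
    by unfold_locales (auto intro: I smooth_on_const smooth_Q)
  obtain u u1 where "smooth_on u I" "smooth_on u1 I" "red.solves u u1" "u t0 = v" "u1 t0 = w"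
    using red.smooth_solution_exists[OF assms] .
  then show ?thesis
    using that[of u u1] by (auto simp: reduced_sol_def red.solves_def red.rhs_def mv.zero_left)
qed

lemma solves_of_reduced_sol:
  assumes "solves p p1" "reduced_sol u u1"
  shows "solves (\<lambda>t. p t + T t *v u t) (\<lambda>t. p1 t + T_lift u u1 t)"
  unfolding solves_def
proof (intro ballI conjI)
  fix t assume t: "t \<in> I"
  have u: "(u has_vector_derivative u1 t) (at t)" "(u1 has_vector_derivative - (Q t *v u t)) (at t)"
    and p: "(p has_vector_derivative p1 t) (at t)" "(p1 has_vector_derivative rhs t (p t) (p1 t)) (at t)"
    using assms t by (auto simp: reduced_sol_def solves_def)
  show "((\<lambda>t. p t + T t *v u t) has_vector_derivative p1 t + T_lift u u1 t) (at t)"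
    by (intro has_vector_derivative_add p deriv_T_vec t u)
  have "((\<lambda>t. p1 t + T_lift u u1 t) has_vector_derivative rhs t (p t) (p1 t)
     + (T t *v (- (Q t *v u t) + Q t *v u t) - A1 t *v T_lift u u1 t - A0 t *v (T t *v u t))) (at t)"
    by (intro has_vector_derivative_add p deriv_T_lift t u)
  then show "((\<lambda>t. p1 t + T_lift u u1 t) has_vector_derivative
      rhs t (p t + T t *v u t) (p1 t + T_lift u u1 t)) (at t)"
    by (rule has_vector_derivative_eq_rhs) (simp add: rhs_def mv_simps mv.zero_right algebra_simps)
qed

lemma reduced_sol_of_solves:
  assumes "solves p p1" "solves y y1"
  shows "reduced_sol (\<lambda>t. S t *v (y t - p t)) (S_lift (\<lambda>t. y t - p t) (\<lambda>t. y1 t - p1 t))"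
  unfolding reduced_sol_def
proof (intro ballI conjI)
  fix t assume t: "t \<in> I"
  have y: "(y has_vector_derivative y1 t) (at t)" "(y1 has_vector_derivative rhs t (y t) (y1 t)) (at t)"
    and p: "(p has_vector_derivative p1 t) (at t)" "(p1 has_vector_derivative rhs t (p t) (p1 t)) (at t)"
    using assms t by (auto simp: solves_def)
  show "((\<lambda>t. S t *v (y t - p t)) has_vector_derivative
      S_lift (\<lambda>t. y t - p t) (\<lambda>t. y1 t - p1 t) t) (at t)"
    by (intro deriv_S_vec t has_vector_derivative_diff y p)
  have "(S_lift (\<lambda>t. y t - p t) (\<lambda>t. y1 t - p1 t) has_vector_derivative
     S t *v ((rhs t (y t) (y1 t) - rhs t (p t) (p1 t)) + A1 t *v (y1 t - p1 t) + A0 t *v (y t - p t))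
      - Q t *v (S t *v (y t - p t))) (at t)"
    by (intro deriv_S_lift t has_vector_derivative_diff y p)
  moreover have "(rhs t (y t) (y1 t) - rhs t (p t) (p1 t)) + A1 t *v (y1 t - p1 t) + A0 t *v (y t - p t) = 0"
    by (simp add: rhs_def mv_simps)
  ultimately show "(S_lift (\<lambda>t. y t - p t) (\<lambda>t. y1 t - p1 t) has_vector_derivative
     - (Q t *v (S t *v (y t - p t)))) (at t)"
    by (simp add: mv.zero_right)
qed

lemma T_lift_S_lift:
  "t \<in> I \<Longrightarrow> T_lift (\<lambda>t. S t *v y t) (S_lift y y1) t = y1 t"
  by (simp add: T_lift_def S_lift_def T_S_vec mv_simps)

end

section \<open>Second derivatives along curves\<close>

text \<open>After s = 0, the sum of the values at 1 and -1 isolates \<open>c2\<close>; then s = 2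
  separates \<open>c3\<close> from \<open>c1\<close>.\<close>

lemma cubic_coeffs_zero:
  fixes c0 c1 c2 c3 :: "'a::real_vector"
  assumes "\<And>s::real. c0 + s *\<^sub>R c1 + s\<^sup>2 *\<^sub>R c2 + s ^ 3 *\<^sub>R c3 = 0"
  shows "c2 = 0" "c3 = 0"
proof -
  have 0: "c0 = 0" using assms[of 0] by simp
  have 1: "c1 + c2 + c3 = 0" using assms[of 1] 0 by simp
  have m1: "- c1 + c2 - c3 = 0" using assms[of "-1"] 0 by simp
  have "2 *\<^sub>R c2 = (c1 + c2 + c3) + (- c1 + c2 - c3)" by (simp add: scaleR_2)
  then show c2: "c2 = 0" using 1 m1 by simp
  have c1: "c1 = - c3" using 1 c2 by (simp add: eq_neg_iff_add_eq_0)
  have "2 *\<^sub>R c1 + 8 *\<^sub>R c3 = 0" using assms[of 2] 0 c2 by simp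
  then have "6 *\<^sub>R c3 = 0" unfolding c1 by (simp add: scaleR_left_distrib[symmetric])
  then show "c3 = 0" by simp
qed

text \<open>The slope c may vary with the line. Lines through 0 give homogeneity; the line through u
  and v, seen from their midpoint, gives additivity.\<close>

lemma affine_of_affine_on_lines:
  fixes h :: "'a::real_vector \<Rightarrow> 'b::real_vector"
  assumes "\<And>u p. \<exists>c. \<forall>t. h (u + t *\<^sub>R p) = h u + t *\<^sub>R c"
  shows "linear (\<lambda>u. h u - h 0)"
proof -
  define L where "L u = h u - h 0" for u
  have sc: "L (t *\<^sub>R p) = t *\<^sub>R L p" for t p
  proof -
    obtain c where c: "\<And>t. h (0 + t *\<^sub>R p) = h 0 + t *\<^sub>R c" using assms by blast
    show ?thesis using c[of t] c[of 1] by (simp add: L_def)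
  qed
  have mid: "L (u + p) + L (u - p) = 2 *\<^sub>R L u" for u p
  proof -
    obtain c where c: "\<And>t. h (u + t *\<^sub>R p) = h u + t *\<^sub>R c" using assms by blast
    show ?thesis using c[of 1] c[of "-1"] by (simp add: L_def scaleR_2)
  qed
  have "L (u + v) = L u + L v" for u v
  proof -
    let ?a = "(1/2) *\<^sub>R (u + v)" and ?d = "(1/2) *\<^sub>R (u - v)"
    have "?a + ?d = u" "?a - ?d = v"
      by (simp_all add: algebra_simps flip: scaleR_add_left)
    with mid[of ?a ?d] show ?thesis by (simp add: sc)
  qed
  then show ?thesis unfolding L_def[symmetric] by (intro linearI sc)
qed

lemma affine_on_line:
  fixes k :: "real \<Rightarrow> 'a::real_normed_vector"
  assumes "\<And>t. (k has_vector_derivative k1 t) (at t)" "\<And>t. (k1 has_vector_derivative 0) (at t)"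
  shows "k t = k 0 + t *\<^sub>R k1 0"
proof -
  have k1: "k1 s = k1 0" for s
    by (rule const_of_vector_derivative_zero[of UNIV]) (use assms in auto)
  have "((\<lambda>t. k t - t *\<^sub>R k1 0) has_vector_derivative k1 s - (s *\<^sub>R 0 + 1 *\<^sub>R k1 0)) (at s)" for s
    by (intro has_vector_derivative_diff assms scaleR_deriv has_vector_derivative_const)
       (rule has_vector_derivative_id[unfolded id_def])
  moreover have "k1 s - (s *\<^sub>R 0 + 1 *\<^sub>R k1 0) = 0" for s
    by (simp add: k1[of s])
  ultimately have "((\<lambda>t. k t - t *\<^sub>R k1 0) has_vector_derivative 0) (at s)" for s
    by (rule has_vector_derivative_eq_rhs)
  from const_of_vector_derivative_zero[of UNIV, OF _ this, of t 0] show ?thesis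
    by (simp add: algebra_simps)
qed

definition second_deriv :: "(point \<Rightarrow> 'b::real_normed_vector) \<Rightarrow> point \<Rightarrow> point \<Rightarrow> point \<Rightarrow> 'b" where
  "second_deriv g P v w = frechet_derivative (\<lambda>R. frechet_derivative g (at R) v) (at P) w"

text \<open>The derivative in direction (0, p), spelled out in axis directions. Along a solution p =
  u' moves, and it is the derivatives in fixed directions that can be differentiated again.\<close>

definition vert_deriv :: "(point \<Rightarrow> 'b::real_normed_vector) \<Rightarrow> point \<Rightarrow> real^2 \<Rightarrow> 'b" where
  "vert_deriv g P p = p $ 1 *\<^sub>R frechet_derivative g (at P) (0, axis 1 1)
     + p $ 2 *\<^sub>R frechet_derivative g (at P) (0, axis 2 1)"

text \<open>The part linear in p of the second derivative along a graph with velocity p, with the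
  two orders of mixed differentiation as separate summands; \<open>vert_part\<close> is the part
  quadratic in p.\<close>

definition mixed_part :: "(point \<Rightarrow> 'b::real_normed_vector) \<Rightarrow> point \<Rightarrow> real^2 \<Rightarrow> 'b" where
  "mixed_part g P p = second_deriv g P (1, 0) (0, p)
     + (p $ 1 *\<^sub>R second_deriv g P (0, axis 1 1) (1, 0) + p $ 2 *\<^sub>R second_deriv g P (0, axis 2 1) (1, 0))"

definition vert_part :: "(point \<Rightarrow> 'b::real_normed_vector) \<Rightarrow> point \<Rightarrow> real^2 \<Rightarrow> 'b" where
  "vert_part g P p = p $ 1 *\<^sub>R second_deriv g P (0, axis 1 1) (0, p)
     + p $ 2 *\<^sub>R second_deriv g P (0, axis 2 1) (0, p)"

lemma vec2_expand: "(p :: real^2) = p $ 1 *\<^sub>R axis 1 1 + p $ 2 *\<^sub>R axis 2 1"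
  by (simp add: vec_eq_iff forall_2 axis_def)

lemma linear_point_expand:
  assumes "linear (L :: point \<Rightarrow> 'b::real_vector)"
  shows "L (a, p) = a *\<^sub>R L (1, 0) + (p $ 1 *\<^sub>R L (0, axis 1 1) + p $ 2 *\<^sub>R L (0, axis 2 1))"
proof -
  have "(a, p) = a *\<^sub>R (1, 0) + (p $ 1 *\<^sub>R (0, axis 1 1) + p $ 2 *\<^sub>R (0, axis 2 1))"
    using vec2_expand[of p] by simp
  then show ?thesis
    by (metis linear_add[OF assms] linear_scale[OF assms])
qed

lemma linear_point_split:
  assumes "linear (L :: point \<Rightarrow> 'b::real_vector)"
  shows "L (1, p) = L (1, 0) + L (0, p)"
  using linear_add[OF assms, of "(1, 0)" "(0, p)"] by simp

context
  fixes g :: "point \<Rightarrow> 'b::real_normed_vector" and U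
  assumes g: "smooth_on g U"
begin

lemma linear_frechet: "P \<in> U \<Longrightarrow> linear (frechet_derivative g (at P))"
  using smooth_on_has_derivative[OF g] has_derivative_linear by blast

lemma linear_second_deriv: "P \<in> U \<Longrightarrow> linear (second_deriv g P v)"
  unfolding second_deriv_def
  using smooth_on_has_derivative[OF smooth_on_frechet[OF g]] has_derivative_linear by blast

lemma vert_deriv_eq: "P \<in> U \<Longrightarrow> vert_deriv g P p = frechet_derivative g (at P) (0, p)"
  using linear_point_expand[OF linear_frechet, of P 0 p] by (simp add: vert_deriv_def)

lemma vert_part_scale: "P \<in> U \<Longrightarrow> vert_part g P (s *\<^sub>R p) = s\<^sup>2 *\<^sub>R vert_part g P p"
  using linear_scale[OF linear_second_deriv, of P _ s "(0, p)"]
  by (simp add: vert_part_def power2_eq_square scaleR_add_right mult_ac)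

lemma mixed_part_scale: "P \<in> U \<Longrightarrow> mixed_part g P (s *\<^sub>R p) = s *\<^sub>R mixed_part g P p"
  using linear_scale[OF linear_second_deriv, of P _ s "(0, p)"]
  by (simp add: mixed_part_def scaleR_add_right mult_ac)

lemma has_vector_derivative_curve:
  assumes "(c has_vector_derivative v) (at t)" "c t \<in> U"
  shows "((\<lambda>t. g (c t)) has_vector_derivative frechet_derivative g (at (c t)) v) (at t)"
  using has_vector_derivative_compose_curve[OF smooth_on_has_derivative[OF g] assms(1)] assms(2) by blast

lemma has_vector_derivative_frechet_curve:
  assumes "(c has_vector_derivative v) (at t)" "c t \<in> U"
  shows "((\<lambda>t. frechet_derivative g (at (c t)) w) has_vector_derivative second_deriv g (c t) w v) (at t)"
  unfolding second_deriv_def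
  using has_vector_derivative_compose_curve[OF
      smooth_on_has_derivative[OF smooth_on_frechet[OF g]] assms(1)] assms(2) by blast

text \<open>The second derivative is sorted by degree in the velocity, with the acceleration apart.
  For the reduced equation the acceleration depends on the position only, so comparing degrees in
  the velocity is legitimate.\<close>

lemma second_derivative_graph:
  assumes "\<And>t. t \<in> I \<Longrightarrow> (u has_vector_derivative u1 t) (at t)"
    and "\<And>t. t \<in> I \<Longrightarrow> (u1 has_vector_derivative u2 t) (at t)"
    and "\<And>t. t \<in> I \<Longrightarrow> (t, u t) \<in> U" and t: "t \<in> I"
  defines "G1 \<equiv> \<lambda>t. frechet_derivative g (at (t, u t)) (1, 0) + vert_deriv g (t, u t) (u1 t)"
  shows "((\<lambda>t. g (t, u t)) has_vector_derivative G1 t) (at t)"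
    and "(G1 has_vector_derivative second_deriv g (t, u t) (1, 0) (1, 0) + mixed_part g (t, u t) (u1 t)
       + vert_part g (t, u t) (u1 t) + vert_deriv g (t, u t) (u2 t)) (at t)"
proof -
  have c: "((\<lambda>t. (t, u t)) has_vector_derivative (1, u1 t)) (at t)"
    using has_vector_derivative_Pair[OF has_vector_derivative_id[unfolded id_def] assms(1)[OF t]] .
  note P = assms(3)[OF t]
  show "((\<lambda>t. g (t, u t)) has_vector_derivative G1 t) (at t)"
    using has_vector_derivative_curve[OF c P]
    unfolding G1_def vert_deriv_eq[OF P] linear_point_split[OF linear_frechet[OF P], of "u1 t"] .
  have comp: "((\<lambda>t. u1 t $ i) has_real_derivative u2 t $ i) (at t)" for i
    using bounded_linear.has_vector_derivative[OF bounded_linear_vec_nth assms(2)[OF t], of i]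
    by (simp add: has_real_derivative_iff_has_vector_derivative)
  have "(G1 has_vector_derivative second_deriv g (t, u t) (1, 0) (1, u1 t) +
     ((u1 t $ 1 *\<^sub>R second_deriv g (t, u t) (0, axis 1 1) (1, u1 t)
        + u2 t $ 1 *\<^sub>R frechet_derivative g (at (t, u t)) (0, axis 1 1)) +
      (u1 t $ 2 *\<^sub>R second_deriv g (t, u t) (0, axis 2 1) (1, u1 t)
        + u2 t $ 2 *\<^sub>R frechet_derivative g (at (t, u t)) (0, axis 2 1)))) (at t)"
    unfolding G1_def vert_deriv_def
    by (intro has_vector_derivative_add has_vector_derivative_scaleR comp
        has_vector_derivative_frechet_curve[OF c P])
  then show "(G1 has_vector_derivative second_deriv g (t, u t) (1, 0) (1, 0) + mixed_part g (t, u t) (u1 t)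
       + vert_part g (t, u t) (u1 t) + vert_deriv g (t, u t) (u2 t)) (at t)"
    by (rule has_vector_derivative_eq_rhs)
      (simp add: mixed_part_def vert_part_def vert_deriv_def
        linear_point_split[OF linear_second_deriv[OF P], of _ "u1 t"] algebra_simps)
qed

lemma second_derivative_vertical:
  assumes "\<And>v. (x, v) \<in> U"
  shows "((\<lambda>t. g (x, u + t *\<^sub>R p)) has_vector_derivative vert_deriv g (x, u + t *\<^sub>R p) p) (at t)"
    and "((\<lambda>t. vert_deriv g (x, u + t *\<^sub>R p) p) has_vector_derivative vert_part g (x, u + t *\<^sub>R p) p) (at t)"
proof -
  have c: "((\<lambda>t. (x, u + t *\<^sub>R p)) has_vector_derivative (0, p)) (at t)"
    by (intro has_vector_derivative_Pair) (auto intro!: derivative_eq_intros)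
  show "((\<lambda>t. g (x, u + t *\<^sub>R p)) has_vector_derivative vert_deriv g (x, u + t *\<^sub>R p) p) (at t)"
    using has_vector_derivative_curve[OF c assms] unfolding vert_deriv_eq[OF assms] .
  have "((\<lambda>t. p $ i *\<^sub>R frechet_derivative g (at (x, u + t *\<^sub>R p)) (0, axis i 1)) has_vector_derivative
      p $ i *\<^sub>R second_deriv g (x, u + t *\<^sub>R p) (0, axis i 1) (0, p)) (at t)" for i
    by (intro bounded_linear.has_vector_derivative[OF bounded_linear_scaleR_right]
        has_vector_derivative_frechet_curve[OF c assms])
  then show "((\<lambda>t. vert_deriv g (x, u + t *\<^sub>R p) p) has_vector_derivative vert_part g (x, u + t *\<^sub>R p) p) (at t)"
    unfolding vert_deriv_def vert_part_def by (intro has_vector_derivative_add)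
qed

end

section \<open>Non-Cartan symmetries\<close>

text \<open>Two computations of f' agree on an open set, so either may be differentiated once more.
  This compares product-rule expansions with differential equations.\<close>

lemma second_derivative_unique:
  assumes "open I" "x \<in> I"
    and "\<And>t. t \<in> I \<Longrightarrow> (f has_vector_derivative f1 t) (at t)" "(f1 has_vector_derivative f2) (at x)"
    and "\<And>t. t \<in> I \<Longrightarrow> (f has_vector_derivative g1 t) (at t)" "(g1 has_vector_derivative g2) (at x)"
  shows "f2 = g2"
proof -
  have "f1 t = g1 t" if "t \<in> I" for t
    by (rule vector_derivative_unique_at[OF assms(3)[OF that] assms(5)[OF that]])
  from has_vector_derivative_cong_open[OF assms(1,2) this assms(4)] show ?thesis
    by (rule vector_derivative_unique_at[OF _ assms(6)])
qed

context gauged_system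
begin

abbreviation Q' where "Q' t \<equiv> vector_derivative Q (at t)"

lemmas dQ = smooth_on_real_has_derivative[OF smooth_Q]

lemma reduced_solD:
  assumes "reduced_sol u u1" "t \<in> I"
  shows "(u has_vector_derivative u1 t) (at t)" "(u1 has_vector_derivative - (Q t *v u t)) (at t)"
    "((\<lambda>t. - (Q t *v u t)) has_vector_derivative - (Q t *v u1 t + Q' t *v u t)) (at t)"
proof -
  show u: "(u has_vector_derivative u1 t) (at t)" "(u1 has_vector_derivative - (Q t *v u t)) (at t)"
    using assms by (auto simp: reduced_sol_def)
  show "((\<lambda>t. - (Q t *v u t)) has_vector_derivative - (Q t *v u1 t + Q' t *v u t)) (at t)"
    by (intro has_vector_derivative_minus mv_deriv dQ assms u)
qed

text \<open>The evolutionary form of a symmetry, stated through solutions alone. In this form the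
  gauge applies without transforming prolongations.\<close>

definition reduced_symmetry :: "(point \<Rightarrow> real) \<Rightarrow> (point \<Rightarrow> real^2) \<Rightarrow> bool" where
  "reduced_symmetry \<xi> \<phi> \<longleftrightarrow> smooth_on \<xi> (I \<times> UNIV) \<and> smooth_on \<phi> (I \<times> UNIV) \<and>
    (\<forall>u u1. reduced_sol u u1 \<longrightarrow> (\<exists>\<chi>1. reduced_sol (\<lambda>t. \<phi> (t, u t) - \<xi> (t, u t) *\<^sub>R u1 t) \<chi>1))"

text \<open>A solution through (x, u) may have velocity s p with any real s. The equation for the
  characteristic at x is then a cubic polynomial identity in s, and its top two coefficients are the
  claims.\<close>

lemma reduced_symmetry_cubic:
  assumes sym: "reduced_symmetry \<xi> \<phi>" and x: "x \<in> I"
  shows "vert_part \<xi> (x, u) p = 0" and "vert_part \<phi> (x, u) p = mixed_part \<xi> (x, u) p *\<^sub>R p"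
proof -
  have \<xi>: "smooth_on \<xi> (I \<times> UNIV)" and \<phi>: "smooth_on \<phi> (I \<times> UNIV)"
    using sym by (auto simp: reduced_symmetry_def)
  let ?P = "(x, u)"
  have P: "?P \<in> I \<times> UNIV" using x by simp
  \<comment> \<open>\<open>c0\<close> and \<open>c1\<close> gather the terms of degree 0 and 1 in s;
    what counts is that they do not depend on s.\<close>
  define c0 where "c0 = second_deriv \<phi> ?P (1, 0) (1, 0) + vert_deriv \<phi> ?P (- (Q x *v u))
    + \<xi> ?P *\<^sub>R (Q' x *v u) + 2 *\<^sub>R (frechet_derivative \<xi> (at ?P) (1, 0) *\<^sub>R (Q x *v u)) + Q x *v \<phi> ?P"
  define c1 where "c1 = mixed_part \<phi> ?P p + 2 *\<^sub>R (vert_deriv \<xi> ?P p *\<^sub>R (Q x *v u))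
    - (second_deriv \<xi> ?P (1, 0) (1, 0) + vert_deriv \<xi> ?P (- (Q x *v u))) *\<^sub>R p"
  have poly: "c0 + s *\<^sub>R c1 + s\<^sup>2 *\<^sub>R (vert_part \<phi> ?P p - mixed_part \<xi> ?P p *\<^sub>R p)
     + s ^ 3 *\<^sub>R (- (vert_part \<xi> ?P p *\<^sub>R p)) = 0" for s
  proof -
    obtain w w1 where w: "reduced_sol w w1" and w0: "w x = u" "w1 x = s *\<^sub>R p"
      using reduced_sol_exists[OF x] by metis
    note dw = reduced_solD[OF w]
    note gX = second_derivative_graph[OF \<xi>, where I = I, OF dw(1,2)]
    note gF = second_derivative_graph[OF \<phi>, where I = I, OF dw(1,2)]
    obtain \<chi>1 where \<chi>: "reduced_sol (\<lambda>t. \<phi> (t, w t) - \<xi> (t, w t) *\<^sub>R w1 t) \<chi>1"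
      using sym w by (auto simp: reduced_symmetry_def)
    define X1 where "X1 t = frechet_derivative \<xi> (at (t, w t)) (1, 0) + vert_deriv \<xi> (t, w t) (w1 t)" for t
    define F1 where "F1 t = frechet_derivative \<phi> (at (t, w t)) (1, 0) + vert_deriv \<phi> (t, w t) (w1 t)" for t
    define X2 where "X2 = second_deriv \<xi> ?P (1, 0) (1, 0) + mixed_part \<xi> ?P (w1 x)
       + vert_part \<xi> ?P (w1 x) + vert_deriv \<xi> ?P (- (Q x *v u))"
    define F2 where "F2 = second_deriv \<phi> ?P (1, 0) (1, 0) + mixed_part \<phi> ?P (w1 x)
       + vert_part \<phi> ?P (w1 x) + vert_deriv \<phi> ?P (- (Q x *v u))"
    have dX: "((\<lambda>t. \<xi> (t, w t)) has_vector_derivative X1 t) (at t)"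
      and dF: "((\<lambda>t. \<phi> (t, w t)) has_vector_derivative F1 t) (at t)" if "t \<in> I" for t
      unfolding X1_def F1_def using gX(1)[OF _ _ _ that] gF(1)[OF _ _ _ that] that by auto
    have dX1: "(X1 has_vector_derivative X2) (at x)" and dF1: "(F1 has_vector_derivative F2) (at x)"
      unfolding X1_def[abs_def] F1_def[abs_def] X2_def F2_def
      using gX(2)[OF _ _ _ x] gF(2)[OF _ _ _ x] x w0 by auto
    have "F2 - ((\<xi> (x, w x) *\<^sub>R - (Q x *v w1 x + Q' x *v w x) + X1 x *\<^sub>R - (Q x *v w x))
        + (X1 x *\<^sub>R - (Q x *v w x) + X2 *\<^sub>R w1 x))
      = - (Q x *v (\<phi> (x, w x) - \<xi> (x, w x) *\<^sub>R w1 x))"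
    proof (rule second_derivative_unique[OF I(1) x])
      show "((\<lambda>t. \<phi> (t, w t) - \<xi> (t, w t) *\<^sub>R w1 t) has_vector_derivative
          F1 t - (\<xi> (t, w t) *\<^sub>R - (Q t *v w t) + X1 t *\<^sub>R w1 t)) (at t)" if "t \<in> I" for t
        by (intro has_vector_derivative_diff scaleR_deriv dX dF dw that)
      show "((\<lambda>t. F1 t - (\<xi> (t, w t) *\<^sub>R - (Q t *v w t) + X1 t *\<^sub>R w1 t)) has_vector_derivative
        F2 - ((\<xi> (x, w x) *\<^sub>R - (Q x *v w1 x + Q' x *v w x) + X1 x *\<^sub>R - (Q x *v w x))
        + (X1 x *\<^sub>R - (Q x *v w x) + X2 *\<^sub>R w1 x))) (at x)"
        by (intro has_vector_derivative_diff has_vector_derivative_add scaleR_deriv dX dX1 dF1 dw x)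
    qed (use reduced_solD[OF \<chi>] x in auto)
    then show ?thesis
      unfolding w0 X2_def F2_def X1_def mixed_part_scale[OF \<xi> P] mixed_part_scale[OF \<phi> P]
        vert_part_scale[OF \<xi> P] vert_part_scale[OF \<phi> P] c0_def c1_def
        vert_deriv_def[of \<xi> _ "s *\<^sub>R p"] vert_deriv_def[of \<xi> _ p] mv_simps
      by (simp add: vec_eq_iff forall_2 algebra_simps power2_eq_square power3_eq_cube)
  qed
  show V: "vert_part \<xi> (x, u) p = 0"
  proof (cases "p = 0")
    case True
    then show ?thesis using vert_part_scale[OF \<xi> P, of 0 0] by simp
  next
    case False
    then show ?thesis using cubic_coeffs_zero(2)[OF poly] by simp
  qed
  show "vert_part \<phi> (x, u) p = mixed_part \<xi> (x, u) p *\<^sub>R p"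
    using cubic_coeffs_zero(1)[OF poly] by simp
qed

text \<open>The cubic coefficient makes \<xi> affine in u, and the quadratic one then makes \<phi>
  an affine function plus the term with \<alpha>'. Only the even part of \<phi> is recorded, since
  the odd part drops out of the quadratic part of the characteristic.\<close>

lemma reduced_symmetry_normal_form:
  assumes sym: "reduced_symmetry \<xi> \<phi>"
  obtains \<alpha> \<alpha>1 where "smooth_on \<alpha> I" "smooth_on \<alpha>1 I"
    "\<And>x. x \<in> I \<Longrightarrow> (\<alpha> has_vector_derivative \<alpha>1 x) (at x)"
    "\<And>x u. x \<in> I \<Longrightarrow> \<xi> (x, u) = \<xi> (x, 0) + \<alpha> x \<bullet> u"
    "\<And>x u. x \<in> I \<Longrightarrow> \<phi> (x, u) + \<phi> (x, - u) = 2 *\<^sub>R (\<phi> (x, 0) + (\<alpha>1 x \<bullet> u) *\<^sub>R u)"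
proof -
  have \<xi>: "smooth_on \<xi> (I \<times> UNIV)" and \<phi>: "smooth_on \<phi> (I \<times> UNIV)"
    using sym by (auto simp: reduced_symmetry_def)
  define \<beta> where "\<beta> x = \<xi> (x, 0)" for x
  \<comment> \<open>The gradient of \<xi> in u, which will turn out constant on fibres, is taken as
    differences of values, so that it is smooth in x at once.\<close>
  define \<alpha> :: "real \<Rightarrow> real^2" where
    "\<alpha> x = (\<xi> (x, axis 1 1) - \<xi> (x, 0)) *\<^sub>R axis 1 1 + (\<xi> (x, axis 2 1) - \<xi> (x, 0)) *\<^sub>R axis 2 1" for x
  have sl: "smooth_on (\<lambda>x. \<xi> (x, v)) I" for v
    by (rule smooth_on_compose[OF I(1) open_IU \<xi> smooth_on_Pair[OF I(1)
          smooth_on_bounded_linear[OF I(1) bounded_linear_ident] smooth_on_const[OF I(1)]]]) simp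
  have \<alpha>: "smooth_on \<alpha> I" and \<beta>: "smooth_on \<beta> I"
    unfolding \<alpha>_def[abs_def] \<beta>_def[abs_def]
    by (intro smooth_on_add smooth_on_bilinear[OF I(1) bounded_bilinear_scaleR] smooth_on_const
        smooth_on_diff I(1) sl)+
  obtain \<alpha>1 where \<alpha>1: "smooth_on \<alpha>1 I" "\<And>x. x \<in> I \<Longrightarrow> (\<alpha> has_vector_derivative \<alpha>1 x) (at x)"
    using smooth_on_real_deriv[OF \<alpha>] by blast
  obtain \<alpha>2 where \<alpha>2: "\<And>x. x \<in> I \<Longrightarrow> (\<alpha>1 has_vector_derivative \<alpha>2 x) (at x)"
    using smooth_on_real_deriv[OF \<alpha>1(1)] by blast
  obtain \<beta>1 where \<beta>1: "smooth_on \<beta>1 I" "\<And>x. x \<in> I \<Longrightarrow> (\<beta> has_vector_derivative \<beta>1 x) (at x)"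
    using smooth_on_real_deriv[OF \<beta>] by blast
  obtain \<beta>2 where \<beta>2: "\<And>x. x \<in> I \<Longrightarrow> (\<beta>1 has_vector_derivative \<beta>2 x) (at x)"
    using smooth_on_real_deriv[OF \<beta>1(1)] by blast
  have \<xi>_eq: "\<xi> (x, u) = \<beta> x + \<alpha> x \<bullet> u" if x: "x \<in> I" for x u
  proof -
    have lin: "linear (\<lambda>u. \<xi> (x, u) - \<xi> (x, 0))"
    proof (rule affine_of_affine_on_lines)
      fix v p :: "real^2"
      note d = second_derivative_vertical[OF \<xi>, of x v p, unfolded reduced_symmetry_cubic(1)[OF sym x]]
      have "\<xi> (x, v + t *\<^sub>R p) = \<xi> (x, v) + t *\<^sub>R vert_deriv \<xi> (x, v) p" for t
        using affine_on_line[OF d, of t] x by simp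
      then show "\<exists>c. \<forall>t. \<xi> (x, v + t *\<^sub>R p) = \<xi> (x, v) + t *\<^sub>R c" by blast
    qed
    have "\<xi> (x, u) - \<xi> (x, 0) = u $ 1 *\<^sub>R (\<xi> (x, axis 1 1) - \<xi> (x, 0)) + u $ 2 *\<^sub>R (\<xi> (x, axis 2 1) - \<xi> (x, 0))"
      using linear_add[OF lin, of "u $ 1 *\<^sub>R axis 1 1" "u $ 2 *\<^sub>R axis 2 1"]
        linear_scale[OF lin] vec2_expand[of u] by metis
    then show ?thesis
      by (simp add: \<alpha>_def \<beta>_def inner_add_left inner_axis' mult.commute)
  qed
  \<comment> \<open>On straight lines with velocity s p the second derivative of \<xi> is explicit,
    and the terms linear in s are compared. The factor 2 stems from the two cross terms of the
    product rule.\<close>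
  have mixed: "mixed_part \<xi> (x, u) p = 2 * (\<alpha>1 x \<bullet> p)" if x: "x \<in> I" for x u p
  proof -
    have P: "(x, u) \<in> I \<times> UNIV" using x by simp
    have eq: "second_deriv \<xi> (x, u) (1, 0) (1, 0) + s * mixed_part \<xi> (x, u) p
      = \<beta>2 x + (\<alpha>2 x \<bullet> u + s * (2 * (\<alpha>1 x \<bullet> p)))" for s
    proof -
      define w where "w t = u + (t - x) *\<^sub>R (s *\<^sub>R p)" for t
      have w: "(w has_vector_derivative s *\<^sub>R p) (at t)" for t
        unfolding w_def by (auto intro!: derivative_eq_intros)
      have w0: "((\<lambda>t. s *\<^sub>R p) has_vector_derivative 0) (at t)" for t by simp
      note gX = second_derivative_graph[OF \<xi>, where I = I, OF w w0]
      have "second_deriv \<xi> (x, w x) (1, 0) (1, 0) + mixed_part \<xi> (x, w x) (s *\<^sub>R p)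
         + vert_part \<xi> (x, w x) (s *\<^sub>R p) + vert_deriv \<xi> (x, w x) 0
        = \<beta>2 x + ((\<alpha>1 x \<bullet> (s *\<^sub>R p) + \<alpha>2 x \<bullet> w x) + (\<alpha> x \<bullet> 0 + \<alpha>1 x \<bullet> (s *\<^sub>R p)))"
      proof (rule second_derivative_unique[OF I(1) x, symmetric])
        show "((\<lambda>t. \<xi> (t, w t)) has_vector_derivative
           \<beta>1 t + (\<alpha> t \<bullet> (s *\<^sub>R p) + \<alpha>1 t \<bullet> w t)) (at t)" if t: "t \<in> I" for t
        proof (rule has_vector_derivative_cong_open[OF I(1) t])
          show "\<beta> r + \<alpha> r \<bullet> w r = \<xi> (r, w r)" if "r \<in> I" for r using \<xi>_eq[OF that] by simp
          show "((\<lambda>r. \<beta> r + \<alpha> r \<bullet> w r) has_vector_derivative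
             \<beta>1 t + (\<alpha> t \<bullet> (s *\<^sub>R p) + \<alpha>1 t \<bullet> w t)) (at t)"
            by (intro has_vector_derivative_add inner_deriv \<alpha>1 \<beta>1 w t)
        qed
        have "((\<lambda>t. \<beta>1 t + (\<alpha> t \<bullet> (s *\<^sub>R p) + \<alpha>1 t \<bullet> w t)) has_vector_derivative
          \<beta>2 x + ((\<alpha> x \<bullet> 0 + \<alpha>1 x \<bullet> (s *\<^sub>R p)) + (\<alpha>1 x \<bullet> (s *\<^sub>R p) + \<alpha>2 x \<bullet> w x))) (at x)"
          by (intro has_vector_derivative_add inner_deriv \<alpha>1 \<alpha>2 \<beta>2 w w0 x)
        then show "((\<lambda>t. \<beta>1 t + (\<alpha> t \<bullet> (s *\<^sub>R p) + \<alpha>1 t \<bullet> w t)) has_vector_derivative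
          \<beta>2 x + ((\<alpha>1 x \<bullet> (s *\<^sub>R p) + \<alpha>2 x \<bullet> w x) + (\<alpha> x \<bullet> 0 + \<alpha>1 x \<bullet> (s *\<^sub>R p)))) (at x)"
          by (simp add: algebra_simps)
      qed (use gX(1) gX(2)[of x] x in auto)
      then show ?thesis
        using reduced_symmetry_cubic(1)[OF sym x] mixed_part_scale[OF \<xi> P, of s p]
        by (simp add: w_def vert_deriv_def)
    qed
    show ?thesis using eq[of 0] eq[of 1] by simp
  qed
  have \<phi>_eq: "\<phi> (x, u) + \<phi> (x, - u) = 2 *\<^sub>R (\<phi> (x, 0) + (\<alpha>1 x \<bullet> u) *\<^sub>R u)" if x: "x \<in> I" for x u
  proof -
    \<comment> \<open>\<phi> and the subtracted term have the same second derivative 2 (\<alpha>'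
      \<bullet> p) p along vertical lines, so \<psi> is affine; adding its values at u and - u
      removes the linear part.\<close>
    define \<psi> where "\<psi> u = \<phi> (x, u) - (\<alpha>1 x \<bullet> u) *\<^sub>R u" for u
    have "linear (\<lambda>u. \<psi> u - \<psi> 0)"
    proof (rule affine_of_affine_on_lines)
      fix v p :: "real^2"
      define l where "l t = v + t *\<^sub>R p" for t
      have l: "(l has_vector_derivative p) (at t)" for t
        unfolding l_def by (auto intro!: derivative_eq_intros)
      have cst: "((\<lambda>t. p) has_vector_derivative 0) (at t)" "((\<lambda>t. \<alpha>1 x) has_vector_derivative 0) (at t)"
        for t :: real by simp_all
      note d = second_derivative_vertical[OF \<phi>, of x v p, folded l_def]
      define k1 where "k1 t = vert_deriv \<phi> (x, l t) p
         - ((\<alpha>1 x \<bullet> l t) *\<^sub>R p + (\<alpha>1 x \<bullet> p) *\<^sub>R l t)" for t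
      have "\<psi> (l t) = \<psi> (l 0) + t *\<^sub>R k1 0" for t
      proof (rule affine_on_line)
        fix t
        have "((\<lambda>t. \<psi> (l t)) has_vector_derivative vert_deriv \<phi> (x, l t) p
         - ((\<alpha>1 x \<bullet> l t) *\<^sub>R p + (\<alpha>1 x \<bullet> p + 0 \<bullet> l t) *\<^sub>R l t)) (at t)"
          unfolding \<psi>_def using d(1) x
          by (intro has_vector_derivative_diff scaleR_deriv inner_deriv l cst) auto
        then show "((\<lambda>t. \<psi> (l t)) has_vector_derivative k1 t) (at t)" by (simp add: k1_def)
        have "(k1 has_vector_derivative vert_part \<phi> (x, l t) p
         - (((\<alpha>1 x \<bullet> l t) *\<^sub>R 0 + (\<alpha>1 x \<bullet> p + 0 \<bullet> l t) *\<^sub>R p) + (\<alpha>1 x \<bullet> p) *\<^sub>R p)) (at t)"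
          unfolding k1_def[abs_def] using d(2) x
          by (intro has_vector_derivative_diff has_vector_derivative_add scaleR_deriv inner_deriv l cst
              bounded_linear.has_vector_derivative[OF bounded_linear_scaleR_right]) auto
        then show "(k1 has_vector_derivative 0) (at t)"
          by (simp add: reduced_symmetry_cubic(2)[OF sym x] mixed[OF x] flip: scaleR_left_distrib)
      qed
      then have "\<psi> (v + t *\<^sub>R p) = \<psi> v + t *\<^sub>R k1 0" for t by (simp add: l_def)
      then show "\<exists>c. \<forall>t. \<psi> (v + t *\<^sub>R p) = \<psi> v + t *\<^sub>R c" by blast
    qed
    from linear_neg[OF this, of u] show ?thesis
      by (simp add: \<psi>_def vec_eq_iff forall_2 algebra_simps)
  qed
  show ?thesis
  proof (rule that[OF \<alpha> \<alpha>1])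
    show "\<xi> (x, u) = \<xi> (x, 0) + \<alpha> x \<bullet> u" if "x \<in> I" for x u
      using \<xi>_eq[OF that, of u] unfolding \<beta>_def .
  qed (assumption, rule \<phi>_eq)
qed

end

lemma has_vector_derivative_tendsto:
  assumes "(f has_vector_derivative v) (at x)"
  shows "((\<lambda>t. (f t - f x) /\<^sub>R (t - x)) \<longlongrightarrow> v) (at x)"
proof -
  have "((\<lambda>t. norm (f t - f x - (t - x) *\<^sub>R v) / norm (t - x)) \<longlongrightarrow> 0) (at x)"
    using assms unfolding has_vector_derivative_def has_derivative_iff_norm by blast
  moreover have "\<forall>\<^sub>F t in at x. norm (f t - f x - (t - x) *\<^sub>R v) / norm (t - x)
      = norm ((f t - f x) /\<^sub>R (t - x) - v)"
  proof (rule eventually_at_filter[THEN iffD2], rule always_eventually, intro allI impI)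
    fix t assume "t \<noteq> x"
    then have "(f t - f x) /\<^sub>R (t - x) - v = (f t - f x - (t - x) *\<^sub>R v) /\<^sub>R (t - x)"
      by (simp add: scaleR_diff_right)
    then show "norm (f t - f x - (t - x) *\<^sub>R v) / norm (t - x) = norm ((f t - f x) /\<^sub>R (t - x) - v)"
      by (simp add: divide_inverse mult.commute)
  qed
  ultimately have "((\<lambda>t. norm ((f t - f x) /\<^sub>R (t - x) - v)) \<longlongrightarrow> 0) (at x)"
    by (rule Lim_transform_eventually)
  then show ?thesis
    by (simp add: tendsto_norm_zero_iff LIM_zero_cancel)
qed

section \<open>The quadratic part of a symmetry\<close>

context gauged_system
begin

lemma reduced_sol_add:
  assumes "reduced_sol u u1" "reduced_sol v v1"
  shows "reduced_sol (\<lambda>t. u t + v t) (\<lambda>t. u1 t + v1 t)"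
  unfolding reduced_sol_def
proof (intro ballI conjI)
  fix t assume t: "t \<in> I"
  show "((\<lambda>t. u t + v t) has_vector_derivative u1 t + v1 t) (at t)"
    by (intro has_vector_derivative_add reduced_solD(1)[OF assms(1) t] reduced_solD(1)[OF assms(2) t])
  show "((\<lambda>t. u1 t + v1 t) has_vector_derivative - (Q t *v (u t + v t))) (at t)"
    using has_vector_derivative_add[OF reduced_solD(2)[OF assms(1) t] reduced_solD(2)[OF assms(2) t]]
    by (simp add: mv_simps)
qed

lemma reduced_sol_scaleR:
  assumes "reduced_sol u u1"
  shows "reduced_sol (\<lambda>t. c *\<^sub>R u t) (\<lambda>t. c *\<^sub>R u1 t)"
  unfolding reduced_sol_def
proof (intro ballI conjI)
  fix t assume t: "t \<in> I"
  note sc = bounded_linear.has_vector_derivative[OF bounded_linear_scaleR_right[of c]]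
  show "((\<lambda>t. c *\<^sub>R u t) has_vector_derivative c *\<^sub>R u1 t) (at t)"
    by (intro sc reduced_solD[OF assms t])
  show "((\<lambda>t. c *\<^sub>R u1 t) has_vector_derivative - (Q t *v (c *\<^sub>R u t))) (at t)"
    using sc[OF reduced_solD(2)[OF assms t]] by (simp add: mv_simps)
qed

lemma reduced_sol_cong:
  assumes "reduced_sol u u1" "\<And>t. t \<in> I \<Longrightarrow> v t = u t"
  shows "reduced_sol v u1"
  unfolding reduced_sol_def
proof (intro ballI conjI)
  fix t assume t: "t \<in> I"
  show "(v has_vector_derivative u1 t) (at t)"
    by (rule has_vector_derivative_cong_open[OF I(1) t assms(2)[symmetric] reduced_solD(1)[OF assms(1) t]])
  show "(u1 has_vector_derivative - (Q t *v v t)) (at t)"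
    using reduced_solD(2)[OF assms(1) t] assms(2)[OF t] by simp
qed

text \<open>The mean of the characteristics along u and - u, minus the one along 0, solves the
  reduced equation by linearity, and the normal form evaluates it to (\<alpha>' \<bullet> u) u -
  (\<alpha> \<bullet> u) u'. The identity is the part of its differential equation at x that is
  linear in the velocity p.\<close>

lemma quadratic_identity_of_symmetry:
  assumes sym: "reduced_symmetry \<xi> \<phi>"
    and \<alpha>: "\<And>x. x \<in> I \<Longrightarrow> (\<alpha> has_vector_derivative \<alpha>1 x) (at x)"
    and \<xi>_eq: "\<And>x u. x \<in> I \<Longrightarrow> \<xi> (x, u) = \<xi> (x, 0) + \<alpha> x \<bullet> u"
    and \<phi>_eq: "\<And>x u. x \<in> I \<Longrightarrow> \<phi> (x, u) + \<phi> (x, - u) = 2 *\<^sub>R (\<phi> (x, 0) + (\<alpha>1 x \<bullet> u) *\<^sub>R u)"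
    and \<alpha>1: "\<And>x. x \<in> I \<Longrightarrow> (\<alpha>1 has_vector_derivative \<alpha>2 x) (at x)"
    and \<alpha>2: "\<And>x. x \<in> I \<Longrightarrow> (\<alpha>2 has_vector_derivative \<alpha>3 x) (at x)"
    and x: "x \<in> I"
  shows "2 *\<^sub>R ((\<alpha>2 x \<bullet> p) *\<^sub>R v) + (\<alpha>2 x \<bullet> v + \<alpha> x \<bullet> (Q x *v v)) *\<^sub>R p
     + 2 *\<^sub>R ((\<alpha> x \<bullet> p) *\<^sub>R (Q x *v v)) = 0"
proof -
  \<comment> \<open>The residual \<eta>'' + Q \<eta> at x of that quadratic expression \<eta>, for u
    = v and u' = p. The terms quadratic in p cancel, so \<open>E p - E 0\<close> is the linear
    part.\<close>
  define E where "E p = (\<alpha>3 x \<bullet> v) *\<^sub>R v + 2 *\<^sub>R ((\<alpha>2 x \<bullet> p) *\<^sub>R v)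
     + (\<alpha>2 x \<bullet> v) *\<^sub>R p - (\<alpha>1 x \<bullet> (Q x *v v)) *\<^sub>R v + (\<alpha> x \<bullet> (Q x *v v)) *\<^sub>R p
     + 2 *\<^sub>R ((\<alpha> x \<bullet> p) *\<^sub>R (Q x *v v)) + 2 *\<^sub>R ((\<alpha>1 x \<bullet> v) *\<^sub>R (Q x *v v))
     + (\<alpha> x \<bullet> v) *\<^sub>R (Q' x *v v)" for p :: "real^2"
  have E0: "E p = 0" for p
  proof -
    obtain u u1 where u: "reduced_sol u u1" and u0: "u x = v" "u1 x = p"
      using reduced_sol_exists[OF x] by metis
    note du = reduced_solD[OF u]
    have flow: "\<exists>\<chi>1. reduced_sol (\<lambda>t. \<phi> (t, c *\<^sub>R u t) - \<xi> (t, c *\<^sub>R u t) *\<^sub>R (c *\<^sub>R u1 t)) \<chi>1" for c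
      using sym reduced_sol_scaleR[OF u, of c] unfolding reduced_symmetry_def by blast
    obtain a where a: "reduced_sol (\<lambda>t. \<phi> (t, 1 *\<^sub>R u t) - \<xi> (t, 1 *\<^sub>R u t) *\<^sub>R (1 *\<^sub>R u1 t)) a"
      using flow[of "1"] by (rule exE)
    obtain b where b: "reduced_sol (\<lambda>t. \<phi> (t, (-1) *\<^sub>R u t) - \<xi> (t, (-1) *\<^sub>R u t) *\<^sub>R ((-1) *\<^sub>R u1 t)) b"
      using flow[of "(-1)"] by (rule exE)
    obtain c where c: "reduced_sol (\<lambda>t. \<phi> (t, 0 *\<^sub>R u t) - \<xi> (t, 0 *\<^sub>R u t) *\<^sub>R (0 *\<^sub>R u1 t)) c"
      using flow[of "0"] by (rule exE)
    define \<chi>1 where "\<chi>1 t = (1/2) *\<^sub>R (a t + b t) + (-1) *\<^sub>R c t" for t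
    have \<eta>: "reduced_sol (\<lambda>t. (\<alpha>1 t \<bullet> u t) *\<^sub>R u t - (\<alpha> t \<bullet> u t) *\<^sub>R u1 t) \<chi>1"
      unfolding \<chi>1_def
    proof (rule reduced_sol_cong[OF reduced_sol_add[OF reduced_sol_scaleR[OF reduced_sol_add[OF a b]]
            reduced_sol_scaleR[OF c]]])
      fix t assume t: "t \<in> I"
      have ph: "\<phi> (t, - u t) = 2 *\<^sub>R (\<phi> (t, 0) + (\<alpha>1 t \<bullet> u t) *\<^sub>R u t) - \<phi> (t, u t)"
        using \<phi>_eq[OF t, of "u t"] by (simp add: algebra_simps)
      have xi: "\<xi> (t, - u t) = \<xi> (t, 0) - \<alpha> t \<bullet> u t" "\<xi> (t, u t) = \<xi> (t, 0) + \<alpha> t \<bullet> u t"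
        using \<xi>_eq[OF t, of "- u t"] \<xi>_eq[OF t, of "u t"] by simp_all
      show "(\<alpha>1 t \<bullet> u t) *\<^sub>R u t - (\<alpha> t \<bullet> u t) *\<^sub>R u1 t =
        (1 / 2) *\<^sub>R (\<phi> (t, 1 *\<^sub>R u t) - \<xi> (t, 1 *\<^sub>R u t) *\<^sub>R 1 *\<^sub>R u1 t +
           (\<phi> (t, - 1 *\<^sub>R u t) - \<xi> (t, - 1 *\<^sub>R u t) *\<^sub>R - 1 *\<^sub>R u1 t)) +
        (-1) *\<^sub>R (\<phi> (t, 0 *\<^sub>R u t) - \<xi> (t, 0 *\<^sub>R u t) *\<^sub>R 0 *\<^sub>R u1 t)"
        by (simp add: ph xi vec_eq_iff forall_2 field_simps)
    qed
    define d1 where "d1 t = ((\<alpha>1 t \<bullet> u t) *\<^sub>R u1 t + (\<alpha>1 t \<bullet> u1 t + \<alpha>2 t \<bullet> u t) *\<^sub>R u t)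
       - ((\<alpha> t \<bullet> u t) *\<^sub>R - (Q t *v u t) + (\<alpha> t \<bullet> u1 t + \<alpha>1 t \<bullet> u t) *\<^sub>R u1 t)" for t
    let ?q = "- (Q x *v u x)" and ?q' = "- (Q x *v u1 x + Q' x *v u x)"
    have "(((\<alpha>1 x \<bullet> u x) *\<^sub>R ?q + (\<alpha>1 x \<bullet> u1 x + \<alpha>2 x \<bullet> u x) *\<^sub>R u1 x)
        + ((\<alpha>1 x \<bullet> u1 x + \<alpha>2 x \<bullet> u x) *\<^sub>R u1 x
           + ((\<alpha>1 x \<bullet> ?q + \<alpha>2 x \<bullet> u1 x) + (\<alpha>2 x \<bullet> u1 x + \<alpha>3 x \<bullet> u x)) *\<^sub>R u x))
      - (((\<alpha> x \<bullet> u x) *\<^sub>R ?q' + (\<alpha> x \<bullet> u1 x + \<alpha>1 x \<bullet> u x) *\<^sub>R ?q)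
        + ((\<alpha> x \<bullet> u1 x + \<alpha>1 x \<bullet> u x) *\<^sub>R ?q
           + ((\<alpha> x \<bullet> ?q + \<alpha>1 x \<bullet> u1 x) + (\<alpha>1 x \<bullet> u1 x + \<alpha>2 x \<bullet> u x)) *\<^sub>R u1 x))
      = - (Q x *v ((\<alpha>1 x \<bullet> u x) *\<^sub>R u x - (\<alpha> x \<bullet> u x) *\<^sub>R u1 x))"
    proof (rule second_derivative_unique[OF I(1) x _ _ reduced_solD(1)[OF \<eta>] reduced_solD(2)[OF \<eta> x]])
      show "((\<lambda>t. (\<alpha>1 t \<bullet> u t) *\<^sub>R u t - (\<alpha> t \<bullet> u t) *\<^sub>R u1 t) has_vector_derivative d1 t) (at t)"
        if "t \<in> I" for t
        unfolding d1_def by (intro has_vector_derivative_diff scaleR_deriv inner_deriv \<alpha> \<alpha>1 du that)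
      show "(d1 has_vector_derivative
        (((\<alpha>1 x \<bullet> u x) *\<^sub>R ?q + (\<alpha>1 x \<bullet> u1 x + \<alpha>2 x \<bullet> u x) *\<^sub>R u1 x)
        + ((\<alpha>1 x \<bullet> u1 x + \<alpha>2 x \<bullet> u x) *\<^sub>R u1 x
           + ((\<alpha>1 x \<bullet> ?q + \<alpha>2 x \<bullet> u1 x) + (\<alpha>2 x \<bullet> u1 x + \<alpha>3 x \<bullet> u x)) *\<^sub>R u x))
      - (((\<alpha> x \<bullet> u x) *\<^sub>R ?q' + (\<alpha> x \<bullet> u1 x + \<alpha>1 x \<bullet> u x) *\<^sub>R ?q)
        + ((\<alpha> x \<bullet> u1 x + \<alpha>1 x \<bullet> u x) *\<^sub>R ?q
           + ((\<alpha> x \<bullet> ?q + \<alpha>1 x \<bullet> u1 x) + (\<alpha>1 x \<bullet> u1 x + \<alpha>2 x \<bullet> u x)) *\<^sub>R u1 x))) (at x)"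
        unfolding d1_def[abs_def]
        by (intro has_vector_derivative_diff has_vector_derivative_add scaleR_deriv inner_deriv \<alpha> \<alpha>1 \<alpha>2 du x)
    qed
    then show ?thesis
      unfolding E_def u0
      by (simp add: mv_simps vec_eq_iff forall_2 algebra_simps inner_add_right inner_diff_right)
  qed
  have "E p - E 0 = 2 *\<^sub>R ((\<alpha>2 x \<bullet> p) *\<^sub>R v) + (\<alpha>2 x \<bullet> v + \<alpha> x \<bullet> (Q x *v v)) *\<^sub>R p
     + 2 *\<^sub>R ((\<alpha> x \<bullet> p) *\<^sub>R (Q x *v v))"
    unfolding E_def by (simp add: algebra_simps)
  then show ?thesis by (simp add: E0)
qed

lemma quadratic_identity_consequences:
  fixes M :: "real^2^2" and a c :: "real^2"
  assumes id: "\<And>p v. 2 *\<^sub>R ((c \<bullet> p) *\<^sub>R v) + (c \<bullet> v + a \<bullet> (M *v v)) *\<^sub>R p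
     + 2 *\<^sub>R ((a \<bullet> p) *\<^sub>R (M *v v)) = 0"
  shows "c \<bullet> v = - (a \<bullet> (M *v v))" and "a \<noteq> 0 \<Longrightarrow> wedge (M *v v) v = 0"
proof -
  show trace: "c \<bullet> v = - (a \<bullet> (M *v v))" for v
  proof -
    \<comment> \<open>A trace over p: the i-th component for p = \<open>axis i 1\<close>, summed
      over i, is four times c \<bullet> v + a \<bullet> M v.\<close>
    have "(2 *\<^sub>R ((c \<bullet> axis i 1) *\<^sub>R v) + (c \<bullet> v + a \<bullet> (M *v v)) *\<^sub>R axis i 1
     + 2 *\<^sub>R ((a \<bullet> axis i 1) *\<^sub>R (M *v v))) $ i = 0" for i
      unfolding id by simp
    from this[of 1] this[of 2] show ?thesis
      by (simp add: inner_axis inner_vec_def[of c v] inner_vec_def[of a] sum_2)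
  qed
  assume a: "a \<noteq> 0"
  \<comment> \<open>With p = a the wedge with v removes the first term, the trace identity removes
    the second, and the third keeps the factor a \<bullet> a.\<close>
  have "wedge (2 *\<^sub>R ((c \<bullet> a) *\<^sub>R v) + (c \<bullet> v + a \<bullet> (M *v v)) *\<^sub>R a
     + 2 *\<^sub>R ((a \<bullet> a) *\<^sub>R (M *v v))) v = 0"
    unfolding id by (simp add: wedge_def)
  then have "2 * (a \<bullet> a) * wedge (M *v v) v = 0"
    unfolding trace by (simp add: wedge_def algebra_simps)
  then show "wedge (M *v v) v = 0" using a by simp
qed

text \<open>The Wronskian of \<open>\<alpha>\<close> with solutions is constant, so \<open>\<alpha>\<close> and its derivative do not vanish together.\<close>

lemma adjoint_nonvanishing:
  assumes \<alpha>: "\<And>x. x \<in> I \<Longrightarrow> (\<alpha> has_vector_derivative \<alpha>1 x) (at x)"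
    and \<alpha>1: "\<And>x. x \<in> I \<Longrightarrow> (\<alpha>1 has_vector_derivative \<alpha>2 x) (at x)"
    and adj: "\<And>x v. x \<in> I \<Longrightarrow> \<alpha>2 x \<bullet> v = - (\<alpha> x \<bullet> (Q x *v v))"
    and xs: "xs \<in> I" "\<alpha> xs \<noteq> 0" and x: "x \<in> I" "\<alpha> x = 0"
  shows "\<alpha>1 x \<noteq> 0"
proof
  assume 0: "\<alpha>1 x = 0"
  \<comment> \<open>With these initial values the Wronskian is
    \<open>\<alpha> xs \<bullet> \<alpha> xs\<close> at xs, while it would be 0 at x.\<close>
  obtain u u1 where u: "reduced_sol u u1" "u xs = 0" "u1 xs = \<alpha> xs"
    using reduced_sol_exists[OF xs(1)] by metis
  have "((\<lambda>t. \<alpha> t \<bullet> u1 t - \<alpha>1 t \<bullet> u t) has_vector_derivative 0) (at t)" if t: "t \<in> I" for t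
  proof -
    have "((\<lambda>t. \<alpha> t \<bullet> u1 t - \<alpha>1 t \<bullet> u t) has_vector_derivative
      (\<alpha> t \<bullet> (- (Q t *v u t)) + \<alpha>1 t \<bullet> u1 t) - (\<alpha>1 t \<bullet> u1 t + \<alpha>2 t \<bullet> u t)) (at t)"
      by (intro has_vector_derivative_diff inner_deriv \<alpha> \<alpha>1 reduced_solD[OF u(1)] t)
    then show ?thesis by (simp add: adj[OF t])
  qed
  from const_of_vector_derivative_zero[OF I(2) this xs(1) x(1)] show False
    using xs(2) x(2) 0 u(2,3) by simp
qed

lemma wedge_Q_continuous: "continuous_on I (\<lambda>x. wedge (Q x *v v) v)"
  by (intro bounded_bilinear.continuous_on[OF bounded_bilinear_wedge]
      bounded_bilinear.continuous_on[OF bounded_bilinear_matrix_vector_mult]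
      smooth_on_continuous_on[OF smooth_Q] continuous_on_const)

lemma scalar_of_reduced_symmetry:
  assumes sym: "reduced_symmetry \<xi> \<phi>"
    and xs: "xs \<in> I" and nonconst: "\<xi> (xs, v) \<noteq> \<xi> (xs, w)" and x: "x \<in> I"
  shows "wedge (Q x *v z) z = 0"
proof -
  obtain \<alpha> \<alpha>1 where sm: "smooth_on \<alpha> I" "smooth_on \<alpha>1 I"
    and \<alpha>: "\<And>x. x \<in> I \<Longrightarrow> (\<alpha> has_vector_derivative \<alpha>1 x) (at x)"
    and \<xi>_eq: "\<And>x u. x \<in> I \<Longrightarrow> \<xi> (x, u) = \<xi> (x, 0) + \<alpha> x \<bullet> u"
    and \<phi>_eq: "\<And>x u. x \<in> I \<Longrightarrow> \<phi> (x, u) + \<phi> (x, - u) = 2 *\<^sub>R (\<phi> (x, 0) + (\<alpha>1 x \<bullet> u) *\<^sub>R u)"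
    using reduced_symmetry_normal_form[OF sym] by blast
  obtain \<alpha>2 where sm2: "smooth_on \<alpha>2 I" and \<alpha>1: "\<And>x. x \<in> I \<Longrightarrow> (\<alpha>1 has_vector_derivative \<alpha>2 x) (at x)"
    using smooth_on_real_deriv[OF sm(2)] by blast
  obtain \<alpha>3 where \<alpha>2: "\<And>x. x \<in> I \<Longrightarrow> (\<alpha>2 has_vector_derivative \<alpha>3 x) (at x)"
    using smooth_on_real_deriv[OF sm2] by blast
  have "\<alpha> xs \<noteq> 0"
    using nonconst \<xi>_eq[OF xs, of v] \<xi>_eq[OF xs, of w] by auto
  have id: "2 *\<^sub>R ((\<alpha>2 x \<bullet> p) *\<^sub>R v) + (\<alpha>2 x \<bullet> v + \<alpha> x \<bullet> (Q x *v v)) *\<^sub>R p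
     + 2 *\<^sub>R ((\<alpha> x \<bullet> p) *\<^sub>R (Q x *v v)) = 0" if "x \<in> I" for x v p
    by (rule quadratic_identity_of_symmetry[OF sym \<alpha> \<xi>_eq \<phi>_eq \<alpha>1 \<alpha>2 that])
  note adj = quadratic_identity_consequences(1)[OF id] and scal = quadratic_identity_consequences(2)[OF id]
  show ?thesis
  proof (cases "\<alpha> x = 0")
    case False
    then show ?thesis using scal[OF x] by blast
  next
    case True
    \<comment> \<open>A simple zero: \<alpha> is nonzero at all nearby points other than x, where
      the relation already holds, and continuity of Q carries it to x.\<close>
    have "\<alpha>1 x \<noteq> 0"
      by (rule adjoint_nonvanishing[OF \<alpha> \<alpha>1 adj xs \<open>\<alpha> xs \<noteq> 0\<close> x True])
    have "\<forall>\<^sub>F t in at x. t \<in> I \<and> t \<noteq> x"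
      using I(1) x by (simp add: eventually_at_topological) blast
    moreover have "\<forall>\<^sub>F t in at x. \<alpha> t \<noteq> 0"
    proof -
      have "((\<lambda>t. (\<alpha> t - \<alpha> x) /\<^sub>R (t - x)) \<longlongrightarrow> \<alpha>1 x) (at x)"
        by (rule has_vector_derivative_tendsto[OF \<alpha>[OF x]])
      from tendsto_imp_eventually_ne[OF this \<open>\<alpha>1 x \<noteq> 0\<close>] show ?thesis
        by (rule eventually_mono) (auto simp: True)
    qed
    ultimately have "\<forall>\<^sub>F t in at x. wedge (Q t *v z) z = 0"
      by eventually_elim (use scal in blast)
    moreover have "((\<lambda>t. wedge (Q t *v z) z) \<longlongrightarrow> wedge (Q x *v z) z) (at x)"
      using wedge_Q_continuous[of z] x I(1) continuous_on_eq_continuous_at isCont_def by blast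
    ultimately have "((\<lambda>t. 0::real) \<longlongrightarrow> wedge (Q x *v z) z) (at x)"
      by (rule Lim_transform_eventually[rotated])
    then show ?thesis by (simp add: tendsto_const_iff)
  qed
qed

text \<open>In the coordinates \<open>(x, u)\<close> with \<open>y = p + T u\<close> the characteristic is multiplied by \<open>S\<close>.\<close>

lemma reduced_symmetry_of_lie_symmetry:
  assumes sym: "lie_symmetry I \<Delta> \<xi> \<phi>" and p: "solves p p1" "smooth_on p I" "smooth_on p1 I"
  shows "reduced_symmetry (\<lambda>(x, u). \<xi> (x, p x + T x *v u))
    (\<lambda>(x, u). S x *v (\<phi> (x, p x + T x *v u)
       - \<xi> (x, p x + T x *v u) *\<^sub>R (p1 x - (1 / 2) *\<^sub>R (A1 x *v (T x *v u)))))"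
  unfolding reduced_symmetry_def
proof (intro conjI allI impI)
  have \<xi>: "smooth_on \<xi> (I \<times> UNIV)" and \<phi>: "smooth_on \<phi> (I \<times> UNIV)"
    using sym by (auto simp: lie_symmetry_def)
  note base = smooth_on_of_fst[OF I(1)]
  note mvI = smooth_on_bilinear[OF open_IU bounded_bilinear_matrix_vector_mult]
    and scI = smooth_on_bilinear[OF open_IU bounded_bilinear_scaleR]
    and sndI = smooth_on_bounded_linear[OF open_IU bounded_linear_snd]
    and fstI = smooth_on_bounded_linear[OF open_IU bounded_linear_fst]
  have Y: "smooth_on (\<lambda>P. (fst P, p (fst P) + T (fst P) *v snd P)) (I \<times> UNIV)"
    by (intro smooth_on_Pair[OF open_IU] smooth_on_add[OF open_IU] mvI sndI fstI base T p)
  have comp: "smooth_on (\<lambda>P. f (fst P, p (fst P) + T (fst P) *v snd P)) (I \<times> UNIV)"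
    if "smooth_on f (I \<times> UNIV)" for f :: "point \<Rightarrow> 'a::real_normed_vector"
    by (rule smooth_on_compose[OF open_IU open_IU that Y]) auto
  show "smooth_on (\<lambda>(x, u). \<xi> (x, p x + T x *v u)) (I \<times> UNIV)"
    using comp[OF \<xi>] by (simp add: case_prod_unfold)
  have "smooth_on (\<lambda>P. S (fst P) *v (\<phi> (fst P, p (fst P) + T (fst P) *v snd P)
       - \<xi> (fst P, p (fst P) + T (fst P) *v snd P) *\<^sub>R (p1 (fst P)
         - (1 / 2) *\<^sub>R (A1 (fst P) *v (T (fst P) *v snd P))))) (I \<times> UNIV)"
    by (intro mvI scI smooth_on_diff[OF open_IU] comp[OF \<xi>] comp[OF \<phi>] base[OF S] base[OF T] base[OF A1]
        base[OF p(3)] sndI smooth_on_const[OF open_IU])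
  then show "smooth_on (\<lambda>(x, u). S x *v (\<phi> (x, p x + T x *v u)
       - \<xi> (x, p x + T x *v u) *\<^sub>R (p1 x - (1 / 2) *\<^sub>R (A1 x *v (T x *v u))))) (I \<times> UNIV)"
    by (simp add: case_prod_unfold)
  fix u u1 assume u: "reduced_sol u u1"
  define y where "y t = p t + T t *v u t" for t
  define y1 where "y1 t = p1 t + T_lift u u1 t" for t
  have "solves y y1"
    unfolding y_def[abs_def] y1_def[abs_def] by (rule solves_of_reduced_sol[OF p(1) u])
  then obtain \<chi>1 where \<eta>: "\<And>t. t \<in> I \<Longrightarrow> ((\<lambda>s. \<phi> (s, y s) - \<xi> (s, y s) *\<^sub>R y1 s) has_vector_derivative \<chi>1 t) (at t)"
    "\<And>t. t \<in> I \<Longrightarrow> (\<chi>1 has_vector_derivative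
        - (A1 t *v \<chi>1 t) - A0 t *v (\<phi> (t, y t) - \<xi> (t, y t) *\<^sub>R y1 t)) (at t)"
    using lie_symmetryD[OF sym] by blast
  define \<eta> where "\<eta> s = \<phi> (s, y s) - \<xi> (s, y s) *\<^sub>R y1 s" for s
  have R: "reduced_sol (\<lambda>t. S t *v \<eta> t) (S_lift \<eta> \<chi>1)"
    unfolding reduced_sol_def
  proof (intro ballI conjI)
    fix t assume t: "t \<in> I"
    show "((\<lambda>t. S t *v \<eta> t) has_vector_derivative S_lift \<eta> \<chi>1 t) (at t)"
      using deriv_S_vec[OF t] \<eta>(1)[OF t] unfolding \<eta>_def[abs_def] by blast
    have "(S_lift \<eta> \<chi>1 has_vector_derivative S t *v ((- (A1 t *v \<chi>1 t) - A0 t *v \<eta> t) + A1 t *v \<chi>1 t + A0 t *v \<eta> t)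
        - Q t *v (S t *v \<eta> t)) (at t)"
      using deriv_S_lift[OF t, of \<eta> \<chi>1] \<eta>[OF t] unfolding \<eta>_def[abs_def] by blast
    then show "(S_lift \<eta> \<chi>1 has_vector_derivative - (Q t *v (S t *v \<eta> t))) (at t)"
      by (simp add: mv.zero_right)
  qed
  show "\<exists>\<chi>1. reduced_sol (\<lambda>t. (case (t, u t) of (x, u) \<Rightarrow> S x *v (\<phi> (x, p x + T x *v u)
       - \<xi> (x, p x + T x *v u) *\<^sub>R (p1 x - (1 / 2) *\<^sub>R (A1 x *v (T x *v u)))))
       - (case (t, u t) of (x, u) \<Rightarrow> \<xi> (x, p x + T x *v u)) *\<^sub>R u1 t) \<chi>1"
  proof (rule exI, rule reduced_sol_cong[OF R])
    fix t assume t: "t \<in> I"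
    \<comment> \<open>The bracket depends on (t, u t) only and has been absorbed into the new
      \<phi>. The rest of the velocity, \<open>T t *v u1 t\<close>, becomes \<open>u1 t\<close>
      under S.\<close>
    have "y1 t = (p1 t - (1 / 2) *\<^sub>R (A1 t *v (T t *v u t))) + T t *v u1 t"
      by (simp add: y1_def T_lift_def)
    then show "(case (t, u t) of (x, u) \<Rightarrow> S x *v (\<phi> (x, p x + T x *v u)
       - \<xi> (x, p x + T x *v u) *\<^sub>R (p1 x - (1 / 2) *\<^sub>R (A1 x *v (T x *v u)))))
       - (case (t, u t) of (x, u) \<Rightarrow> \<xi> (x, p x + T x *v u)) *\<^sub>R u1 t = S t *v \<eta> t"
      unfolding \<eta>_def by (simp add: y_def mv_simps scaleR_add_right S_T_vec[OF t])
  qed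
qed

lemma scalar_of_non_Cartan:
  assumes sym: "lie_symmetry I \<Delta> \<xi> \<phi>" and nC: "non_Cartan I \<xi>" and x: "x \<in> I"
  shows "wedge (Q x *v z) z = 0"
proof -
  obtain j xs y where xs: "xs \<in> I" and ne: "frechet_derivative \<xi> (at (xs, y)) (0, axis j 1) \<noteq> 0"
    using nC by (auto simp: non_Cartan_def)
  have \<xi>: "smooth_on \<xi> (I \<times> UNIV)" using sym by (auto simp: lie_symmetry_def)
  obtain p p1 where p: "smooth_on p I" "smooth_on p1 I" "solves p p1"
    using smooth_solution_exists[OF xs] by metis
  have "\<exists>v w. \<xi> (xs, p xs + T xs *v v) \<noteq> \<xi> (xs, p xs + T xs *v w)"
  proof (rule ccontr)
    assume "\<not> ?thesis"
    then have "\<xi> (xs, p xs + T xs *v (S xs *v (v - p xs))) = \<xi> (xs, p xs + T xs *v (S xs *v (w - p xs)))" for v w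
      by blast
    then have const: "\<xi> (xs, v) = \<xi> (xs, w)" for v w
      by (simp add: T_S_vec[OF xs])
    have "((\<lambda>t. (xs, y + t *\<^sub>R axis j 1)) has_vector_derivative (0, axis j 1)) (at 0)"
      by (intro has_vector_derivative_Pair) (auto intro!: derivative_eq_intros)
    from has_vector_derivative_curve[OF \<xi> this] xs
    have "((\<lambda>t. \<xi> (xs, y + t *\<^sub>R axis j 1)) has_vector_derivative
        frechet_derivative \<xi> (at (xs, y)) (0, axis j 1)) (at 0)" by simp
    moreover have "((\<lambda>t. \<xi> (xs, y + t *\<^sub>R axis j 1)) has_vector_derivative 0) (at 0)"
    proof -
      have "(\<lambda>t. \<xi> (xs, y + t *\<^sub>R axis j 1)) = (\<lambda>t. \<xi> (xs, 0))"
        by (rule ext) (rule const)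
      then show ?thesis by simp
    qed
    ultimately show False
      using ne vector_derivative_unique_at by blast
  qed
  then obtain v w where "\<xi> (xs, p xs + T xs *v v) \<noteq> \<xi> (xs, p xs + T xs *v w)" by blast
  then show ?thesis
    by (intro scalar_of_reduced_symmetry[OF reduced_symmetry_of_lie_symmetry[OF sym p(3,1,2)] xs _ x, of v w]) simp
qed

end

section \<open>Reducible systems\<close>

text \<open>Cramer's rule in the plane.\<close>

lemma wedge_span:
  assumes "wedge a b \<noteq> 0"
  shows "w = (wedge w b / wedge a b) *\<^sub>R a + (wedge a w / wedge a b) *\<^sub>R b"
proof -
  have "wedge a b *\<^sub>R w = wedge w b *\<^sub>R a + wedge a w *\<^sub>R b"
    by (simp add: vec_eq_iff forall_2 wedge_def algebra_simps)
  then have "w = (1 / wedge a b) *\<^sub>R (wedge w b *\<^sub>R a + wedge a w *\<^sub>R b)"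
    using assms by (metis divide_self_if scaleR_one scaleR_scaleR times_divide_eq_left mult_1)
  then show ?thesis by (simp add: scaleR_add_right)
qed

lemma diffeo_on_frechet_bij:
  assumes "diffeo_on U \<Psi>" "P \<in> U"
  shows "bij (frechet_derivative \<Psi> (at P))"
proof -
  obtain V \<Theta> where V: "open U" "open V" and hom: "homeomorphism U V \<Psi> \<Theta>"
    and sm: "smooth_on \<Psi> U" "smooth_on \<Theta> V"
    using assms(1) by (auto simp: diffeo_on_def)
  have P: "\<Psi> P \<in> V" using hom assms(2) by (auto simp: homeomorphism_def)
  note D = smooth_on_has_derivative[OF sm(1) assms(2)]
  have "((\<lambda>R. \<Theta> (\<Psi> R)) has_derivative
      (\<lambda>h. frechet_derivative \<Theta> (at (\<Psi> P)) (frechet_derivative \<Psi> (at P) h))) (at P)"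
    by (rule has_derivative_compose[OF D smooth_on_has_derivative[OF sm(2) P]])
  then have "((\<lambda>R. R) has_derivative
      (\<lambda>h. frechet_derivative \<Theta> (at (\<Psi> P)) (frechet_derivative \<Psi> (at P) h))) (at P)"
    by (rule has_derivative_transform_within_open[OF _ V(1) assms(2)])
      (use hom in \<open>auto simp: homeomorphism_def\<close>)
  then have "(\<lambda>h. frechet_derivative \<Theta> (at (\<Psi> P)) (frechet_derivative \<Psi> (at P) h)) = (\<lambda>h. h)"
    by (rule has_derivative_unique) (rule has_derivative_ident)
  then have "inj (frechet_derivative \<Psi> (at P))"
    by (metis injI)
  then show ?thesis
    using has_derivative_linear[OF D] by (simp add: bij_def linear_injective_imp_surjective)
qed

lemma frechet_fst_snd:
  fixes \<Psi> :: "point \<Rightarrow> point"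
  assumes "smooth_on \<Psi> U" "P \<in> U"
  shows "frechet_derivative (fst \<circ> \<Psi>) (at P) v = fst (frechet_derivative \<Psi> (at P) v)"
    and "frechet_derivative (snd \<circ> \<Psi>) (at P) v = snd (frechet_derivative \<Psi> (at P) v)"
proof -
  note D = smooth_on_has_derivative[OF assms]
  have "((fst \<circ> \<Psi>) has_derivative (\<lambda>v. fst (frechet_derivative \<Psi> (at P) v))) (at P)"
    "((snd \<circ> \<Psi>) has_derivative (\<lambda>v. snd (frechet_derivative \<Psi> (at P) v))) (at P)"
    using has_derivative_fst[OF D] has_derivative_snd[OF D] by (simp_all add: o_def)
  from frechet_derivative_at[OF this(1), symmetric] frechet_derivative_at[OF this(2), symmetric]
  show "frechet_derivative (fst \<circ> \<Psi>) (at P) v = fst (frechet_derivative \<Psi> (at P) v)"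
    and "frechet_derivative (snd \<circ> \<Psi>) (at P) v = snd (frechet_derivative \<Psi> (at P) v)"
    by simp_all
qed

lemma new_deriv1_differentiable:
  assumes "open U" "smooth_on \<Psi> U" "(t, v) \<in> U" "Dx0 (fst \<circ> \<Psi>) (t, v, w) \<noteq> 0"
  shows "new_deriv1 \<Psi> differentiable (at (t, v, w))"
proof -
  have "smooth_on (fst \<circ> \<Psi>) U" "smooth_on (snd \<circ> \<Psi>) U"
    using smooth_on_linear_compose[OF assms(1) bounded_linear_fst assms(2)]
      smooth_on_linear_compose[OF assms(1) bounded_linear_snd assms(2)] by (simp_all add: o_def)
  note s = smooth_on_differentiable[OF smooth_on_Dx0[OF assms(1) this(1)]]
    smooth_on_differentiable[OF smooth_on_Dx0[OF assms(1) this(2)]]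
  have "(\<lambda>J. inverse (Dx0 (fst \<circ> \<Psi>) J) *\<^sub>R Dx0 (snd \<circ> \<Psi>) J) differentiable (at (t, v, w))"
    using assms(3,4) by (intro differentiable_scaleR differentiable_inverse s) auto
  then show ?thesis by (simp add: new_deriv1_def)
qed

text \<open>If a and b were independent, (1, w), (0, a), (0, b) would be a basis of the point space.
  Its image under the invertible derivative is again a basis, and only 0 is orthogonal to
  it.\<close>

lemma wedge_zero_of_plane:
  fixes \<Psi> :: "point \<Rightarrow> point"
  assumes bij: "bij (frechet_derivative \<Psi> (at P))" and lin: "linear (frechet_derivative \<Psi> (at P))"
    and "\<nu> \<noteq> 0" and 1: "\<nu> \<bullet> frechet_derivative \<Psi> (at P) (1, w) = 0"
    and a: "\<nu> \<bullet> frechet_derivative \<Psi> (at P) (0, a) = 0" and b: "\<nu> \<bullet> frechet_derivative \<Psi> (at P) (0, b) = 0"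
  shows "wedge a b = 0"
proof (rule ccontr)
  assume ne: "wedge a b \<noteq> 0"
  let ?D = "frechet_derivative \<Psi> (at P)"
  have 0: "\<nu> \<bullet> ?D (0, v) = 0" for v
  proof -
    obtain c d where "v = c *\<^sub>R a + d *\<^sub>R b" using wedge_span[OF ne, of v] by blast
    then have "?D (0, v) = ?D (c *\<^sub>R (0, a) + d *\<^sub>R (0, b))" by simp
    also have "\<dots> = c *\<^sub>R ?D (0, a) + d *\<^sub>R ?D (0, b)"
      by (simp only: linear_add[OF lin] linear_scale[OF lin])
    finally have "?D (0, v) = c *\<^sub>R ?D (0, a) + d *\<^sub>R ?D (0, b)" .
    then show ?thesis using a b by (simp add: inner_add_right)
  qed
  have "\<nu> \<bullet> ?D (c, v) = 0" for c v
  proof -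
    have "?D (c, v) = ?D (c *\<^sub>R (1, w) + (0, v - c *\<^sub>R w))" by simp
    also have "\<dots> = c *\<^sub>R ?D (1, w) + ?D (0, v - c *\<^sub>R w)"
      by (simp only: linear_add[OF lin] linear_scale[OF lin])
    finally have "?D (c, v) = c *\<^sub>R ?D (1, w) + ?D (0, v - c *\<^sub>R w)" .
    then show ?thesis using 0 1 by (simp add: inner_add_right)
  qed
  moreover obtain c v where "\<nu> = ?D (c, v)"
    using bij by (metis bij_pointE prod.collapse)
  ultimately have "\<nu> \<bullet> \<nu> = 0" by metis
  then show False using \<open>\<nu> \<noteq> 0\<close> by simp
qed

context linear_system
begin

text \<open>A plane \<open>\<nu> = const\<close> tangent at one point to a pencil of solution curves contains all of them,
  because the curves are mapped into straight lines.\<close>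

lemma pencil_in_plane:
  assumes U: "open U" "U \<subseteq> I \<times> UNIV" and \<Psi>: "smooth_on \<Psi> U"
    and trans: "transforms_to_trivial U \<Delta> \<Psi>"
    and sol: "\<And>s. solves (\<lambda>t. p t + s *\<^sub>R h t) (\<lambda>t. p1 t + s *\<^sub>R h1 t)"
    and x0: "h x0 = 0" "(x0, p x0) \<in> U" "Dx0 (fst \<circ> \<Psi>) (x0, p x0, p1 x0) \<noteq> 0"
    and \<nu>: "\<nu> \<bullet> frechet_derivative \<Psi> (at (x0, p x0)) (1, p1 x0) = 0"
      "\<nu> \<bullet> frechet_derivative \<Psi> (at (x0, p x0)) (0, h1 x0) = 0"
  shows "\<forall>\<^sub>F x in nhds x0. (x, p x) \<in> U \<and> Dx0 (fst \<circ> \<Psi>) (x, p x, p1 x) \<noteq> 0 \<and>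
    \<nu> \<bullet> frechet_derivative \<Psi> (at (x, p x)) (1, p1 x) = 0 \<and>
    \<nu> \<bullet> frechet_derivative \<Psi> (at (x, p x)) (0, h x) = 0"
proof -
  define Z where "Z = fst \<circ> \<Psi>"
  define W where "W = snd \<circ> \<Psi>"
  have sZ: "smooth_on Z U" and sW: "smooth_on W U"
    using smooth_on_linear_compose[OF U(1) bounded_linear_fst \<Psi>]
      smooth_on_linear_compose[OF U(1) bounded_linear_snd \<Psi>] by (simp_all add: Z_def W_def o_def)
  have D\<Psi>: "frechet_derivative \<Psi> (at (x, y)) (1, y1) = (Dx0 Z (x, y, y1), Dx0 W (x, y, y1))"
    if "(x, y) \<in> U" for x y y1
    using frechet_fst_snd[OF \<Psi> that] by (simp add: Dx0_def Z_def W_def)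
  let ?U1 = "(\<lambda>J :: jet1. (fst J, fst (snd J))) -` U"
  have oU1: "open ?U1"
    by (intro open_vimage U linear_continuous_on bounded_linear_Pair bounded_linear_fst
        bounded_linear_compose[OF bounded_linear_fst bounded_linear_snd])
  \<comment> \<open>The jets at which the transformed curve is a graph over the z-axis.\<close>
  define O1 where "O1 = {J \<in> ?U1. Dx0 Z J \<noteq> 0}"
  have O1: "open O1"
  proof -
    have "open (?U1 \<inter> Dx0 Z -` (- {0}))"
      by (rule continuous_open_preimage[OF smooth_on_continuous_on[OF smooth_on_Dx0[OF U(1) sZ]] oU1]) auto
    moreover have "?U1 \<inter> Dx0 Z -` (- {0}) = O1" unfolding O1_def by blast
    ultimately show ?thesis by (rule subst[rotated])
  qed
  have x0I: "x0 \<in> I" using x0(2) U(2) by auto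
  define y where "y s t = p t + s *\<^sub>R h t" for s t
  define y1 where "y1 s t = p1 t + s *\<^sub>R h1 t" for s t
  have dy: "(y s has_vector_derivative y1 s t) (at t)"
    "(y1 s has_vector_derivative rhs t (y s t) (y1 s t)) (at t)" if "t \<in> I" for s t
    using sol[of s] that by (auto simp: solves_def y_def[abs_def] y1_def[abs_def])
  have cont_y: "continuous_on I (y s)" "continuous_on I (y1 s)" for s
    using dy by (auto intro!: continuous_at_imp_continuous_on has_vector_derivative_continuous)
  have cp: "continuous_on I p" "continuous_on I p1"
    using cont_y[of 0] by (simp_all add: y_def y1_def)
  have ch: "continuous_on I h" "continuous_on I h1"
    using continuous_on_diff[OF cont_y(1)[of 1] cp(1)] continuous_on_diff[OF cont_y(2)[of 1] cp(2)]
    by (simp_all add: y_def y1_def)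
  let ?m = "\<lambda>(t, s). (t, y s t, y1 s t)"
  have "continuous_on (I \<times> UNIV) ?m"
    unfolding case_prod_unfold y_def y1_def
    by (intro continuous_intros continuous_on_compose2[OF cp(1)] continuous_on_compose2[OF cp(2)]
        continuous_on_compose2[OF ch(1)] continuous_on_compose2[OF ch(2)]) auto
  then have "open ((I \<times> UNIV) \<inter> ?m -` O1)"
    by (rule continuous_open_preimage) (intro open_Times I open_UNIV, rule O1)
  moreover have "(x0, 0) \<in> (I \<times> UNIV) \<inter> ?m -` O1"
    using x0 x0I by (simp add: O1_def y_def y1_def Z_def)
  \<comment> \<open>A product neighbourhood provides one range of t for all members of the pencil
    with s near 0.\<close>
  ultimately obtain A B where AB: "open A" "open B" "(x0, 0) \<in> A \<times> B"
    "A \<times> B \<subseteq> (I \<times> UNIV) \<inter> ?m -` O1"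
    by (rule open_prod_elim)
  obtain e where e: "e > 0" "ball x0 e \<subseteq> A"
    using AB(1,3) open_contains_ball by blast
  define N where "N = ball x0 e"
  have N: "open N" "is_interval N" "x0 \<in> N" "N \<subseteq> I"
    using e AB by (auto simp: N_def is_interval_ball_real)
  have jet: "(t, y s t) \<in> U" "Dx0 Z (t, y s t, y1 s t) \<noteq> 0" if "t \<in> N" "s \<in> B" for s t
  proof -
    have "(t, s) \<in> A \<times> B" using that e(2) by (auto simp: N_def)
    then have "(t, y s t, y1 s t) \<in> O1" using AB(4) by auto
    then show "(t, y s t) \<in> U" "Dx0 Z (t, y s t, y1 s t) \<noteq> 0" by (auto simp: O1_def)
  qed
  have main: "\<nu> \<bullet> frechet_derivative \<Psi> (at (t, y s t)) (1, y1 s t) = 0"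
    if s: "s \<in> B" and t: "t \<in> N" for s t
  proof -
    \<comment> \<open>The slope dw/dz of the transformed curve. It is constant by the trivial
      equation, so the tangent vector keeps the direction (1, \<open>m x0\<close>) and stays
      orthogonal to \<nu> if it is so at x0.\<close>
    define m where "m t = new_deriv1 \<Psi> (t, y s t, y1 s t)" for t
    have "(m has_vector_derivative 0) (at r)" if r: "r \<in> N" for r
    proof -
      have rI: "r \<in> I" using r N by auto
      let ?y2 = "rhs r (y s r) (y1 s r)"
      have "(m has_vector_derivative Dx1 (new_deriv1 \<Psi>) (r, y s r, y1 s r, ?y2)) (at r)"
        unfolding m_def[abs_def]
        by (rule has_vector_derivative_Dx1[OF new_deriv1_differentiable[OF U(1) \<Psi> jet[OF r s, unfolded Z_def]] dy[OF rI]])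
      moreover have "new_deriv2 \<Psi> (r, y s r, y1 s r, ?y2) = 0"
        using trans jet[OF r s] lin_sys_eq_0_iff[of r "y s r" "y1 s r" ?y2]
        unfolding transforms_to_trivial_def Z_def by blast
      then have "Dx1 (new_deriv1 \<Psi>) (r, y s r, y1 s r, ?y2) = 0"
        using jet(2)[OF r s] by (simp add: new_deriv2_def Z_def)
      ultimately show ?thesis by simp
    qed
    then have m: "m r = m x0" if "r \<in> N" for r
      by (rule const_of_vector_derivative_zero[OF N(2) _ that N(3)])
    have W: "Dx0 W (r, y s r, y1 s r) = Dx0 Z (r, y s r, y1 s r) *\<^sub>R m x0" if "r \<in> N" for r
      using jet(2)[OF that s] by (simp add: m[OF that, symmetric]) (simp add: m_def new_deriv1_def Z_def W_def)
    have fac: "frechet_derivative \<Psi> (at (r, y s r)) (1, y1 s r) = Dx0 Z (r, y s r, y1 s r) *\<^sub>R (1, m x0)"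
      if "r \<in> N" for r
      using D\<Psi>[OF jet(1)[OF that s], of "y1 s r"] W[OF that] by simp
    have "frechet_derivative \<Psi> (at (x0, p x0)) (1, p1 x0 + s *\<^sub>R h1 x0) =
        frechet_derivative \<Psi> (at (x0, p x0)) (1, p1 x0) + s *\<^sub>R frechet_derivative \<Psi> (at (x0, p x0)) (0, h1 x0)"
      using linear_add[OF linear_frechet[OF \<Psi> x0(2)], of "(1, p1 x0)" "s *\<^sub>R (0, h1 x0)"]
        linear_scale[OF linear_frechet[OF \<Psi> x0(2)], of s "(0, h1 x0)"] by simp
    then have "\<nu> \<bullet> frechet_derivative \<Psi> (at (x0, y s x0)) (1, y1 s x0) = 0"
      using \<nu> x0(1) by (simp add: y_def y1_def inner_add_right)
    then have "\<nu> \<bullet> (1, m x0) = 0"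
      unfolding fac[OF N(3)] inner_scaleR_right using jet(2)[OF N(3) s] by simp
    then show ?thesis unfolding fac[OF t] inner_scaleR_right by simp
  qed
  have const: "\<nu> \<bullet> \<Psi> (t, y s t) = \<nu> \<bullet> \<Psi> (x0, p x0)" if s: "s \<in> B" and t: "t \<in> N" for s t
  proof -
    have "\<nu> \<bullet> \<Psi> (t, y s t) = \<nu> \<bullet> \<Psi> (x0, y s x0)"
    proof (rule const_of_vector_derivative_zero[OF N(2) _ t N(3)])
      fix r assume r: "r \<in> N"
      have "((\<lambda>t. (t, y s t)) has_vector_derivative (1, y1 s r)) (at r)"
        using r N by (intro has_vector_derivative_Pair dy has_vector_derivative_id[unfolded id_def]) auto
      from has_vector_derivative_curve[OF \<Psi> this jet(1)[OF r s]]
      have "((\<lambda>t. \<nu> \<bullet> \<Psi> (t, y s t)) has_vector_derivative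
          \<nu> \<bullet> frechet_derivative \<Psi> (at (r, y s r)) (1, y1 s r)) (at r)"
        by (rule bounded_linear.has_vector_derivative[OF bounded_linear_inner_right])
      then show "((\<lambda>t. \<nu> \<bullet> \<Psi> (t, y s t)) has_vector_derivative 0) (at r)"
        by (simp add: main[OF s r])
    qed
    then show ?thesis using x0(1) by (simp add: y_def)
  qed
  have B0: "0 \<in> B" using AB by auto
  \<comment> \<open>The swept surface lies in a plane, so moving in s at fixed t is tangent to this
    plane too; at s = 0 that direction is \<open>h t\<close>.\<close>
  have tang: "\<nu> \<bullet> frechet_derivative \<Psi> (at (t, p t)) (0, h t) = 0" if t: "t \<in> N" for t
  proof -
    have "((\<lambda>s. (t, y s t)) has_vector_derivative (0, h t)) (at 0)"
      unfolding y_def by (intro has_vector_derivative_Pair) (auto intro!: derivative_eq_intros)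
    from has_vector_derivative_curve[OF \<Psi> this jet(1)[OF t B0]]
    have "((\<lambda>s. \<nu> \<bullet> \<Psi> (t, y s t)) has_vector_derivative
        \<nu> \<bullet> frechet_derivative \<Psi> (at (t, y 0 t)) (0, h t)) (at 0)"
      by (rule bounded_linear.has_vector_derivative[OF bounded_linear_inner_right])
    moreover have "((\<lambda>s. \<nu> \<bullet> \<Psi> (t, y s t)) has_vector_derivative 0) (at 0)"
      by (rule has_vector_derivative_cong_open[OF AB(2) B0 const[OF _ t, symmetric]]) auto
    ultimately show ?thesis
      using vector_derivative_unique_at by (fastforce simp: y_def)
  qed
  show ?thesis
    unfolding eventually_nhds
    by (intro exI[of _ N] conjI N ballI) (use jet[OF _ B0] main[OF B0] tang in \<open>simp_all add: y_def y1_def Z_def\<close>)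
qed

end

context gauged_system
begin

lemma T_lift_scaleR: "T_lift (\<lambda>t. s *\<^sub>R u t) (\<lambda>t. s *\<^sub>R u1 t) t = s *\<^sub>R T_lift u u1 t"
  by (simp add: T_lift_def mv_simps algebra_simps)

lemma solves_pencil:
  assumes "solves p p1" "reduced_sol u u1"
  shows "solves (\<lambda>t. p t + s *\<^sub>R (T t *v u t)) (\<lambda>t. p1 t + s *\<^sub>R T_lift u u1 t)"
  using solves_of_reduced_sol[OF assms(1) reduced_sol_scaleR[OF assms(2), of s]]
  by (simp add: T_lift_scaleR mv.scaleR_right)

lemma det_T: "t \<in> I \<Longrightarrow> det (T t) \<noteq> 0"
  using ST[of t] det_mul[of "S t" "T t"] by auto

lemma scalar_of_reducible:
  assumes red: "reducible_to_trivial I \<Delta>" and x0: "x0 \<in> I"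
  shows "wedge (Q x0 *v e) e = 0"
proof -
  have "(x0, 0) \<in> I \<times> (UNIV :: (real^2) set)" using x0 by simp
  with red obtain U \<Psi> where PU: "(x0, 0) \<in> U" "U \<subseteq> I \<times> UNIV" and diffeo: "diffeo_on U \<Psi>"
    and trans: "transforms_to_trivial U \<Delta> \<Psi>"
    unfolding reducible_to_trivial_def by blast
  have U: "open U" and \<Psi>: "smooth_on \<Psi> U" using diffeo by (auto simp: diffeo_on_def)
  note bij = diffeo_on_frechet_bij[OF diffeo] and lin = linear_frechet[OF \<Psi>]
  let ?D = "\<lambda>P. frechet_derivative \<Psi> (at P)"
  \<comment> \<open>The vectors (1, w) span the point space; if the first component of the
    derivative vanished on all of them, the derivative would not be onto.\<close>
  obtain w where w: "Dx0 (fst \<circ> \<Psi>) (x0, 0, w) \<noteq> 0"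
  proof (rule ccontr)
    assume "\<not> thesis"
    then have "\<And>w. Dx0 (fst \<circ> \<Psi>) (x0, 0, w) = 0" using that by blast
    then have 0: "fst (?D (x0, 0) (1, w)) = 0" for w
      by (simp add: Dx0_def frechet_fst_snd[OF \<Psi> PU(1)])
    have "fst (?D (x0, 0) (c, v)) = 0" for c v
    proof -
      have "?D (x0, 0) (c, v) = ?D (x0, 0) (c *\<^sub>R (1, 0) + ((1, v) - (1, 0)))" by simp
      also have "\<dots> = c *\<^sub>R ?D (x0, 0) (1, 0) + (?D (x0, 0) (1, v) - ?D (x0, 0) (1, 0))"
        by (simp only: linear_add[OF lin[OF PU(1)]] linear_scale[OF lin[OF PU(1)]] linear_diff[OF lin[OF PU(1)]])
      finally show ?thesis using 0 by simp
    qed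
    moreover obtain c v where "(1, 0) = ?D (x0, 0) (c, v)"
      using bij[OF PU(1)] by (metis bij_pointE prod.collapse)
    ultimately show False by (metis fst_conv zero_neq_one)
  qed
  obtain p p1 where p: "solves p p1" "p x0 = 0" "p1 x0 = w"
    using smooth_solution_exists[OF x0] by metis
  obtain u u1 where u: "reduced_sol u u1" "u x0 = 0" "u1 x0 = e"
    using reduced_sol_exists[OF x0] by metis
  \<comment> \<open>Two vectors in three dimensions have a common normal. These are the images of
    the tangent of p and of the velocity of the variation T u at x0.\<close>
  obtain \<nu> where \<nu>: "\<nu> \<noteq> 0" "\<nu> \<bullet> ?D (x0, p x0) (1, p1 x0) = 0" "\<nu> \<bullet> ?D (x0, p x0) (0, T_lift u u1 x0) = 0"
  proof -
    let ?S = "{?D (x0, p x0) (1, p1 x0), ?D (x0, p x0) (0, T_lift u u1 x0)}"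
    have "dim ?S \<le> card ?S" by (rule dim_le_card') simp
    also have "\<dots> \<le> 2" by (simp add: card_insert_if)
    also have "2 < DIM(point)" by simp
    finally obtain \<nu> where "\<nu> \<noteq> 0" "\<And>y. y \<in> span ?S \<Longrightarrow> orthogonal \<nu> y"
      using orthogonal_to_subspace_exists by blast
    then show ?thesis using that[of \<nu>] by (simp add: orthogonal_def span_base)
  qed
  have "\<forall>\<^sub>F x in nhds x0. (x, p x) \<in> U \<and> Dx0 (fst \<circ> \<Psi>) (x, p x, p1 x) \<noteq> 0 \<and>
    \<nu> \<bullet> ?D (x, p x) (1, p1 x) = 0 \<and> \<nu> \<bullet> ?D (x, p x) (0, T x *v u x) = 0"
    using PU p(2,3) w u(2) \<nu>(2,3)
    by (intro pencil_in_plane[OF U PU(2) \<Psi> trans solves_pencil[OF p(1) u(1)]]) (simp_all add: mv.zero_right)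
  then obtain N where N: "open N" "x0 \<in> N" and plane: "\<And>x. x \<in> N \<Longrightarrow> (x, p x) \<in> U"
    "\<And>x. x \<in> N \<Longrightarrow> Dx0 (fst \<circ> \<Psi>) (x, p x, p1 x) \<noteq> 0"
    "\<And>x. x \<in> N \<Longrightarrow> \<nu> \<bullet> ?D (x, p x) (1, p1 x) = 0"
    "\<And>x. x \<in> N \<Longrightarrow> \<nu> \<bullet> ?D (x, p x) (0, T x *v u x) = 0"
    unfolding eventually_nhds by blast
  have NI: "N \<subseteq> I" using plane(1) PU(2) by auto
  have par: "wedge (u1 x) (u x) = 0" if x: "x \<in> N" for x
  proof -
    have xI: "x \<in> I" using x NI by auto
    \<comment> \<open>A second pencil around p, now centred at x, whose variation has velocity T u
      there. The first pencil has shown this direction to be tangent to the plane, so the same \<nu>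
      works again.\<close>
    obtain v v1 where v: "reduced_sol v v1" "v x = 0" "v1 x = u x"
      using reduced_sol_exists[OF xI] by metis
    have "T_lift v v1 x = T x *v u x" by (simp add: T_lift_def v mv.zero_right)
    then have "\<forall>\<^sub>F r in nhds x. (r, p r) \<in> U \<and> Dx0 (fst \<circ> \<Psi>) (r, p r, p1 r) \<noteq> 0 \<and>
      \<nu> \<bullet> ?D (r, p r) (1, p1 r) = 0 \<and> \<nu> \<bullet> ?D (r, p r) (0, T r *v v r) = 0"
      using plane[OF x] v(2)
      by (intro pencil_in_plane[OF U PU(2) \<Psi> trans solves_pencil[OF p(1) v(1)]]) (simp_all add: mv.zero_right)
    then obtain M where M: "open M" "x \<in> M" and plane': "\<And>r. r \<in> M \<Longrightarrow> \<nu> \<bullet> ?D (r, p r) (0, T r *v v r) = 0"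
      unfolding eventually_nhds by blast
    let ?M = "M \<inter> N"
    have oM: "open ?M" "x \<in> ?M" and MI: "\<And>r. r \<in> ?M \<Longrightarrow> r \<in> I" using M N x NI by auto
    have w0: "wedge (u r) (v r) = 0" if r: "r \<in> ?M" for r
    proof -
      have rN: "r \<in> N" "r \<in> M" using r by auto
      have "wedge (T r *v u r) (T r *v v r) = 0"
        by (rule wedge_zero_of_plane[OF bij[OF plane(1)[OF rN(1)]] lin[OF plane(1)[OF rN(1)]] \<nu>(1)
              plane(3)[OF rN(1)] plane(4)[OF rN(1)] plane'[OF rN(2)]])
      then show ?thesis using det_T[OF MI[OF r]] by (simp add: wedge_matrix_mult)
    qed
    note du = reduced_solD[OF u(1)] and dv = reduced_solD[OF v(1)]
    \<comment> \<open>The wedge of u and v vanishes near x. As \<open>v x = 0\<close> and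
      \<open>v1 x = u x\<close>, its second derivative at x is twice
      \<open>wedge (u1 x) (u x)\<close>.\<close>
    have "(wedge (u x) (- (Q x *v v x)) + wedge (u1 x) (v1 x))
        + (wedge (u1 x) (v1 x) + wedge (- (Q x *v u x)) (v x)) = 0"
    proof (rule second_derivative_unique[OF oM])
      show "((\<lambda>r. wedge (u r) (v r)) has_vector_derivative wedge (u r) (v1 r) + wedge (u1 r) (v r)) (at r)"
        if "r \<in> ?M" for r
        by (intro wedge_deriv du dv MI that)
      show "((\<lambda>r. wedge (u r) (v1 r) + wedge (u1 r) (v r)) has_vector_derivative
        (wedge (u x) (- (Q x *v v x)) + wedge (u1 x) (v1 x))
        + (wedge (u1 x) (v1 x) + wedge (- (Q x *v u x)) (v x))) (at x)"
        using MI[OF oM(2)] by (intro has_vector_derivative_add wedge_deriv du dv)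
      show "((\<lambda>r. wedge (u r) (v r)) has_vector_derivative 0) (at r)" if "r \<in> ?M" for r
        by (rule has_vector_derivative_cong_open[OF oM(1) that w0[symmetric]]) auto
    qed auto
    then show ?thesis by (simp add: v mv.zero_right) (simp add: wedge_def)
  qed
  have wQ: "wedge (Q x *v u x) (u x) = 0" if x: "x \<in> N" for x
  proof -
    have xI: "x \<in> I" using x NI by auto
    have "((\<lambda>r. wedge (u1 r) (u r)) has_vector_derivative
        wedge (u1 x) (u1 x) + wedge (- (Q x *v u x)) (u x)) (at x)"
      by (intro wedge_deriv reduced_solD[OF u(1) xI])
    moreover have "((\<lambda>r. wedge (u1 r) (u r)) has_vector_derivative 0) (at x)"
      by (rule has_vector_derivative_cong_open[OF N(1) x par[symmetric]]) auto
    ultimately have "wedge (u1 x) (u1 x) + wedge (- (Q x *v u x)) (u x) = 0"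
      by (rule vector_derivative_unique_at)
    then show ?thesis by (simp add: wedge_def)
  qed
  \<comment> \<open>At x0 itself the relation for u is void because \<open>u x0 = 0\<close>.
    Division by x - x0 preserves it at the other points and leads to e in the limit.\<close>
  let ?d = "\<lambda>x. (u x - u x0) /\<^sub>R (x - x0)"
  have "(?d \<longlongrightarrow> e) (at x0)"
    using has_vector_derivative_tendsto[OF reduced_solD(1)[OF u(1) x0]] u(3) by simp
  moreover have "(Q \<longlongrightarrow> Q x0) (at x0)"
    using smooth_on_continuous_on[OF smooth_Q] x0 I(1) continuous_on_eq_continuous_at isCont_def by blast
  ultimately have "((\<lambda>x. wedge (Q x *v ?d x) (?d x)) \<longlongrightarrow> wedge (Q x0 *v e) e) (at x0)"
    by (intro bounded_bilinear.tendsto[OF bounded_bilinear_wedge]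
        bounded_bilinear.tendsto[OF bounded_bilinear_matrix_vector_mult])
  moreover have "\<forall>\<^sub>F x in at x0. wedge (Q x *v ?d x) (?d x) = 0"
    unfolding eventually_at_topological
    by (intro exI[of _ N] conjI N ballI impI) (use wQ in \<open>auto simp: u(2) mv.scaleR_right wedge_def algebra_simps\<close>)
  ultimately have "((\<lambda>x. 0::real) \<longlongrightarrow> wedge (Q x0 *v e) e) (at x0)"
    by (rule Lim_transform_eventually)
  then show ?thesis by (simp add: tendsto_const_iff)
qed

end

section \<open>Systems with scalar potential\<close>

context gauged_system
begin

text \<open>The field with coefficients \<alpha> \<bullet> u and (\<alpha>' \<bullet> u) u, pulled
  back through the gauge. For Q = 0 such fields generate projective transformations.\<close>

lemma symmetry_exists_of_scalar:
  assumes q: "\<And>x v. x \<in> I \<Longrightarrow> Q x *v v = q x *\<^sub>R v" and x0: "x0 \<in> I"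
  shows "\<exists>\<xi> \<phi>. lie_symmetry I \<Delta> \<xi> \<phi> \<and> non_Cartan I \<xi>"
proof -
  obtain \<alpha> \<alpha>1 where \<alpha>: "reduced_sol \<alpha> \<alpha>1" "\<alpha> x0 = axis 1 1" and sm\<alpha>: "smooth_on \<alpha> I" "smooth_on \<alpha>1 I"
    using reduced_sol_exists[OF x0] by blast
  obtain p p1 where smp: "smooth_on p I" "smooth_on p1 I" and p: "solves p p1"
    using smooth_solution_exists[OF x0] by blast
  define \<xi> :: "point \<Rightarrow> real" where "\<xi> P = \<alpha> (fst P) \<bullet> (S (fst P) *v (snd P - p (fst P)))" for P
  \<comment> \<open>The second summand offsets the part of \<xi> y' that does not come from T u',
    which leaves the characteristic as T applied to (\<alpha>' \<bullet> u) u - (\<alpha> \<bullet>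
    u) u'.\<close>
  define \<phi> :: "point \<Rightarrow> real^2" where
    "\<phi> P = (\<alpha>1 (fst P) \<bullet> (S (fst P) *v (snd P - p (fst P)))) *\<^sub>R (snd P - p (fst P))
       + \<xi> P *\<^sub>R (p1 (fst P) - (1 / 2) *\<^sub>R (A1 (fst P) *v (snd P - p (fst P))))" for P
  note mvI = smooth_on_bilinear[OF open_IU bounded_bilinear_matrix_vector_mult]
    and scI = smooth_on_bilinear[OF open_IU bounded_bilinear_scaleR]
    and inI = smooth_on_bilinear[OF open_IU bounded_bilinear_inner]
    and diffI = smooth_on_diff[OF open_IU]
    and sndI = smooth_on_bounded_linear[OF open_IU bounded_linear_snd]
    and base = smooth_on_of_fst[OF I(1)]
  have \<xi>: "smooth_on \<xi> (I \<times> UNIV)"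
    unfolding \<xi>_def[abs_def]
    by (intro inI mvI diffI sndI base[OF S] base[OF sm\<alpha>(1)] base[OF smp(1)])
  have \<phi>: "smooth_on \<phi> (I \<times> UNIV)"
    unfolding \<phi>_def[abs_def]
    by (intro smooth_on_add[OF open_IU] scI inI mvI diffI sndI \<xi> base[OF S] base[OF sm\<alpha>(2)] base[OF smp(1)]
        base[OF smp(2)] base[OF A1] smooth_on_const[OF open_IU])
  have "lie_symmetry I \<Delta> \<xi> \<phi>"
  proof (rule lie_symmetryI[OF \<xi> \<phi>])
    fix y y1 assume y: "solves y y1"
    define u where "u t = S t *v (y t - p t)" for t
    define u1 where "u1 = S_lift (\<lambda>t. y t - p t) (\<lambda>t. y1 t - p1 t)"
    have u: "reduced_sol u u1"
      unfolding u_def[abs_def] u1_def by (rule reduced_sol_of_solves[OF p y])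
    have Tu: "y t = p t + T t *v u t" if "t \<in> I" for t
      by (simp add: u_def T_S_vec[OF that])
    have y1: "y1 t = p1 t + T_lift u u1 t" if "t \<in> I" for t
      using T_lift_S_lift[OF that, of "\<lambda>t. y t - p t" "\<lambda>t. y1 t - p1 t"] by (simp add: u_def[abs_def] u1_def)
    define g where "g t = (\<alpha>1 t \<bullet> u t) *\<^sub>R u t - (\<alpha> t \<bullet> u t) *\<^sub>R u1 t" for t
    \<comment> \<open>In the derivative of g the terms with Q cancel, because a scalar Q satisfies
      (Q \<alpha> \<bullet> u) u = (\<alpha> \<bullet> u) Q u.\<close>
    define g1 where "g1 t = (\<alpha>1 t \<bullet> u1 t) *\<^sub>R u t - (\<alpha> t \<bullet> u1 t) *\<^sub>R u1 t" for t
    have dg: "(g has_vector_derivative g1 t) (at t)" "(g1 has_vector_derivative - (Q t *v g t)) (at t)"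
      if t: "t \<in> I" for t
    proof -
      note du = reduced_solD(1,2)[OF u t] and d\<alpha> = reduced_solD(1,2)[OF \<alpha>(1) t]
      have "(g has_vector_derivative
        ((\<alpha>1 t \<bullet> u t) *\<^sub>R u1 t + (\<alpha>1 t \<bullet> u1 t + (- (Q t *v \<alpha> t)) \<bullet> u t) *\<^sub>R u t)
        - ((\<alpha> t \<bullet> u t) *\<^sub>R (- (Q t *v u t)) + (\<alpha> t \<bullet> u1 t + \<alpha>1 t \<bullet> u t) *\<^sub>R u1 t)) (at t)"
        unfolding g_def[abs_def] by (intro has_vector_derivative_diff scaleR_deriv inner_deriv du d\<alpha>)
      then show "(g has_vector_derivative g1 t) (at t)"
        by (rule has_vector_derivative_eq_rhs) (simp add: g1_def q[OF t] algebra_simps)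
      have "(g1 has_vector_derivative
        ((\<alpha>1 t \<bullet> u1 t) *\<^sub>R u1 t + (\<alpha>1 t \<bullet> (- (Q t *v u t)) + (- (Q t *v \<alpha> t)) \<bullet> u1 t) *\<^sub>R u t)
        - ((\<alpha> t \<bullet> u1 t) *\<^sub>R (- (Q t *v u t)) + (\<alpha> t \<bullet> (- (Q t *v u t)) + \<alpha>1 t \<bullet> u1 t) *\<^sub>R u1 t)) (at t)"
        unfolding g1_def[abs_def] by (intro has_vector_derivative_diff scaleR_deriv inner_deriv du d\<alpha>)
      then show "(g1 has_vector_derivative - (Q t *v g t)) (at t)"
        by (rule has_vector_derivative_eq_rhs) (simp add: g_def q[OF t] algebra_simps)
    qed
    have char: "\<phi> (t, y t) - \<xi> (t, y t) *\<^sub>R y1 t = T t *v g t" if t: "t \<in> I" for t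
      by (simp add: \<phi>_def \<xi>_def y1[OF t] T_lift_def g_def Tu[OF t] S_T_vec[OF t] mv_simps algebra_simps)
    show "\<exists>\<chi>1. \<forall>t\<in>I. ((\<lambda>s. \<phi> (s, y s) - \<xi> (s, y s) *\<^sub>R y1 s) has_vector_derivative \<chi>1 t) (at t) \<and>
      (\<chi>1 has_vector_derivative - (A1 t *v \<chi>1 t) - A0 t *v (\<phi> (t, y t) - \<xi> (t, y t) *\<^sub>R y1 t)) (at t)"
    proof (intro exI[of _ "T_lift g g1"] ballI conjI)
      fix t assume t: "t \<in> I"
      show "((\<lambda>s. \<phi> (s, y s) - \<xi> (s, y s) *\<^sub>R y1 s) has_vector_derivative T_lift g g1 t) (at t)"
        by (rule has_vector_derivative_cong_open[OF I(1) t char[symmetric] deriv_T_vec[of t g g1, OF t dg(1)[OF t]]])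
      show "(T_lift g g1 has_vector_derivative
          - (A1 t *v T_lift g g1 t) - A0 t *v (\<phi> (t, y t) - \<xi> (t, y t) *\<^sub>R y1 t)) (at t)"
        using deriv_T_lift[of t g g1, OF t dg[OF t]] unfolding char[OF t] by (simp add: mv.zero_right)
    qed
  qed
  moreover have "non_Cartan I \<xi>"
  proof (rule ccontr)
    assume nC: "\<not> non_Cartan I \<xi>"
    have "\<alpha> x0 \<bullet> (S x0 *v axis j 1) = 0" for j
    proof -
      have P: "(x0, p x0) \<in> I \<times> UNIV" using x0 by simp
      have "((\<lambda>t. (x0, p x0 + t *\<^sub>R axis j 1)) has_vector_derivative (0, axis j 1)) (at 0)"
        by (intro has_vector_derivative_Pair) (auto intro!: derivative_eq_intros)
      from has_vector_derivative_curve[OF \<xi> this] P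
      have "((\<lambda>t. \<xi> (x0, p x0 + t *\<^sub>R axis j 1)) has_vector_derivative
          frechet_derivative \<xi> (at (x0, p x0)) (0, axis j 1)) (at 0)" by simp
      moreover have "frechet_derivative \<xi> (at (x0, p x0)) (0, axis j 1) = 0"
        using nC x0 unfolding non_Cartan_def by blast
      moreover have "((\<lambda>t. \<xi> (x0, p x0 + t *\<^sub>R axis j 1)) has_vector_derivative
          \<alpha> x0 \<bullet> (S x0 *v axis j 1)) (at 0)"
        unfolding \<xi>_def by (auto simp: mv.scaleR_right intro!: derivative_eq_intros)
      ultimately show ?thesis
        using vector_derivative_unique_at by metis
    qed
    then have "\<alpha> x0 \<bullet> (S x0 *v v) = 0" for v
      by (subst vec2_expand[of v]) (simp add: mv_simps inner_add_right)
    from this[of "T x0 *v \<alpha> x0"] show False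
      by (simp add: S_T_vec[OF x0] \<alpha>(2))
  qed
  ultimately show ?thesis by blast
qed

end

text \<open>The inverse X satisfies X' = 1 / \<open>\<zeta>1\<close> at X, so its regularity
  bootstraps itself.\<close>

lemma smooth_inverse_1d:
  fixes \<zeta> :: "real \<Rightarrow> real"
  assumes J: "open J" "is_interval J"
    and \<zeta>: "\<And>t. t \<in> J \<Longrightarrow> (\<zeta> has_vector_derivative \<zeta>1 t) (at t)"
    and pos: "\<And>t. t \<in> J \<Longrightarrow> \<zeta>1 t > 0" and sm: "smooth_on \<zeta>1 J"
  obtains X where "open (\<zeta> ` J)" "smooth_on X (\<zeta> ` J)" "\<And>t. t \<in> J \<Longrightarrow> X (\<zeta> t) = t"
proof -
  have mono: "\<zeta> s < \<zeta> t" if "s \<in> J" "t \<in> J" "s < t" for s t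
  proof (rule DERIV_pos_imp_increasing[OF that(3)])
    fix r assume "s \<le> r" "r \<le> t"
    then have "r \<in> J" using mem_is_interval_1_I[OF J(2) that(1,2)] by blast
    then show "\<exists>y. DERIV \<zeta> r :> y \<and> y > 0"
      using \<zeta> pos by (auto simp: has_real_derivative_iff_has_vector_derivative)
  qed
  have inj: "inj_on \<zeta> J"
    by (rule linorder_inj_onI') (use mono in force)
  have cont: "continuous_on J \<zeta>"
    using \<zeta> by (auto intro!: continuous_at_imp_continuous_on has_vector_derivative_continuous)
  have op: "open (\<zeta> ` J)"
    using injective_eq_1d_open_map_UNIV[OF cont J(2)] inj J(1) by blast
  define X where "X = the_inv_into J \<zeta>"
  have X: "X (\<zeta> t) = t" if "t \<in> J" for t
    unfolding X_def by (rule the_inv_into_f_f[OF inj that])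
  have "smooth_on X (\<zeta> ` J)"
  proof (rule smooth_on_realI[OF op])
    show "(X has_vector_derivative inverse (\<zeta>1 (X z))) (at z)" if z: "z \<in> \<zeta> ` J" for z
    proof -
      obtain t where t: "t \<in> J" "z = \<zeta> t" using z by blast
      have "(X has_derivative (\<lambda>h. h *\<^sub>R inverse (\<zeta>1 t))) (at (\<zeta> t))"
      proof (rule has_derivative_inverse_strong[OF J(1) t(1) cont X \<zeta>[OF t(1), unfolded has_vector_derivative_def]])
        show "(\<lambda>h. h *\<^sub>R \<zeta>1 t) \<circ> (\<lambda>h. h *\<^sub>R inverse (\<zeta>1 t)) = id"
          using pos[OF t(1)] by (auto simp: fun_eq_iff)
      qed
      then show ?thesis using X[OF t(1)] t(2) by (simp add: has_vector_derivative_def)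
    qed
    show "Ck_on k (\<lambda>z. inverse (\<zeta>1 (X z))) (\<zeta> ` J)" if "Ck_on k X (\<zeta> ` J)" for k
    proof (rule Ck_on_compose[OF op J(1) _ that])
      show "Ck_on k (\<lambda>t. inverse (\<zeta>1 t)) J"
        using smooth_on_inverse[OF J(1) sm] pos by (force simp: smooth_on_def)
      show "X ` \<zeta> ` J \<subseteq> J" using X by auto
    qed
  qed
  then show ?thesis using that[OF op _ X] by blast
qed

context gauged_system
begin

text \<open>Every solution is u = c a + s d with constant vectors a and d, hence u / c = a + z d for
  z = s / c, a straight line. The choice \<open>c x0 = 1\<close> keeps c positive near x0.\<close>

lemma reducible_of_scalar:
  assumes q: "\<And>x v. x \<in> I \<Longrightarrow> Q x *v v = q x *\<^sub>R v" and smq: "smooth_on q I"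
  shows "reducible_to_trivial I \<Delta>"
  unfolding reducible_to_trivial_def
proof
  fix P0 :: point assume "P0 \<in> I \<times> UNIV"
  then obtain x0 y0 where P0: "P0 = (x0, y0)" and x0: "x0 \<in> I" by (cases P0) auto
  obtain p p1 where smp: "smooth_on p I" "smooth_on p1 I" and p: "solves p p1"
    using smooth_solution_exists[OF x0] by blast
  have smq': "smooth_on (\<lambda>t. - q t) I"
    using smooth_on_linear_compose[OF I(1) bounded_linear_minus[OF bounded_linear_ident] smq] by simp
  have scalar_sol: "\<exists>c c1. smooth_on c I \<and> smooth_on c1 I \<and> c x0 = v0 \<and> c1 x0 = v1 \<and>
     (\<forall>t\<in>I. (c has_vector_derivative c1 t) (at t) \<and> (c1 has_vector_derivative - (q t * c t)) (at t))"
    for v0 v1 :: real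
  proof -
    obtain c c1 where "smooth_on c I" "smooth_on c1 I" "c x0 = v0" "c1 x0 = v1"
      "\<And>t. t \<in> I \<Longrightarrow> (c has_vector_derivative c1 t) (at t)"
      "\<And>t. t \<in> I \<Longrightarrow> (c1 has_vector_derivative 0 + 0 * c1 t + - q t * c t) (at t)"
      using linear_ode2[OF I x0 bounded_bilinear_mult smooth_on_const[OF I(1)] smq' smooth_on_const[OF I(1)]]
      by blast
    then show ?thesis by (intro exI[of _ c] exI[of _ c1]) simp
  qed
  obtain c c1 where smc: "smooth_on c I" "smooth_on c1 I" and c0: "c x0 = 1" "c1 x0 = 0"
    and dc: "\<And>t. t \<in> I \<Longrightarrow> (c has_vector_derivative c1 t) (at t)"
      "\<And>t. t \<in> I \<Longrightarrow> (c1 has_vector_derivative - (q t * c t)) (at t)"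
    using scalar_sol[of 1 0] by blast
  obtain s s1 where sms: "smooth_on s I" and s0: "s x0 = 0" "s1 x0 = 1"
    and ds: "\<And>t. t \<in> I \<Longrightarrow> (s has_vector_derivative s1 t) (at t)"
      "\<And>t. t \<in> I \<Longrightarrow> (s1 has_vector_derivative - (q t * s t)) (at t)"
    using scalar_sol[of 0 1] by blast
  note mult_deriv = bounded_bilinear.has_vector_derivative[OF bounded_bilinear_mult]
  \<comment> \<open>This normalises z' to 1 / c^2, so z is increasing and d/dz is c^2 d/dx.\<close>
  have wronskian: "c t * s1 t - s t * c1 t = 1" if t: "t \<in> I" for t
  proof -
    have "((\<lambda>t. c t * s1 t - s t * c1 t) has_vector_derivative 0) (at r)" if r: "r \<in> I" for r
    proof -
      have "((\<lambda>t. c t * s1 t - s t * c1 t) has_vector_derivative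
        (c r * - (q r * s r) + c1 r * s1 r) - (s r * - (q r * c r) + s1 r * c1 r)) (at r)"
        by (intro has_vector_derivative_diff mult_deriv dc ds r)
      then show ?thesis by (rule has_vector_derivative_eq_rhs) (simp add: algebra_simps)
    qed
    from const_of_vector_derivative_zero[OF I(2) this t x0] show ?thesis by (simp add: c0 s0)
  qed
  have "open (I \<inter> c -` {0<..})"
    by (rule continuous_open_preimage[OF smooth_on_continuous_on[OF smc(1)] I(1)]) auto
  moreover have "x0 \<in> I \<inter> c -` {0<..}" using x0 c0 by simp
  ultimately obtain e where e: "e > 0" "ball x0 e \<subseteq> I \<inter> c -` {0<..}"
    using open_contains_ball by blast
  define J where "J = ball x0 e"
  have J: "open J" "is_interval J" "x0 \<in> J" "J \<subseteq> I" and cpos: "\<And>t. t \<in> J \<Longrightarrow> c t > 0"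
    using e by (auto simp: J_def is_interval_ball_real)
  note onJ = smooth_on_subset[OF _ J(4)]
  define k where "k t = inverse (c t)" for t
  have smk: "smooth_on k J"
    unfolding k_def[abs_def] using cpos by (intro smooth_on_inverse J onJ smc) force
  have dk: "(k has_vector_derivative - (c1 t * (k t)\<^sup>2)) (at t)" if t: "t \<in> J" for t
  proof -
    have "(c has_real_derivative c1 t) (at t)"
      using dc(1)[of t] t J by (auto simp: has_real_derivative_iff_has_vector_derivative)
    from DERIV_inverse'[OF this] cpos[OF t] show ?thesis
      unfolding has_real_derivative_iff_has_vector_derivative k_def
      by (simp add: power2_eq_square mult_ac)
  qed
  have ck: "c t * k t = 1" if "t \<in> J" for t using cpos[OF that] by (simp add: k_def)
  define \<zeta> where "\<zeta> t = s t * k t" for t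
  have d\<zeta>: "(\<zeta> has_vector_derivative (k t)\<^sup>2) (at t)" if t: "t \<in> J" for t
  proof -
    have tI: "t \<in> I" using t J by auto
    have "(\<zeta> has_vector_derivative s t * - (c1 t * (k t)\<^sup>2) + s1 t * k t) (at t)"
      unfolding \<zeta>_def[abs_def] by (intro mult_deriv ds dk t tI)
    moreover have "s t * - (c1 t * (k t)\<^sup>2) + s1 t * k t = (k t)\<^sup>2 * (c t * s1 t - s t * c1 t)"
      using ck[OF t] by (simp add: power2_eq_square algebra_simps)
    ultimately show ?thesis by (simp add: wronskian[OF tI])
  qed
  have smk2: "smooth_on (\<lambda>t. (k t)\<^sup>2) J"
    unfolding power2_eq_square by (intro smooth_on_bilinear[OF J(1) bounded_bilinear_mult] smk)
  have sm\<zeta>: "smooth_on \<zeta> J"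
    unfolding \<zeta>_def[abs_def] by (intro smooth_on_bilinear[OF J(1) bounded_bilinear_mult] smk onJ[OF sms])
  have k2pos: "(k t)\<^sup>2 > 0" if "t \<in> J" for t using cpos[OF that] by (simp add: k_def)
  obtain X where op: "open (\<zeta> ` J)" and smX: "smooth_on X (\<zeta> ` J)" and X: "\<And>t. t \<in> J \<Longrightarrow> X (\<zeta> t) = t"
    using smooth_inverse_1d[OF J(1,2) d\<zeta> k2pos smk2] by blast
  let ?U = "J \<times> (UNIV :: (real^2) set)" and ?V = "\<zeta> ` J \<times> (UNIV :: (real^2) set)"
  have oU: "open ?U" and oV: "open ?V" using J(1) op by (auto intro: open_Times)
  define \<Psi> :: "point \<Rightarrow> point" where
    "\<Psi> P = (\<zeta> (fst P), k (fst P) *\<^sub>R (S (fst P) *v (snd P - p (fst P))))" for P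
  define \<Theta> :: "point \<Rightarrow> point" where
    "\<Theta> R = (X (fst R), p (X (fst R)) + c (X (fst R)) *\<^sub>R (T (X (fst R)) *v snd R))" for R
  note baseU = smooth_on_of_fst[OF J(1)]
  have sm\<Psi>: "smooth_on \<Psi> ?U"
    unfolding \<Psi>_def[abs_def]
    by (intro smooth_on_Pair[OF oU] smooth_on_bilinear[OF oU bounded_bilinear_scaleR]
        smooth_on_bilinear[OF oU bounded_bilinear_matrix_vector_mult] smooth_on_diff[OF oU]
        smooth_on_bounded_linear[OF oU bounded_linear_snd]
        baseU[OF sm\<zeta>] baseU[OF smk] baseU[OF onJ[OF S]] baseU[OF onJ[OF smp(1)]])
  have baseV: "smooth_on (\<lambda>R :: point. f (X (fst R))) ?V" if "smooth_on f I"
    for f :: "real \<Rightarrow> 'a::real_normed_vector"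
    by (rule smooth_on_of_fst[OF op smooth_on_compose[OF op J(1) onJ[OF that] smX]]) (use X in auto)
  have sm\<Theta>: "smooth_on \<Theta> ?V"
    unfolding \<Theta>_def[abs_def]
    by (intro smooth_on_Pair[OF oV] smooth_on_add[OF oV] smooth_on_bilinear[OF oV bounded_bilinear_scaleR]
        smooth_on_bilinear[OF oV bounded_bilinear_matrix_vector_mult]
        smooth_on_bounded_linear[OF oV bounded_linear_snd]
        smooth_on_of_fst[OF op smX] baseV[OF smc(1)] baseV[OF T] baseV[OF smp(1)])
  have \<Theta>\<Psi>: "\<Theta> (\<Psi> P) = P" if "P \<in> ?U" for P
  proof -
    have x: "fst P \<in> J" "fst P \<in> I" using that J(4) by auto
    show ?thesis
      using ck[OF x(1)] by (simp add: \<Theta>_def \<Psi>_def X[OF x(1)] mv.scaleR_right T_S_vec[OF x(2)])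
  qed
  have \<Psi>\<Theta>: "\<Psi> (\<Theta> R) = R" if R: "R \<in> ?V" for R
  proof -
    obtain t where t: "t \<in> J" "fst R = \<zeta> t" using R by (auto simp: mem_Times_iff)
    then have tI: "t \<in> I" using J(4) by auto
    show ?thesis
      using ck[OF t(1)]
      by (simp add: prod_eq_iff \<Theta>_def \<Psi>_def t(2) X[OF t(1)] mv.scaleR_right S_T_vec[OF tI] mult.commute)
  qed
  have "homeomorphism ?U ?V \<Psi> \<Theta>"
  proof (rule homeomorphismI)
    show "continuous_on ?U \<Psi>" "continuous_on ?V \<Theta>"
      by (intro smooth_on_continuous_on sm\<Psi> sm\<Theta>)+
    show "\<Psi> ` ?U \<subseteq> ?V" by (auto simp: \<Psi>_def)
    show "\<Theta> ` ?V \<subseteq> ?U" using X by (auto simp: \<Theta>_def)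
  qed (use \<Theta>\<Psi> \<Psi>\<Theta> in auto)
  then have diffeo: "diffeo_on ?U \<Psi>"
    unfolding diffeo_on_def using oU oV sm\<Psi> sm\<Theta> by blast
  have trans: "transforms_to_trivial ?U \<Delta> \<Psi>"
    unfolding transforms_to_trivial_def
  proof (intro allI impI, elim conjE)
    fix x y y1 y2 assume xU: "(x, y) \<in> ?U" and Z: "Dx0 (fst \<circ> \<Psi>) (x, y, y1) \<noteq> 0"
    have x: "x \<in> J" "x \<in> I" using xU J(4) by auto
    \<comment> \<open>A parabola with the prescribed second-order jet at x. It need not solve the
      system, as both directions of the equivalence are to be shown.\<close>
    define Y where "Y t = y + ((t - x) *\<^sub>R y1 + ((t - x)\<^sup>2 / 2) *\<^sub>R y2)" for t
    define Y1 where "Y1 t = y1 + (t - x) *\<^sub>R y2" for t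
    have dY: "(Y has_vector_derivative Y1 t) (at t)" "(Y1 has_vector_derivative y2) (at t)" for t
      unfolding Y_def[abs_def] Y1_def[abs_def]
      by (auto intro!: derivative_eq_intros simp: has_real_derivative_iff_has_vector_derivative)
    have Yx: "Y x = y" "Y1 x = y1" by (simp_all add: Y_def Y1_def)
    define u where "u t = S t *v (Y t - p t)" for t
    define u1 where "u1 = S_lift (\<lambda>t. Y t - p t) (\<lambda>t. Y1 t - p1 t)"
    have du: "(u has_vector_derivative u1 t) (at t)" if "t \<in> I" for t
      unfolding u_def[abs_def] u1_def
      using p that by (intro deriv_S_vec has_vector_derivative_diff dY) (auto simp: solves_def)
    have du1: "(u1 has_vector_derivative S x *v \<Delta> (x, y, y1, y2) - q x *\<^sub>R u x) (at x)"
    proof -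
      have "(u1 has_vector_derivative S x *v ((y2 - rhs x (p x) (p1 x)) + A1 x *v (Y1 x - p1 x)
          + A0 x *v (Y x - p x)) - Q x *v (S x *v (Y x - p x))) (at x)"
        unfolding u1_def
        using p x(2) by (intro deriv_S_lift has_vector_derivative_diff dY) (auto simp: solves_def)
      then show ?thesis
        by (rule has_vector_derivative_eq_rhs)
          (simp add: Yx q[OF x(2)] u_def lin_sys_def rhs_def mv_simps algebra_simps)
    qed
    have jetZ: "Dx0 (fst \<circ> \<Psi>) (t, Y t, Y1 t) = (k t)\<^sup>2" if t: "t \<in> J" for t
    proof (rule vector_derivative_unique_at)
      have "(fst \<circ> \<Psi>) differentiable (at (t, Y t))"
        using smooth_on_differentiable[OF smooth_on_linear_compose[OF oU bounded_linear_fst sm\<Psi>], of "(t, Y t)"] t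
        by (simp add: o_def)
      from has_vector_derivative_Dx0[OF this dY(1)]
      show "(\<zeta> has_vector_derivative Dx0 (fst \<circ> \<Psi>) (t, Y t, Y1 t)) (at t)"
        by (simp add: \<Psi>_def)
    qed (rule d\<zeta>[OF t])
    have jetW: "Dx0 (snd \<circ> \<Psi>) (t, Y t, Y1 t) = k t *\<^sub>R u1 t + (- (c1 t * (k t)\<^sup>2)) *\<^sub>R u t" if t: "t \<in> J" for t
    proof (rule vector_derivative_unique_at)
      have "(snd \<circ> \<Psi>) differentiable (at (t, Y t))"
        using smooth_on_differentiable[OF smooth_on_linear_compose[OF oU bounded_linear_snd sm\<Psi>], of "(t, Y t)"] t
        by (simp add: o_def)
      from has_vector_derivative_Dx0[OF this dY(1)]
      show "((\<lambda>t. k t *\<^sub>R u t) has_vector_derivative Dx0 (snd \<circ> \<Psi>) (t, Y t, Y1 t)) (at t)"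
        by (simp add: \<Psi>_def u_def)
      show "((\<lambda>t. k t *\<^sub>R u t) has_vector_derivative k t *\<^sub>R u1 t + (- (c1 t * (k t)\<^sup>2)) *\<^sub>R u t) (at t)"
        using t J(4) by (intro scaleR_deriv dk du) auto
    qed
    \<comment> \<open>The operator c^2 d/dx applied to u / c. Differentiating once more cancels the
      terms with c' u' and leaves c (u'' + q u), the transported residual.\<close>
    have nd1: "new_deriv1 \<Psi> (t, Y t, Y1 t) = c t *\<^sub>R u1 t - c1 t *\<^sub>R u t" if t: "t \<in> J" for t
    proof -
      have "inverse ((k t)\<^sup>2) * k t = c t" "inverse ((k t)\<^sup>2) * (c1 t * (k t)\<^sup>2) = c1 t"
        using cpos[OF t] by (simp_all add: k_def power2_eq_square field_simps)
      then show ?thesis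
        by (simp only: new_deriv1_def jetZ[OF t] jetW[OF t] scaleR_add_right scaleR_scaleR
            scaleR_minus_left mult_minus_right) simp
    qed
    have "Dx1 (new_deriv1 \<Psi>) (x, Y x, Y1 x, y2) = (c x *\<^sub>R (S x *v \<Delta> (x, y, y1, y2) - q x *\<^sub>R u x) + c1 x *\<^sub>R u1 x)
        - (c1 x *\<^sub>R u1 x + (- (q x * c x)) *\<^sub>R u x)"
    proof (rule vector_derivative_unique_at)
      have "new_deriv1 \<Psi> differentiable (at (x, Y x, Y1 x))"
        by (rule new_deriv1_differentiable[OF oU sm\<Psi>]) (use xU Z in \<open>simp_all add: Yx\<close>)
      from has_vector_derivative_Dx1[OF this dY(1) dY(2)]
      have "((\<lambda>t. new_deriv1 \<Psi> (t, Y t, Y1 t)) has_vector_derivative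
          Dx1 (new_deriv1 \<Psi>) (x, Y x, Y1 x, y2)) (at x)" .
      from has_vector_derivative_cong_open[OF J(1) x(1) nd1 this]
      show "((\<lambda>t. c t *\<^sub>R u1 t - c1 t *\<^sub>R u t) has_vector_derivative
          Dx1 (new_deriv1 \<Psi>) (x, Y x, Y1 x, y2)) (at x)" .
      show "((\<lambda>t. c t *\<^sub>R u1 t - c1 t *\<^sub>R u t) has_vector_derivative
         (c x *\<^sub>R (S x *v \<Delta> (x, y, y1, y2) - q x *\<^sub>R u x) + c1 x *\<^sub>R u1 x)
        - (c1 x *\<^sub>R u1 x + (- (q x * c x)) *\<^sub>R u x)) (at x)"
        by (intro has_vector_derivative_diff scaleR_deriv dc du du1 x)
    qed
    then have "Dx1 (new_deriv1 \<Psi>) (x, y, y1, y2) = c x *\<^sub>R (S x *v \<Delta> (x, y, y1, y2))"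
      by (simp add: Yx algebra_simps)
    then have "new_deriv2 \<Psi> (x, y, y1, y2) = 0 \<longleftrightarrow> S x *v \<Delta> (x, y, y1, y2) = 0"
      using Z cpos[OF x(1)] by (simp add: new_deriv2_def)
    also have "\<dots> \<longleftrightarrow> \<Delta> (x, y, y1, y2) = 0"
      using T_S_vec[OF x(2)] mv.zero_right by metis
    finally show "\<Delta> (x, y, y1, y2) = 0 \<longleftrightarrow> new_deriv2 \<Psi> (x, y, y1, y2) = 0" ..
  qed
  have "P0 \<in> ?U" "?U \<subseteq> I \<times> UNIV" using P0 J by auto
  then show "\<exists>U \<Psi>. P0 \<in> U \<and> U \<subseteq> I \<times> UNIV \<and> diffeo_on U \<Psi> \<and> transforms_to_trivial U \<Delta> \<Psi>"
    by (intro exI[of _ ?U] exI[of _ \<Psi>] conjI diffeo trans)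
qed

end

theorem theorem4:
  fixes I :: "real set"
    and A1 A0 :: "real \<Rightarrow> real^2^2"
    and b :: "real \<Rightarrow> real^2"
  assumes "open I" and "is_interval I" and "I \<noteq> {}"
    and "smooth_on A1 I" and "smooth_on A0 I" and "smooth_on b I"
  shows "reducible_to_trivial I (lin_sys A1 A0 b) \<longleftrightarrow>
    (\<exists>\<xi> \<phi>. lie_symmetry I (lin_sys A1 A0 b) \<xi> \<phi> \<and> non_Cartan I \<xi>)"
proof -
  interpret linear_system I A1 A0 b
    by unfold_locales (use assms in auto)
  obtain x0 where x0: "x0 \<in> I" using assms(3) by blast
  obtain T S where "gauged_system I A1 A0 b T S" using gauge_exists[OF x0] .
  then interpret gauged_system I A1 A0 b T S .
  \<comment> \<open>A scalar matrix is its upper left entry times the identity; this entry is a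
    smooth choice of q.\<close>
  have smq: "smooth_on (\<lambda>x. Q x $ 1 $ 1) I"
    by (intro smooth_on_linear_compose[OF I(1) bounded_linear_vec_nth] smooth_Q)
  show ?thesis
  proof
    assume "reducible_to_trivial I \<Delta>"
    from scalar_matrix_of_wedge[OF scalar_of_reducible[OF this]]
    show "\<exists>\<xi> \<phi>. lie_symmetry I \<Delta> \<xi> \<phi> \<and> non_Cartan I \<xi>"
      by (rule symmetry_exists_of_scalar[OF _ x0])
  next
    assume "\<exists>\<xi> \<phi>. lie_symmetry I \<Delta> \<xi> \<phi> \<and> non_Cartan I \<xi>"
    then obtain \<xi> \<phi> where "lie_symmetry I \<Delta> \<xi> \<phi>" "non_Cartan I \<xi>" by blast
    from scalar_matrix_of_wedge[OF scalar_of_non_Cartan[OF this]]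
    show "reducible_to_trivial I \<Delta>"
      by (rule reducible_of_scalar[OF _ smq])
  qed
qed

end
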